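(* For every fixed $\beta>0$ and every fixed integer $\Delta\ge 3$ there exist positive constants $c$, $C$, $c'$ (depending only on $\beta$ and $\Delta$) and an integer $n_0$ such that the following holds for every $n\ge n_0$ with $\Delta n$ even and every real $\alpha$ with $\beta\log n\le\alpha\le n$. Let $G_n$ be a uniformly random simple $\Delta$-regular graph on the vertex set $[n]=\{1,\dots,n\}$, conditioned on the event of being connected, viewed as a metric space with its shortest-path metric. For real $d$, let $\mathcal{B}(d)$ denote the set of real normed spaces of dimension at most $d$, and let $k:=k_n^\alpha(\ell_\infty)$. Then $$ \mathbb{P}\big[\exists\, X\in\mathcal{B}(c\,k):\ G_n \text{ embeds into } X \text{ with distortion at most } \alpha\big]\le e^{-c'\,n\log n}, $$ and $$ \mathbb{P}\big[\exists\, X\in\mathcal{B}(C\,k):\ G_n \text{ embeds into } X \text{ with distortion at most } \alpha\big]=1 . $$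
   Context: A metric space $(M,d_M)$ embeds into a normed space $X$ with (bi-Lipschitz) distortion at most $\alpha$ if there is a map $f:M\to X$ with $\|f(s)-f(s')\|_X\le d_M(s,s')\le\alpha\|f(s)-f(s')\|_X$ for all $s,s'\in M$ (by rescaling $f$, the equivalent normalization $d_M(s,s')\le \|f(s)-f(s')\|_X\le\alpha\, d_M(s,s')$ may be used). Metric dimension reduction modulus: for $n\in\mathbb{N}$, $\alpha\in[1,\infty)$ and a normed space $X$ (possibly infinite-dimensional), $k_n^\alpha(X)$ is the minimum $k\in\mathbb{N}$ such that every $n$-point subset $S\subset X$ embeds, with bi-Lipschitz distortion at most $\alpha$, into some $k$-dimensional linear subspace $F_S$ of $X$ (with the metric induced by $X$). $\ell_\infty$ is the space of bounded real sequences with the supremum norm. *)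

theory Defs
  imports "HOL-Probability.Probability"
begin

definition embeds_with_distortion ::
    "'p set \<Rightarrow> ('p \<Rightarrow> 'p \<Rightarrow> real) \<Rightarrow> 'q set \<Rightarrow> ('q \<Rightarrow> 'q \<Rightarrow> real) \<Rightarrow> real \<Rightarrow> bool" where
  "embeds_with_distortion M dM X dX \<alpha> \<longleftrightarrow>
     (\<exists>f \<in> M \<rightarrow> X. \<forall>s\<in>M. \<forall>s'\<in>M. dX (f s) (f s') \<le> dM s s' \<and> dM s s' \<le> \<alpha> * dX (f s) (f s'))"

text \<open>The library's \<^const>\<open>dim\<close> is \<open>0\<close> on infinite-dimensional spaces, hence the explicit basis.\<close>

definition has_dimension :: "'a::real_vector set \<Rightarrow> nat \<Rightarrow> bool" where
  "has_dimension F k \<longleftrightarrow> (\<exists>B. finite B \<and> independent B \<and> span B = F \<and> card B = k)"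

definition dim_red_modulus :: "'a::real_normed_vector itself \<Rightarrow> nat \<Rightarrow> real \<Rightarrow> nat" where
  "dim_red_modulus _ n \<alpha> =
     (LEAST k. \<forall>S::'a set. finite S \<and> card S = n \<longrightarrow>
        (\<exists>F::'a set. has_dimension F k \<and> embeds_with_distortion S dist F dist \<alpha>))"

text \<open>Since \<^typ>\<open>nat\<close> is discrete, bounded continuous functions on it are exactly the bounded
  sequences, and the norm of this type is the supremum norm.\<close>

type_synonym linf = "nat \<Rightarrow>\<^sub>C real"

text \<open>An event cannot quantify over types, so a normed space of dimension \<open>m\<close> is given in
  coordinates with respect to a basis: as a norm on \<open>\<real>\<^sup>m\<close>, whose elements are the real sequences
  vanishing from index \<open>m\<close> on. Lemma \<open>normed_space_in_coordinates\<close> shows that this covers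
  all \<open>m\<close>-dimensional normed spaces up to linear isometry.\<close>

definition coord_space :: "nat \<Rightarrow> (nat \<Rightarrow> real) set" where
  "coord_space m = {x. \<forall>i\<ge>m. x i = 0}"

definition norm_on_coord_space :: "nat \<Rightarrow> ((nat \<Rightarrow> real) \<Rightarrow> real) \<Rightarrow> bool" where
  "norm_on_coord_space m N \<longleftrightarrow>
     (\<forall>x\<in>coord_space m. N x \<ge> 0 \<and> (N x = 0 \<longleftrightarrow> x = (\<lambda>_. 0))) \<and>
     (\<forall>a. \<forall>x\<in>coord_space m. N (\<lambda>i. a * x i) = \<bar>a\<bar> * N x) \<and>
     (\<forall>x\<in>coord_space m. \<forall>y\<in>coord_space m. N (\<lambda>i. x i + y i) \<le> N x + N y)"

definition embeds_in_dimension_at_most ::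
    "'p set \<Rightarrow> ('p \<Rightarrow> 'p \<Rightarrow> real) \<Rightarrow> real \<Rightarrow> real \<Rightarrow> bool" where
  "embeds_in_dimension_at_most M dM d \<alpha> \<longleftrightarrow>
     (\<exists>m N. real m \<le> d \<and> norm_on_coord_space m N \<and>
        embeds_with_distortion M dM (coord_space m) (\<lambda>x y. N (\<lambda>i. x i - y i)) \<alpha>)"

lemma normed_space_in_coordinates:
  fixes F :: "'a::real_normed_vector set"
  assumes "has_dimension F m"
  shows "\<exists>N \<phi>. norm_on_coord_space m N \<and> bij_betw \<phi> (coord_space m) F \<and>
           (\<forall>x\<in>coord_space m. norm (\<phi> x) = N x) \<and>
           (\<forall>x\<in>coord_space m. \<forall>y\<in>coord_space m. \<phi> (\<lambda>i. x i + y i) = \<phi> x + \<phi> y) \<and>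
           (\<forall>a. \<forall>x\<in>coord_space m. \<phi> (\<lambda>i. a * x i) = a *\<^sub>R \<phi> x)"
proof -
  obtain B where B: "finite B" "independent B" "span B = F" "card B = m"
    using assms unfolding has_dimension_def by blast
  obtain b where b: "bij_betw b {..<m} B"
    using ex_bij_betw_nat_finite[OF B(1)] B(4)
    by (auto simp: lessThan_atLeast0)
  define \<phi> where "\<phi> x = (\<Sum>i<m. x i *\<^sub>R b i)" for x :: "nat \<Rightarrow> real"
  define N where "N x = norm (\<phi> x)" for x :: "nat \<Rightarrow> real"
  have add: "\<phi> (\<lambda>i. x i + y i) = \<phi> x + \<phi> y" for x y
    by (simp add: \<phi>_def scaleR_add_left sum.distrib)
  have diff: "\<phi> (\<lambda>i. x i - y i) = \<phi> x - \<phi> y" for x y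
    by (simp add: \<phi>_def scaleR_diff_left sum_subtractf)
  have scale: "\<phi> (\<lambda>i. a * x i) = a *\<^sub>R \<phi> x" for a x
    by (simp add: \<phi>_def scaleR_sum_right)
  have \<phi>_B: "\<phi> x = (\<Sum>v\<in>B. x (the_inv_into {..<m} b v) *\<^sub>R v)" for x
    unfolding \<phi>_def
    by (subst sum.reindex_bij_betw[OF b, symmetric])
       (intro sum.cong refl, use b in \<open>auto simp: bij_betw_def the_inv_into_f_f\<close>)
  have ker: "x = (\<lambda>_. 0)" if x: "x \<in> coord_space m" and 0: "\<phi> x = 0" for x
  proof
    fix i
    show "x i = 0"
    proof (cases "i < m")
      case True
      then have bi: "b i \<in> B" and inv: "the_inv_into {..<m} b (b i) = i"
        using b by (auto simp: bij_betw_def the_inv_into_f_f)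
      have "x (the_inv_into {..<m} b (b i)) = 0"
        using independentD[OF B(2,1) subset_refl, of "\<lambda>v. x (the_inv_into {..<m} b v)" "b i"]
          0 bi by (simp add: \<phi>_B)
      then show ?thesis using inv by simp
    qed (use x in \<open>auto simp: coord_space_def\<close>)
  qed
  have "inj_on \<phi> (coord_space m)"
  proof (rule inj_onI)
    fix x y assume xy: "x \<in> coord_space m" "y \<in> coord_space m" "\<phi> x = \<phi> y"
    then have "(\<lambda>i. x i - y i) = (\<lambda>_. 0)"
      by (intro ker) (auto simp: diff coord_space_def)
    then show "x = y" by (metis eq_iff_diff_eq_0 ext)
  qed
  moreover have "\<phi> ` coord_space m = F"
  proof
    show "\<phi> ` coord_space m \<subseteq> F"
      unfolding B(3)[symmetric] \<phi>_B
      by (intro image_subsetI span_sum span_scale) (rule span_base)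
    show "F \<subseteq> \<phi> ` coord_space m"
    proof
      fix v assume "v \<in> F"
      then obtain u where u: "v = (\<Sum>w\<in>B. u w *\<^sub>R w)"
        unfolding B(3)[symmetric] span_finite[OF B(1)] by auto
      have "v = (\<Sum>i<m. u (b i) *\<^sub>R b i)"
        unfolding u by (rule sum.reindex_bij_betw[OF b, symmetric])
      then have "v = \<phi> (\<lambda>i. if i < m then u (b i) else 0)"
        by (simp add: \<phi>_def)
      moreover have "(\<lambda>i. if i < m then u (b i) else 0) \<in> coord_space m"
        by (simp add: coord_space_def)
      ultimately show "v \<in> \<phi> ` coord_space m" by blast
    qed
  qed
  moreover have "norm_on_coord_space m N"
  proof -
    have "\<phi> (\<lambda>_. 0) = 0" by (simp add: \<phi>_def)
    then show ?thesis
      unfolding norm_on_coord_space_def N_def add scale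
      using ker by (auto simp: norm_triangle_ineq)
  qed
  ultimately show ?thesis
    using add scale unfolding bij_betw_def N_def by blast
qed

text \<open>A simple graph on the vertex set \<open>{1..n}\<close> is identified with its set of edges, each edge
  being a two-element set of vertices.\<close>

definition regular_graphs :: "nat \<Rightarrow> nat \<Rightarrow> nat set set set" where
  "regular_graphs n \<Delta> =
     {E. (\<forall>e\<in>E. e \<subseteq> {1..n} \<and> card e = 2) \<and> (\<forall>v\<in>{1..n}. card {e\<in>E. v \<in> e} = \<Delta>)}"

definition adj :: "nat set set \<Rightarrow> (nat \<times> nat) set" where
  "adj E = {(u, v). {u, v} \<in> E}"

definition connected_graph :: "nat \<Rightarrow> nat set set \<Rightarrow> bool" where
  "connected_graph n E \<longleftrightarrow> (\<forall>u\<in>{1..n}. \<forall>v\<in>{1..n}. (u, v) \<in> (adj E)\<^sup>*)"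

text \<open>\<open>(u, v) \<in> adj E ^^ l\<close> says that there is a walk of length \<open>l\<close> from \<open>u\<close> to \<open>v\<close>.\<close>

definition graph_dist :: "nat set set \<Rightarrow> nat \<Rightarrow> nat \<Rightarrow> real" where
  "graph_dist E u v = real (LEAST l. (u, v) \<in> adj E ^^ l)"

text \<open>Conditioning is meaningful only if a connected \<open>\<Delta>\<close>-regular graph on \<open>{1..n}\<close> exists, which
  for \<open>\<Delta> \<ge> 3\<close> is the case as soon as \<open>n > \<Delta>\<close> and \<open>\<Delta> * n\<close> is even.\<close>

definition random_connected_regular_graph :: "nat \<Rightarrow> nat \<Rightarrow> nat set set pmf" where
  "random_connected_regular_graph n \<Delta> =
     cond_pmf (pmf_of_set (regular_graphs n \<Delta>)) {E. connected_graph n E}"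

end

theory Submission imports Defs begin

text \<open>
  Since every finite metric space embeds isometrically into the space of bounded sequences, every
  connected graph on \<open>n\<close> vertices embeds into dimension \<open>k\<close>, and the second claim holds with \<open>C = 1\<close>.

  For the first claim, let \<open>L = ln n\<close>. On the one hand \<open>k \<le> C\<^sub>0 L / ln (1 + \<alpha> / L)\<close>: a weighted
  Ramsey theorem provides a large subset of a given \<open>n\<close>-point space that is close to an ultrametric,
  random labels of the clusters of the ultrametric map it to the line, and this map extends
  to the whole space with the same Lipschitz constant. It resolves, at its own scale, a definite
  proportion of any given set of pairs of points, so few such maps serve as coordinates.
  On the other hand, if a graph embeds into dimension \<open>m \<le> c k\<close>, then the graph is one of at most
  \<open>n powr ((1 + \<epsilon>) n)\<close>: by a packing argument each vertex has \<open>n powr \<epsilon>\<close> candidates for its neighbours,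
  and the candidates are determined by a spanning tree, which costs \<open>n ^ n\<close>, together with rounded
  displacements along its edges. But there are \<open>n powr ((1 + \<theta>) n)\<close> connected \<open>\<Delta>\<close>-regular graphs
  with \<open>\<theta> > 0\<close>, already among the relabellings of graphs that contain the path \<open>1, \<dots>, n\<close>.
\<close>

section \<open>A weighted Ramsey theorem for ultrametrics\<close>

text \<open>Both bounds are governed by A = \<alpha> / ln n. For the lower bound put l = \<delta> ln
  n, so that a ball of radius l in the graph has only n powr O(\<delta>) vertices. Vertices at
  mutual distance above l whose images lie within O(\<alpha>) of a given one number at most (O(1) (1
  + \<alpha> / l)) ^ m by packing, which is at most n powr \<epsilon> when m is a small multiple of
  ln n / ln (1 + A). The condition \<alpha> \<ge> \<beta> ln n keeps ln (1 + A) away from 0, so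
  constants inside the logarithm cost only a constant factor in m.

  The obstacle is that the spanning tree is recorded vertex by vertex, so the number of codes is at
  least n ^ n. The leading exponents therefore have to be compared exactly, and the graphs must
  outnumber n ^ n by some n powr (\<theta> n), while factors exp (O(n)) are harmless. Relabelling
  one graph gives at most n!. The surplus comes from switching linearly many edges of a circulant
  graph in all possible ways; since \<Delta> \<ge> 3, there is room for this beside a Hamiltonian
  path.\<close>

lemma pigeonhole_growth:
  fixes b :: "nat \<Rightarrow> real"
  assumes "t \<ge> 1" and pos: "\<And>j. b j > 0" and "b t \<le> M"
  shows "\<exists>j<t. b (Suc j) \<le> b j * (M / b 0) powr (1 / t)"
proof (rule ccontr)
  let ?c = "(M / b 0) powr (1 / t)"
  assume "\<not> ?thesis"
  then have gr: "b (Suc j) > b j * ?c" if "j < t" for j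
    using that by force
  have Mpos: "M > 0" using pos[of t] assms(3) by linarith
  have c: "?c > 0" using Mpos pos[of 0] by simp
  have le: "b 0 * ?c ^ j \<le> b j" if "j \<le> t" for j
    using that
  proof (induction j)
    case (Suc j)
    have "b 0 * ?c ^ Suc j = (b 0 * ?c ^ j) * ?c" by simp
    also have "\<dots> \<le> b j * ?c" using Suc c by (intro mult_right_mono) auto
    finally show ?case using gr[of j] Suc.prems by simp
  qed simp
  obtain s where s: "t = Suc s" using assms(1) by (cases t) auto
  have "b 0 * ?c ^ t = (b 0 * ?c ^ s) * ?c" by (simp add: s)
  also have "\<dots> \<le> b s * ?c" using le[of s] s c by (intro mult_right_mono) auto
  also have "\<dots> < b t" using gr[of s] s by simp
  finally have "b 0 * ?c ^ t < M" using assms(3) by simp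
  moreover have "?c ^ t = M / b 0"
  proof -
    have "?c ^ t = ?c powr t" using c by (simp add: powr_realpow)
    then show ?thesis using assms(1) pos[of 0] Mpos by (simp add: powr_powr)
  qed
  ultimately show False using pos[of 0] by simp
qed

text \<open>Off the diagonal, \<open>s * 2 ^ \<rho> x y\<close> is an ultrametric within the factor
  \<open>A\<close> of the given metric. It is stored as an integer level because labels will be
  attached to the clusters of each level.\<close>

definition ultrametric_levels ::
    "'a::metric_space set \<Rightarrow> ('a \<Rightarrow> 'a \<Rightarrow> nat) \<Rightarrow> real \<Rightarrow> real \<Rightarrow> bool" where
  "ultrametric_levels W \<rho> s A \<longleftrightarrow>
     (\<forall>x\<in>W. \<rho> x x = 0) \<and> (\<forall>x\<in>W. \<forall>y\<in>W. \<rho> x y = \<rho> y x) \<and>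
     (\<forall>x\<in>W. \<forall>y\<in>W. \<forall>z\<in>W. \<rho> x z \<le> max (\<rho> x y) (\<rho> y z)) \<and>
     (\<forall>x\<in>W. \<forall>y\<in>W. x \<noteq> y \<longrightarrow> dist x y \<le> s * 2 ^ \<rho> x y \<and> s * 2 ^ \<rho> x y \<le> A * dist x y)"

text \<open>All cross pairs receive the common level \<open>l\<close>, which dominates the levels
  inside both parts. A triple that meets both parts has two cross pairs, so two of its sides have
  the maximal level.\<close>

lemma ultrametric_levels_join:
  fixes W1 W2 :: "'a::metric_space set"
  assumes u1: "ultrametric_levels W1 \<rho>1 s A" "\<And>x y. x \<in> W1 \<Longrightarrow> y \<in> W1 \<Longrightarrow> \<rho>1 x y \<le> l"
    and u2: "ultrametric_levels W2 \<rho>2 s A" "\<And>x y. x \<in> W2 \<Longrightarrow> y \<in> W2 \<Longrightarrow> \<rho>2 x y \<le> l"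
    and sep: "\<And>x y. x \<in> W1 \<Longrightarrow> y \<in> W2 \<Longrightarrow> dist x y \<le> s * 2 ^ l \<and> s * 2 ^ l \<le> A * dist x y"
    and disj: "W1 \<inter> W2 = {}"
  shows "\<exists>\<rho>. ultrametric_levels (W1 \<union> W2) \<rho> s A \<and>
           (\<forall>x\<in>W1 \<union> W2. \<forall>y\<in>W1 \<union> W2. \<rho> x y \<le> l)"
proof -
  define \<rho> where "\<rho> x y = (if x \<in> W1 \<and> y \<in> W1 then \<rho>1 x y
      else if x \<in> W2 \<and> y \<in> W2 then \<rho>2 x y else l)" for x y
  have eq: "\<rho> x y = \<rho>1 x y" if "x \<in> W1" "y \<in> W1" for x y using that by (simp add: \<rho>_def)
  have eq2: "\<rho> x y = \<rho>2 x y" if "x \<in> W2" "y \<in> W2" for x y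
    using that disj by (auto simp: \<rho>_def)
  have eq3: "\<rho> x y = l" "\<rho> y x = l" if "x \<in> W1" "y \<in> W2" for x y
    using that disj by (auto simp: \<rho>_def)
  have le: "\<rho> x y \<le> l" if "x \<in> W1 \<union> W2" "y \<in> W1 \<union> W2" for x y
    using that u1(2) u2(2) by (auto simp: \<rho>_def)
  have "ultrametric_levels (W1 \<union> W2) \<rho> s A"
    unfolding ultrametric_levels_def
  proof (intro conjI ballI impI)
    fix x assume "x \<in> W1 \<union> W2"
    then show "\<rho> x x = 0" using u1(1) u2(1) eq eq2 by (auto simp: ultrametric_levels_def)
  next
    fix x y assume "x \<in> W1 \<union> W2" "y \<in> W1 \<union> W2"
    then show "\<rho> x y = \<rho> y x" using u1(1) u2(1) eq eq2 eq3
      by (auto simp: ultrametric_levels_def)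
  next
    fix x y z assume xyz: "x \<in> W1 \<union> W2" "y \<in> W1 \<union> W2" "z \<in> W1 \<union> W2"
    have "\<rho> x z \<le> l" using le xyz by blast
    then show "\<rho> x z \<le> max (\<rho> x y) (\<rho> y z)"
      using xyz u1(1) u2(1) by (auto simp: eq eq2 eq3 ultrametric_levels_def)
  next
    fix x y assume xy: "x \<in> W1 \<union> W2" "y \<in> W1 \<union> W2" "x \<noteq> y"
    consider "x \<in> W1" "y \<in> W1" | "x \<in> W2" "y \<in> W2" | "x \<in> W1" "y \<in> W2" | "x \<in> W2" "y \<in> W1"
      using xy by blast
    then have "dist x y \<le> s * 2 ^ \<rho> x y \<and> s * 2 ^ \<rho> x y \<le> A * dist x y"
    proof cases
      case 1 then show ?thesis using u1(1) xy(3) eq by (simp add: ultrametric_levels_def)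
    next
      case 2 then show ?thesis using u2(1) xy(3) eq2 by (simp add: ultrametric_levels_def)
    next
      case 3 then show ?thesis using sep[of x y] eq3(1)[of x y] by simp
    next
      case 4 then show ?thesis using sep[of y x] eq3(2)[of y x] by (simp add: dist_commute)
    qed
    then show "dist x y \<le> s * 2 ^ \<rho> x y" "s * 2 ^ \<rho> x y \<le> A * dist x y" by blast+
  qed
  then show ?thesis using le by blast
qed

text \<open>The bound \<open>M\<close> on the weights of the balls of a quarter of the current scale makes the
  losses at successive scales telescope: carving around the heaviest ball of an eighth of the scale
  costs the ratio of the weights of the two balls, and the weight of the smaller one bounds
  the losses inside the carved cluster.\<close>

lemma ramsey_ultrametric_scale:
  fixes w :: "'a::metric_space \<Rightarrow> real" and t :: nat
  assumes "t \<ge> 1" and "s > 0" and "finite T"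
    and "\<And>x. x \<in> T \<Longrightarrow> w x \<ge> 1"
    and "\<And>x y. x \<in> T \<Longrightarrow> y \<in> T \<Longrightarrow> x \<noteq> y \<Longrightarrow> dist x y > s"
    and "\<And>x y. x \<in> T \<Longrightarrow> y \<in> T \<Longrightarrow> dist x y \<le> s * 2 ^ i"
    and "M \<ge> 1" and "\<And>x. x \<in> T \<Longrightarrow> sum w (T \<inter> cball x (s * 2 ^ i / 4)) \<le> M"
  shows "\<exists>W \<rho>. W \<subseteq> T \<and> ultrametric_levels W \<rho> s (8 * t) \<and> (\<forall>x\<in>W. \<forall>y\<in>W. \<rho> x y \<le> i) \<and>
           sum w T \<le> sum w W * M powr (1 / t)"
  using assms(3-)
proof (induction i arbitrary: T M)
  case 0
  have single: "x = y" if "x \<in> T" "y \<in> T" for x y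
    using 0(3)[OF that] 0(4)[OF that] by force
  have "ultrametric_levels T (\<lambda>_ _. 0) s (8 * t)"
    unfolding ultrametric_levels_def using single by auto
  moreover have "sum w T \<le> sum w T * M powr (1 / t)"
  proof -
    have "sum w T \<ge> 0" using 0(2) by (intro sum_nonneg) force
    moreover have "M powr (1 / t) \<ge> 1" using 0(5) by (intro ge_one_powr_ge_zero) auto
    ultimately show ?thesis by (simp add: mult_le_cancel_left1)
  qed
  ultimately show ?case by (intro exI[of _ T] exI[of _ "\<lambda>_ _. 0"]) auto
next
  case (Suc i)
  define D where "D = s * 2 ^ Suc i"
  have D: "D > 0" using assms(2) by (simp add: D_def)
  \<comment> \<open>At a fixed scale clusters are carved off one after another, hence an inner
    induction on the number of points; only a carved cluster moves on to the next smaller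
    scale.\<close>
  from Suc.prems show ?case
  proof (induction "card T" arbitrary: T rule: less_induct)
    case less
    note fin = less.prems(1)
    have w0: "w x \<ge> 0" if "x \<in> T" for x using less.prems(2)[OF that] by simp
    show ?case
    proof (cases "T = {}")
      case True
      then show ?thesis
        by (intro exI[of _ "{}"] exI[of _ "\<lambda>_ _. 0"]) (auto simp: ultrametric_levels_def)
    next
      case False
      define B where "B x r = T \<inter> cball x r" for x r
      have finB: "finite (B x r)" for x r using fin by (simp add: B_def)
      obtain x where x: "x \<in> T" "\<And>y. y \<in> T \<Longrightarrow> sum w (B y (D / 8)) \<le> sum w (B x (D / 8))"
        by (rule obtains_MAX[OF fin False, of "\<lambda>y. sum w (B y (D / 8))"])
          (metis Max_ge finite_imageI fin image_eqI)
      define m where "m = sum w (B x (D / 8))"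
      \<comment> \<open>The t shells between the radii D / 8 and D / 4 are the candidates for a cut.
        The outer radius keeps the carved ball within diameter D / 2, the next scale; the width D /
        (8 t) of a shell separates the ball from the remaining points and is the origin of the
        distortion 8 t.\<close>
      define r where "r j = D / 8 + j * (D / (8 * t))" for j :: nat
      define b where "b j = sum w (B x (r j))" for j
      have rpos: "r j \<ge> 0" for j using D by (simp add: r_def)
      have r0: "r 0 = D / 8" by (simp add: r_def)
      have rt: "r t = D / 4" using assms(1) by (simp add: r_def field_simps)
      have rmono: "r j \<le> r k" if "j \<le> k" for j k
        unfolding r_def using that D by (intro add_left_mono mult_right_mono) auto
      have rSuc: "r (Suc j) = r j + D / (8 * t)" for j
        by (simp add: r_def algebra_simps add_divide_distrib)
      have bge: "b j \<ge> 1" for j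
      proof -
        have "x \<in> B x (r j)" using x(1) rpos by (simp add: B_def)
        then have "w x \<le> b j" unfolding b_def
          by (rule member_le_sum) (use finB w0 in \<open>auto simp: B_def\<close>)
        then show ?thesis using less.prems(2)[OF x(1)] by linarith
      qed
      have bt: "b t \<le> M"
        using less.prems(6)[OF x(1)] unfolding b_def rt B_def D_def by simp
      have m: "m = b 0" by (simp add: m_def b_def r0)
      \<comment> \<open>The shell between \<open>r j\<close> and \<open>r (Suc j)\<close> is thrown
        away; this choice bounds the weight of ball and shell together by a multiple of the weight
        of the ball.\<close>
      obtain j where j: "j < t" "b (Suc j) \<le> b j * (M / m) powr (1 / t)"
        unfolding m using pigeonhole_growth[of t b M] assms(1) bt bge
        by (meson less_le_trans zero_less_one)
      define Cl where "Cl = B x (r j)"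
      define T' where "T' = T - B x (r (Suc j))"
      have rj: "r j \<le> D / 4" using rmono[of j t] j(1) rt by simp
      have ClT: "Cl \<subseteq> T" by (auto simp: Cl_def B_def)
      have "x \<in> B x (r (Suc j))" using x(1) rpos by (simp add: B_def)
      then have cardT': "card T' < card T"
        unfolding T'_def using fin x(1) by (intro psubset_card_mono) auto
      have ClD: "dist u v \<le> s * 2 ^ i" if "u \<in> Cl" "v \<in> Cl" for u v
      proof -
        have "dist x u \<le> D / 4" "dist x v \<le> D / 4"
          using that rj by (auto simp: Cl_def B_def)
        then have "dist u v \<le> D / 2" using dist_triangle3[of u v x] by linarith
        then show ?thesis by (simp add: D_def)
      qed
      have Clm: "sum w (Cl \<inter> cball y (s * 2 ^ i / 4)) \<le> m" if "y \<in> Cl" for y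
      proof -
        have "sum w (Cl \<inter> cball y (s * 2 ^ i / 4)) \<le> sum w (B y (D / 8))"
          by (rule sum_mono2) (use ClT w0 finB in \<open>auto simp: B_def D_def\<close>)
        also have "\<dots> \<le> m" unfolding m_def using x(2) that ClT by blast
        finally show ?thesis .
      qed
      have m1: "m \<ge> 1" using bge[of 0] m by simp
      obtain W1 \<rho>1 where W1: "W1 \<subseteq> Cl" "ultrametric_levels W1 \<rho>1 s (8 * t)"
          "\<forall>x\<in>W1. \<forall>y\<in>W1. \<rho>1 x y \<le> i" "sum w Cl \<le> sum w W1 * m powr (1 / t)"
        using Suc.IH[OF finite_subset[OF ClT fin] less.prems(2)[OF subsetD[OF ClT]]
            less.prems(3)[OF subsetD[OF ClT] subsetD[OF ClT]] ClD m1 Clm]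
        by auto
      have T'sub: "T' \<subseteq> T" by (auto simp: T'_def)
      have T'M: "sum w (T' \<inter> cball y (s * 2 ^ Suc i / 4)) \<le> M" if "y \<in> T'" for y
      proof -
        have "sum w (T' \<inter> cball y (s * 2 ^ Suc i / 4)) \<le> sum w (T \<inter> cball y (s * 2 ^ Suc i / 4))"
          by (rule sum_mono2) (use T'sub w0 fin in auto)
        also have "\<dots> \<le> M" using less.prems(6) that T'sub by blast
        finally show ?thesis .
      qed
      obtain W2 \<rho>2 where W2: "W2 \<subseteq> T'" "ultrametric_levels W2 \<rho>2 s (8 * t)"
          "\<forall>x\<in>W2. \<forall>y\<in>W2. \<rho>2 x y \<le> Suc i" "sum w T' \<le> sum w W2 * M powr (1 / t)"
        using less.hyps[OF cardT' finite_subset[OF T'sub fin] less.prems(2)[OF subsetD[OF T'sub]]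
            less.prems(3)[OF subsetD[OF T'sub] subsetD[OF T'sub]]
            less.prems(4)[OF subsetD[OF T'sub] subsetD[OF T'sub]] less.prems(5) T'M]
        by auto
      have sep: "dist u v \<le> s * 2 ^ Suc i \<and> s * 2 ^ Suc i \<le> real (8 * t) * dist u v"
        if "u \<in> W1" "v \<in> W2" for u v
      proof -
        have u: "u \<in> T" "dist x u \<le> r j" using that W1(1) by (auto simp: Cl_def B_def)
        have v: "v \<in> T" "dist x v > r (Suc j)" using that W2(1) by (auto simp: T'_def B_def)
        have "dist u v > D / (8 * t)"
          using dist_triangle[of x v u] u(2) v(2) rSuc[of j] by linarith
        then have "D \<le> real (8 * t) * dist u v"
          using assms(1) by (simp add: field_simps)
        then show ?thesis using less.prems(4)[OF u(1) v(1)] by (simp add: D_def)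
      qed
      have disj: "W1 \<inter> W2 = {}"
        using W1(1) W2(1) rmono[of j "Suc j"] by (fastforce simp: T'_def Cl_def B_def)
      obtain \<rho> where \<rho>: "ultrametric_levels (W1 \<union> W2) \<rho> s (8 * t)"
          "\<forall>x\<in>W1 \<union> W2. \<forall>y\<in>W1 \<union> W2. \<rho> x y \<le> Suc i"
        using ultrametric_levels_join[OF W1(2) _ W2(2) _ sep disj] W1(3) W2(3) by (metis le_Suc_eq)
      have "sum w (W1 \<union> W2) = sum w W1 + sum w W2"
        using disj W1(1) W2(1) ClT T'sub fin
        by (intro sum.union_disjoint) (meson finite_subset)+
      moreover have "sum w T = b (Suc j) + sum w T'"
        unfolding b_def T'_def by (subst sum.subset_diff[of "B x (r (Suc j))" T])
          (use fin in \<open>auto simp: B_def\<close>)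
      moreover have "b (Suc j) \<le> sum w W1 * M powr (1 / t)"
      proof -
        have "b j * (M / m) powr (1 / t) \<le> (sum w W1 * m powr (1 / t)) * (M / m) powr (1 / t)"
          using W1(4) by (intro mult_right_mono) (auto simp: Cl_def b_def)
        also have "\<dots> = sum w W1 * (m * (M / m)) powr (1 / t)"
          using m1 less.prems(5) by (simp add: powr_mult powr_divide)
        also have "m * (M / m) = M" using m1 by simp
        finally show ?thesis using j(2) by linarith
      qed
      ultimately have "sum w T \<le> sum w (W1 \<union> W2) * M powr (1 / t)"
        using W2(4) by (simp add: algebra_simps)
      moreover have "W1 \<union> W2 \<subseteq> T" using W1(1) W2(1) ClT T'sub by auto
      ultimately show ?thesis using \<rho> by blast
    qed
  qed
qed

lemma ramsey_ultrametric:
  fixes w :: "'a::metric_space \<Rightarrow> real" and t :: nat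
  assumes "t \<ge> 1" and "s > 0" and "finite T"
    and "\<And>x. x \<in> T \<Longrightarrow> w x \<ge> 1"
    and "\<And>x y. x \<in> T \<Longrightarrow> y \<in> T \<Longrightarrow> x \<noteq> y \<Longrightarrow> dist x y > s"
    and "\<And>x y. x \<in> T \<Longrightarrow> y \<in> T \<Longrightarrow> dist x y \<le> s * 2 ^ i"
    and "T \<noteq> {}"
  obtains W \<rho> where "W \<subseteq> T" "ultrametric_levels W \<rho> s (8 * t)" "\<forall>x\<in>W. \<forall>y\<in>W. \<rho> x y \<le> i"
    "sum w T powr (1 - 1 / t) \<le> sum w W"
proof -
  have ge: "sum w A \<le> sum w T" if "A \<subseteq> T" for A
    by (rule sum_mono2) (use assms(3) that assms(4) in \<open>force+\<close>)
  obtain x where "x \<in> T" using assms(7) by blast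
  then have M: "sum w T \<ge> 1" using ge[of "{x}"] assms(4)[of x] by simp
  obtain W \<rho> where W: "W \<subseteq> T" "ultrametric_levels W \<rho> s (8 * t)" "\<forall>x\<in>W. \<forall>y\<in>W. \<rho> x y \<le> i"
    "sum w T \<le> sum w W * sum w T powr (1 / t)"
    using ramsey_ultrametric_scale[of t s T w i "sum w T", OF assms(1-6) M] ge by auto
  have "sum w T powr (1 - 1 / t) = sum w T / sum w T powr (1 / t)"
    using M by (simp add: powr_diff)
  also have "\<dots> \<le> sum w W" using W(4) M by (simp add: divide_le_eq)
  finally show ?thesis using that W by blast
qed

section \<open>Maps of finite metric spaces to the line\<close>

text \<open>F is the largest L-Lipschitz extension of f. The last two facts, that the minimum is
  attained and is a lower bound, are recorded because the values at a point outside \<open>W\<close>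
  will be compared for two different labellings.\<close>

lemma mcshane_extension:
  fixes f :: "'a::metric_space \<Rightarrow> real"
  assumes "finite W" "W \<noteq> {}" "L \<ge> 0"
    and lip: "\<And>x y. x \<in> W \<Longrightarrow> y \<in> W \<Longrightarrow> \<bar>f x - f y\<bar> \<le> L * dist x y"
  defines "F \<equiv> \<lambda>y. Min ((\<lambda>w. f w + L * dist w y) ` W)"
  shows "x \<in> W \<Longrightarrow> F x = f x" and "\<bar>F u - F v\<bar> \<le> L * dist u v"
    and "\<exists>w\<in>W. F y = f w + L * dist w y" and "w \<in> W \<Longrightarrow> F y \<le> f w + L * dist w y"
proof -
  show att: "\<exists>w\<in>W. F y = f w + L * dist w y" for y
    using Min_in[of "(\<lambda>w. f w + L * dist w y) ` W"] assms(1,2) unfolding F_def by blast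
  show le: "F y \<le> f w + L * dist w y" if "w \<in> W" for y w
    using assms(1) that unfolding F_def by (intro Min_le) auto
  show "F x = f x" if x: "x \<in> W"
  proof (rule antisym)
    show "F x \<le> f x" using le[OF x, of x] by simp
    obtain w where w: "w \<in> W" "F x = f w + L * dist w x" using att by blast
    then show "f x \<le> F x" using lip[OF x w(1)] by (simp add: dist_commute)
  qed
  have half: "F u - F v \<le> L * dist u v" for u v
  proof -
    obtain w where w: "w \<in> W" "F v = f w + L * dist w v" using att by blast
    have "L * dist w u \<le> L * (dist w v + dist u v)"
      using assms(3) dist_triangle2[of w u v] by (intro mult_left_mono) auto
    then show ?thesis using le[OF w(1), of u] w(2) by (simp add: algebra_simps)
  qed
  show "\<bar>F u - F v\<bar> \<le> L * dist u v"
    using half[of u v] half[of v u] by (simp add: dist_commute)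
qed

text \<open>Counting form of conditioning: once all labels except the one at \<open>c\<close> are
  fixed, at most one of its \<open>q\<close> values is bad. Overwriting the label at
  \<open>c\<close> of a bad family by an arbitrary value is therefore injective.\<close>

lemma card_PiE_bad_values:
  fixes bad :: "('i \<Rightarrow> nat) \<Rightarrow> bool"
  assumes "finite I" "c \<in> I"
    and one: "\<And>\<sigma> s s'. \<sigma> \<in> PiE I (\<lambda>_. {..<q}) \<Longrightarrow> s < q \<Longrightarrow> s' < q \<Longrightarrow>
        bad (\<sigma>(c := s)) \<Longrightarrow> bad (\<sigma>(c := s')) \<Longrightarrow> s = s'"
  shows "card {\<sigma> \<in> PiE I (\<lambda>_. {..<q}). bad \<sigma>} * q \<le> card (PiE I (\<lambda>_. {..<q}))"
proof -
  let ?P = "PiE I (\<lambda>_. {..<q})"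
  have "inj_on (\<lambda>(\<sigma>, s). \<sigma>(c := s)) ({\<sigma> \<in> ?P. bad \<sigma>} \<times> {..<q})"
  proof (rule inj_onI, clarify)
    fix \<sigma> s \<sigma>' s'
    assume a: "\<sigma> \<in> ?P" "bad \<sigma>" "\<sigma>' \<in> ?P" "bad \<sigma>'" and s: "s < q" "s' < q"
      and eq: "\<sigma>(c := s) = \<sigma>'(c := s')"
    have "s = s'" using fun_cong[OF eq, of c] by simp
    have oth: "\<sigma> i = \<sigma>' i" if "i \<noteq> c" for i using fun_cong[OF eq, of i] that by simp
    have e1: "\<sigma>(c := \<sigma> c) = \<sigma>" and e2: "\<sigma>(c := \<sigma>' c) = \<sigma>'" using oth by (auto simp: fun_eq_iff)
    have "\<sigma> c < q" "\<sigma>' c < q" using a assms(2) by auto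
    moreover have "bad (\<sigma>(c := \<sigma> c))" "bad (\<sigma>(c := \<sigma>' c))" unfolding e1 e2 using a by blast+
    ultimately have "\<sigma> c = \<sigma>' c" using one[OF a(1)] by blast
    then have "\<sigma> = \<sigma>'" using e1 e2 by metis
    then show "\<sigma> = \<sigma>' \<and> s = s'" using \<open>s = s'\<close> by blast
  qed
  moreover have "(\<lambda>(\<sigma>, s). \<sigma>(c := s)) ` ({\<sigma> \<in> ?P. bad \<sigma>} \<times> {..<q}) \<subseteq> ?P"
    using assms(2) by (auto simp: PiE_iff extensional_def)
  ultimately have "card ({\<sigma> \<in> ?P. bad \<sigma>} \<times> {..<q}) \<le> card ?P"
    using assms(1) by (intro card_inj_on_le) (auto intro: finite_PiE)
  then show ?thesis by (simp add: card_cartesian_product)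
qed

text \<open>Labels of distinct clusters are independent, and the value of the extension at a point
  outside a cluster is attained outside the cluster unless it is far from the values on the cluster.\<close>

lemma ultrametric_line_embedding:
  fixes S :: "'a::metric_space set"
  assumes "finite S" and W: "W \<subseteq> S" "W \<noteq> {}" and "s > 0" "q \<ge> 1" "t \<ge> 1"
    and u: "ultrametric_levels W \<rho> s (8 * real t)" and \<rho>i: "\<forall>x\<in>W. \<forall>y\<in>W. \<rho> x y \<le> i"
    and far: "\<And>x y. x \<in> S \<Longrightarrow> y \<in> S \<Longrightarrow> x \<noteq> y \<Longrightarrow> dist x y \<ge> 4 * s"
    and diam: "\<And>x y. x \<in> S \<Longrightarrow> y \<in> S \<Longrightarrow> dist x y \<le> s * 2 ^ i"
    and U: "U \<subseteq> W \<times> S" "\<And>x. (x, x) \<notin> U"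
  shows "\<exists>F. (\<forall>x y. \<bar>F x - F y\<bar> \<le> 8 * real t * real q * dist x y) \<and>
     real (card {(x, y) \<in> U. \<bar>F x - F y\<bar> \<ge> dist x y / 16}) \<ge> (1 - 1 / q) * card U"
proof -
  have finW: "finite W" using assms(1) W finite_subset by blast
  have finU: "finite U" using U(1) finW assms(1) finite_subset by blast
  define L where "L = 8 * real t * real q"
  have "1 \<le> t * q" using assms(5,6) by simp
  then have "1 \<le> real (t * q)" by (simp only: of_nat_le_iff[of 1, simplified])
  then have L1: "L \<ge> 8" unfolding L_def by simp
  define C where "C j x = {y \<in> W. \<rho> x y \<le> j}" for j x
  note um = u[unfolded ultrametric_levels_def]
  have u0: "\<rho> x x = 0" if "x \<in> W" for x
    using um[THEN conjunct1, rule_format] that .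
  have us: "\<rho> x y = \<rho> y x" if "x \<in> W" "y \<in> W" for x y
    using um[THEN conjunct2, THEN conjunct1, rule_format] that .
  have ut: "\<rho> x z \<le> max (\<rho> x y) (\<rho> y z)" if "x \<in> W" "y \<in> W" "z \<in> W" for x y z
    using um[THEN conjunct2, THEN conjunct2, THEN conjunct1, rule_format] that .
  have ud: "dist x y \<le> s * 2 ^ \<rho> x y" if "x \<in> W" "y \<in> W" for x y
    using um[THEN conjunct2, THEN conjunct2, THEN conjunct2, rule_format] that assms(4)
    by (cases "x = y") simp_all
  have ud2: "s * 2 ^ \<rho> x y \<le> 8 * real t * dist x y" if "x \<in> W" "y \<in> W" "x \<noteq> y" for x y
    using um[THEN conjunct2, THEN conjunct2, THEN conjunct2, rule_format] that by simp
  have Cself: "x \<in> C j x" if "x \<in> W" for x j using that u0 by (simp add: C_def)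
  have Csub: "C j x \<subseteq> C j y" if "x \<in> W" "y \<in> W" "\<rho> x y \<le> j" for x y j
  proof
    fix z assume "z \<in> C j x"
    then have z: "z \<in> W" "\<rho> x z \<le> j" by (auto simp: C_def)
    have "\<rho> y z \<le> max (\<rho> y x) (\<rho> x z)" using ut[of y x z] that z by blast
    then have "\<rho> y z \<le> j" using z that(3) us[OF that(1,2)] by linarith
    then show "z \<in> C j y" using z(1) by (simp add: C_def)
  qed
  have Ceq: "C j x = C j y" if xy: "x \<in> W" "y \<in> W" and le: "\<rho> x y \<le> j" for x y j
  proof
    show "C j x \<subseteq> C j y" by (rule Csub[OF xy le])
    have "\<rho> y x \<le> j" using us[OF xy] le by argo
    then show "C j y \<subseteq> C j x" by (rule Csub[OF xy(2,1)])
  qed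
  \<comment> \<open>Indexing the labels by a level and an arbitrary subset of \<open>W\<close> makes
    the label families a full product; f reads off only those of the clusters
    \<open>C j x\<close>.\<close>
  define I where "I = {..<i} \<times> Pow W"
  have finI: "finite I" using finW by (simp add: I_def)
  define P where "P = PiE I (\<lambda>_. {..<q})"
  have finP: "finite P" using finI by (auto simp: P_def intro: finite_PiE)
  have "(\<lambda>x\<in>I. 0) \<in> P" using assms(5) by (auto simp: P_def)
  then have P0: "P \<noteq> {}" by blast
  define f where "f \<sigma> x = (\<Sum>j<i. s * 2 ^ j * real (\<sigma> (j, C j x)))"
    for \<sigma> :: "nat \<times> 'a set \<Rightarrow> nat" and x
  have CI: "(j, C j x) \<in> I" if "j < i" for j x using that by (auto simp: I_def C_def)
  have lip: "\<bar>f \<sigma> x - f \<sigma> y\<bar> \<le> L * dist x y" if \<sigma>: "\<sigma> \<in> P" and xy: "x \<in> W" "y \<in> W" for \<sigma> x y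
  proof (cases "x = y")
    case False
    have lt: "\<sigma> (j, C j z) \<le> q - 1" if "j < i" for j z
      using PiE_mem[OF \<sigma>[unfolded P_def] CI[OF that, of z]] by simp
    have "\<bar>f \<sigma> x - f \<sigma> y\<bar> \<le> (\<Sum>j<i. \<bar>s * 2 ^ j * real (\<sigma> (j, C j x)) - s * 2 ^ j * real (\<sigma> (j, C j y))\<bar>)"
      unfolding f_def sum_subtractf[symmetric] by (rule sum_abs)
    \<comment> \<open>From level \<open>\<rho> x y\<close> on, x and y lie in the same cluster and
      share its label; each lower level contributes at most q times its scale, which leaves a
      geometric sum.\<close>
    also have "\<dots> \<le> (\<Sum>j<i. if j < \<rho> x y then s * 2 ^ j * q else 0)"
    proof (rule sum_mono)
      fix j assume j: "j \<in> {..<i}"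
      have "\<bar>real (\<sigma> (j, C j x)) - real (\<sigma> (j, C j y))\<bar> \<le> q"
        using lt[of j x] lt[of j y] j by auto
      then have "s * 2 ^ j * \<bar>real (\<sigma> (j, C j x)) - real (\<sigma> (j, C j y))\<bar> \<le> s * 2 ^ j * q"
        using assms(4) by (intro mult_left_mono) auto
      then have "\<bar>s * 2 ^ j * real (\<sigma> (j, C j x)) - s * 2 ^ j * real (\<sigma> (j, C j y))\<bar> \<le> s * 2 ^ j * q"
        using assms(4) by (simp add: abs_mult right_diff_distrib[symmetric])
      then show "\<bar>s * 2 ^ j * real (\<sigma> (j, C j x)) - s * 2 ^ j * real (\<sigma> (j, C j y))\<bar>
          \<le> (if j < \<rho> x y then s * 2 ^ j * q else 0)"
        using Ceq[OF xy, of j] by auto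
    qed
    also have "\<dots> = (\<Sum>j<\<rho> x y. s * 2 ^ j * q)"
    proof -
      have "{..<i} \<inter> {j. j < \<rho> x y} = {..<\<rho> x y}" using \<rho>i xy by fastforce
      then show ?thesis by (simp add: sum.If_cases)
    qed
    also have "\<dots> = s * q * (2 ^ \<rho> x y - 1)"
    proof -
      have "(\<Sum>j<\<rho> x y. s * 2 ^ j * q) = s * q * (\<Sum>j<\<rho> x y. 2 ^ j)"
        by (simp add: sum_distrib_left mult_ac)
      also have "(\<Sum>j<\<rho> x y. 2 ^ j) = (2 ^ \<rho> x y - 1 :: real)"
        using geometric_sum[of "2::real" "\<rho> x y"] by simp
      finally show ?thesis .
    qed
    also have "\<dots> \<le> q * (s * 2 ^ \<rho> x y)" using assms(4) by (simp add: algebra_simps)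
    also have "\<dots> \<le> q * (8 * real t * dist x y)"
      using ud2[OF xy False] by (intro mult_left_mono) auto
    finally show ?thesis by (simp add: L_def mult_ac)
  qed simp
  define F where "F \<sigma> y = Min ((\<lambda>w. f \<sigma> w + L * dist w y) ` W)" for \<sigma> y
  have Lpos: "L \<ge> 0" using L1 by simp
  have mc1: "F \<sigma> x = f \<sigma> x" if "\<sigma> \<in> P" "x \<in> W" for \<sigma> x
    unfolding F_def by (rule mcshane_extension(1)[OF finW W(2) Lpos lip[OF that(1)] that(2)])
  have mc2: "\<bar>F \<sigma> x - F \<sigma> y\<bar> \<le> L * dist x y" if "\<sigma> \<in> P" for \<sigma> x y
    unfolding F_def by (rule mcshane_extension(2)[OF finW W(2) Lpos lip[OF that]])
  have mc3: "\<exists>w\<in>W. F \<sigma> y = f \<sigma> w + L * dist w y" if "\<sigma> \<in> P" for \<sigma> y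
    unfolding F_def by (rule mcshane_extension(3)[OF finW W(2) Lpos lip[OF that]])
  have mc4: "F \<sigma> y \<le> f \<sigma> w + L * dist w y" if "\<sigma> \<in> P" "w \<in> W" for \<sigma> y w
    unfolding F_def by (rule mcshane_extension(4)[OF finW W(2) Lpos lip[OF that(1)] that(2)])
  define good where "good \<sigma> p \<longleftrightarrow> \<bar>F \<sigma> (fst p) - F \<sigma> (snd p)\<bar> \<ge> dist (fst p) (snd p) / 16" for \<sigma> p
  have bad_few: "card {\<sigma> \<in> P. \<not> good \<sigma> p} * q \<le> card P" if p: "p \<in> U" for p
  proof -
    obtain x y where pxy: "p = (x, y)" by (cases p)
    have x: "x \<in> W" and y: "y \<in> S" and xy: "x \<noteq> y" using p U by (auto simp: pxy)
    have xS: "x \<in> S" using x W(1) by blast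
    define h where "h = dist x y"
    have h4: "h \<ge> 4 * s" unfolding h_def using far xS y xy by blast
    \<comment> \<open>The largest level whose clusters reach at most h / 4 from x. Then y is far
      from the cluster of x, while changing its label by one still shifts the value at x by more
      than h / 8.\<close>
    define j where "j = (GREATEST j. s * 2 ^ j \<le> h / 4)"
    have bnd: "k \<le> i" if "s * 2 ^ k \<le> h / 4" for k
    proof (rule ccontr)
      assume "\<not> k \<le> i"
      then have "s * 2 ^ i \<le> s * 2 ^ k" using assms(4) by (intro mult_left_mono power_increasing) auto
      then have "h \<le> h / 4" using diam[OF xS y] that unfolding h_def by linarith
      then show False using h4 assms(4) by simp
    qed
    have j1: "s * 2 ^ j \<le> h / 4"
      unfolding j_def by (rule GreatestI_nat[of _ 0 i]) (use h4 bnd in auto)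
    have j2: "s * 2 ^ Suc j > h / 4"
    proof (rule ccontr)
      assume "\<not> ?thesis"
      then have "Suc j \<le> j" unfolding j_def
        by (intro Greatest_le_nat[of _ _ i]) (use bnd in auto)
      then show False by simp
    qed
    have ji: "j < i"
    proof -
      have "j \<noteq> i" using j1 diam[OF xS y] h4 assms(4) by (auto simp: h_def)
      then show ?thesis using bnd[OF j1] by simp
    qed
    define c where "c = (j, C j x)"
    have cI: "c \<in> I" using CI[OF ji] by (simp add: c_def)
    \<comment> \<open>Two bad labels contradict each other: the value at y is the same for both, the
      values at x differ by more than h / 8, and yet each of them is within h / 16 of the value at
      y.\<close>
    have one: "a = b" if \<sigma>: "\<sigma> \<in> P" and ab: "a < q" "b < q"
      and bad: "\<not> good (\<sigma>(c := a)) p" "\<not> good (\<sigma>(c := b)) p" for \<sigma> a b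
    proof (rule ccontr)
      assume "a \<noteq> b"
      have upd: "\<sigma>(c := v) \<in> P" if "v < q" for v
        using \<sigma> cI that by (auto simp: P_def PiE_iff extensional_def)
      have outside: "f (\<sigma>(c := a)) w = f (\<sigma>(c := b)) w" if "w \<in> W - C j x" for w
      proof -
        have "C j w \<noteq> C j x" using Cself[of w j] that by blast
        then show ?thesis unfolding f_def by (intro sum.cong refl) (auto simp: c_def)
      qed
      have inside: "f (\<sigma>(c := v)) x = (\<Sum>k\<in>{..<i}-{j}. s * 2 ^ k * real (\<sigma> (k, C k x))) + s * 2 ^ j * v" for v
      proof -
        have "f (\<sigma>(c := v)) x = s * 2 ^ j * v + (\<Sum>k\<in>{..<i}-{j}. s * 2 ^ k * real ((\<sigma>(c := v)) (k, C k x)))"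
          unfolding f_def by (subst sum.remove[of _ j]) (use ji in \<open>auto simp: c_def\<close>)
        also have "(\<Sum>k\<in>{..<i}-{j}. s * 2 ^ k * real ((\<sigma>(c := v)) (k, C k x))) =
            (\<Sum>k\<in>{..<i}-{j}. s * 2 ^ k * real (\<sigma> (k, C k x)))"
          by (intro sum.cong refl) (auto simp: c_def)
        finally show ?thesis by (simp only: add.commute)
      qed
      have attained: "\<exists>w\<in>W - C j x. F (\<sigma>(c := v)) y = f (\<sigma>(c := v)) w + L * dist w y"
        if v: "v < q" and nb: "\<not> good (\<sigma>(c := v)) p" for v
      proof -
        obtain w where w: "w \<in> W" "F (\<sigma>(c := v)) y = f (\<sigma>(c := v)) w + L * dist w y"
          using mc3[OF upd[OF v]] by blast
        have "w \<notin> C j x"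
        proof
          assume "w \<in> C j x"
          then have "\<rho> x w \<le> j" by (simp add: C_def)
          then have "s * 2 ^ \<rho> x w \<le> s * 2 ^ j" using assms(4) by (intro mult_left_mono power_increasing) auto
          then have dxw: "dist x w \<le> h / 4" using ud[OF x w(1)] j1 by linarith
          then have dwy: "dist w y \<ge> 3 * h / 4" using dist_triangle[of x y w] by (simp add: h_def)
          have "f (\<sigma>(c := v)) w \<ge> f (\<sigma>(c := v)) x - L * dist x w"
            using lip[OF upd[OF v] x w(1)] by linarith
          moreover have "L * dist x w \<le> L * (h / 4)" "L * dist w y \<ge> L * (3 * h / 4)"
            using dxw dwy Lpos by (intro mult_left_mono; simp)+
          ultimately have "F (\<sigma>(c := v)) y \<ge> f (\<sigma>(c := v)) x + L * (h / 2)"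
            using w(2) by (simp add: algebra_simps)
          moreover have "L * (h / 2) \<ge> 8 * (h / 2)" using L1 h4 assms(4) by (intro mult_right_mono) auto
          moreover have "h \<ge> 0" by (simp add: h_def)
          ultimately have "good (\<sigma>(c := v)) p"
            using mc1[OF upd[OF v] x] unfolding good_def pxy h_def fst_conv snd_conv by linarith
          then show False using nb by simp
        qed
        then show ?thesis using w by blast
      qed
      \<comment> \<open>A minimiser outside the cluster does not see the label at \<open>c\<close>,
        so the minimum for one label bounds the minimum for the other, and this in both
        directions.\<close>
      have mon: "F (\<sigma>(c := a')) y \<le> F (\<sigma>(c := b')) y"
        if ab': "a' < q" "b' < q" "{a', b'} = {a, b}" and nb: "\<not> good (\<sigma>(c := b')) p" for a' b'
      proof -
        obtain w where w: "w \<in> W - C j x" "F (\<sigma>(c := b')) y = f (\<sigma>(c := b')) w + L * dist w y"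
          using attained[OF ab'(2) nb] by blast
        have "f (\<sigma>(c := a')) w = f (\<sigma>(c := b')) w"
          using outside[OF w(1)] ab'(3) by (metis doubleton_eq_iff)
        then show ?thesis using mc4[OF upd[OF ab'(1)], of w y] w by auto
      qed
      have Feq: "F (\<sigma>(c := a)) y = F (\<sigma>(c := b)) y"
        using mon[of a b] mon[of b a] ab bad by (auto simp: insert_commute)
      have "\<bar>f (\<sigma>(c := a)) x - f (\<sigma>(c := b)) x\<bar> = s * 2 ^ j * \<bar>real a - real b\<bar>"
        using assms(4) by (simp add: inside abs_mult right_diff_distrib[symmetric])
      moreover have "\<bar>real a - real b\<bar> \<ge> 1" using \<open>a \<noteq> b\<close> by linarith
      then have "s * 2 ^ j * \<bar>real a - real b\<bar> \<ge> s * 2 ^ j * 1"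
        using assms(4) by (intro mult_left_mono) auto
      ultimately have "\<bar>f (\<sigma>(c := a)) x - f (\<sigma>(c := b)) x\<bar> \<ge> s * 2 ^ j" by simp
      moreover have "\<bar>f (\<sigma>(c := a)) x - F (\<sigma>(c := a)) y\<bar> < h / 16"
        "\<bar>f (\<sigma>(c := b)) x - F (\<sigma>(c := b)) y\<bar> < h / 16"
        using bad mc1[OF upd[OF ab(1)] x] mc1[OF upd[OF ab(2)] x]
        by (auto simp: good_def pxy h_def)
      ultimately have "s * 2 ^ j < h / 8" using Feq by linarith
      then show False using j2 by simp
    qed
    show ?thesis unfolding P_def
      by (rule card_PiE_bad_values[OF finI cI]) (use one in \<open>auto simp: P_def\<close>)
  qed
  have "real (\<Sum>\<sigma>\<in>P. card {p \<in> U. \<not> good \<sigma> p}) * q = real (\<Sum>p\<in>U. card {\<sigma> \<in> P. \<not> good \<sigma> p}) * q"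
    using sum.swap_restrict[OF finP finU, of "\<lambda>_ _. 1::nat" "\<lambda>\<sigma> p. \<not> good \<sigma> p"] by simp
  also have "\<dots> = real (\<Sum>p\<in>U. card {\<sigma> \<in> P. \<not> good \<sigma> p} * q)" by (simp add: sum_distrib_right)
  also have "\<dots> \<le> real (\<Sum>p\<in>U. card P)" by (intro of_nat_mono sum_mono bad_few)
  finally have total: "real (\<Sum>\<sigma>\<in>P. card {p \<in> U. \<not> good \<sigma> p}) * q \<le> card U * card P" by simp
  \<comment> \<open>Some family of labels does at least as well as the average over
    \<open>P\<close>.\<close>
  have "\<exists>\<sigma>\<in>P. real (card {p \<in> U. \<not> good \<sigma> p}) * q \<le> card U"
  proof (rule ccontr)
    assume "\<not> ?thesis"
    then have "(\<Sum>\<sigma>\<in>P. real (card U)) < (\<Sum>\<sigma>\<in>P. real (card {p \<in> U. \<not> good \<sigma> p}) * q)"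
      using finP P0 by (intro sum_strict_mono) force+
    then show False using total by (simp add: mult.commute flip: sum_distrib_left)
  qed
  then obtain \<sigma> where \<sigma>: "\<sigma> \<in> P" "real (card {p \<in> U. \<not> good \<sigma> p}) * q \<le> card U" by blast
  have "card U = card {p \<in> U. good \<sigma> p} + card {p \<in> U. \<not> good \<sigma> p}"
    by (subst card_Un_disjoint[symmetric]) (use finU in \<open>auto intro!: arg_cong[where f = card]\<close>)
  moreover have "real (card {p \<in> U. \<not> good \<sigma> p}) \<le> card U / q"
    using \<sigma>(2) assms(5) by (simp add: field_simps)
  ultimately have "real (card {p \<in> U. good \<sigma> p}) \<ge> (1 - 1 / q) * card U"
    unfolding left_diff_distrib by simp
  moreover have "{p \<in> U. good \<sigma> p} = {(x, y) \<in> U. \<bar>F \<sigma> x - F \<sigma> y\<bar> \<ge> dist x y / 16}"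
    by (auto simp: good_def)
  ultimately show ?thesis using mc2[OF \<sigma>(1)] by (intro exI[of _ "F \<sigma>"]) (simp add: L_def)
qed

text \<open>The weight of a point is the number of pairs of \<open>U\<close> that start at it, so a
  heavy ultrametric subset keeps many pairs. Only the first point of a pair has to lie in the
  subset, because the line map is extended to all points.\<close>

lemma line_map_resolving_pairs:
  fixes S :: "'a::metric_space set"
  assumes "finite S" and U: "U \<subseteq> S \<times> S" "\<And>x. (x, x) \<notin> U" and "q \<ge> 1" "t \<ge> 1"
  shows "\<exists>F. (\<forall>x y. \<bar>F x - F y\<bar> \<le> 128 * real t * real q * dist x y) \<and>
     real (card {(x, y) \<in> U. \<bar>F x - F y\<bar> \<ge> dist x y}) \<ge> (1 - 1 / q) * card U powr (1 - 1 / t)"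
proof (cases "U = {}")
  case True
  then show ?thesis by (intro exI[of _ "\<lambda>_. 0"]) auto
next
  case False
  have finU: "finite U" using U(1) assms(1) by (meson finite_SigmaI finite_subset)
  define Q where "Q = {p \<in> S \<times> S. fst p \<noteq> snd p}"
  have finQ: "finite Q" using assms(1) by (simp add: Q_def)
  have Q0: "Q \<noteq> {}" using False U by (force simp: Q_def)
  \<comment> \<open>A quarter of the minimal distance, so that level 0 already has a scale of at
    most a quarter of the distance of every pair.\<close>
  define s where "s = Min ((\<lambda>p. dist (fst p) (snd p)) ` Q) / 4"
  have "Min ((\<lambda>p. dist (fst p) (snd p)) ` Q) > 0"
    using finQ Q0 by (subst Min_gr_iff) (auto simp: Q_def)
  then have s: "s > 0" by (simp add: s_def)
  have far: "dist x y \<ge> 4 * s" if "x \<in> S" "y \<in> S" "x \<noteq> y" for x y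
  proof -
    have "(x, y) \<in> Q" using that by (simp add: Q_def)
    then have "Min ((\<lambda>p. dist (fst p) (snd p)) ` Q) \<le> dist x y"
      using finQ by (intro Min_le) force+
    then show ?thesis by (simp add: s_def)
  qed
  obtain D where D: "\<And>x y. x \<in> S \<Longrightarrow> y \<in> S \<Longrightarrow> dist x y \<le> D"
    using finite_imp_bounded[OF assms(1)] bounded_two_points by metis
  obtain i where i: "D / s < 2 ^ i" using real_arch_pow[of 2 "D / s"] by auto
  have diam: "dist x y \<le> s * 2 ^ i" if "x \<in> S" "y \<in> S" for x y
    using D[OF that] i s by (simp add: field_simps)
  define w where "w x = real (card (U `` {x}))" for x
  define T where "T = fst ` U"
  have TS: "T \<subseteq> S" using U(1) by (auto simp: T_def)
  have finT: "finite T" using finU by (simp add: T_def)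
  have finIm: "finite (U `` {x})" for x using finU by (rule finite_Image)
  have cardW: "real (card (U \<inter> W \<times> S)) = sum w W" if "W \<subseteq> T" for W
  proof -
    have "U \<inter> W \<times> S = Sigma W (\<lambda>x. U `` {x})" using U(1) by auto
    then show ?thesis using finite_subset[OF that finT] finIm by (simp add: w_def)
  qed
  have "U \<inter> T \<times> S = U" using U(1) by (force simp: T_def)
  then have wT: "sum w T = card U" using cardW[of T] by simp
  have w1: "w x \<ge> 1" if x: "x \<in> T" for x
  proof -
    have "U `` {x} \<noteq> {}" using x by (auto simp: T_def)
    then have "card (U `` {x}) \<ge> 1" using finIm[of x] by (simp add: Suc_le_eq card_gt_0_iff)
    then show ?thesis by (simp add: w_def)
  qed
  have far': "dist x y > s" if "x \<in> T" "y \<in> T" "x \<noteq> y" for x y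
    using far[of x y] that TS s by force
  have diam': "dist x y \<le> s * 2 ^ i" if "x \<in> T" "y \<in> T" for x y
    using diam that TS by blast
  have T0: "T \<noteq> {}" using False by (simp add: T_def)
  obtain W \<rho> where W: "W \<subseteq> T" "ultrametric_levels W \<rho> s (8 * real t)" "\<forall>x\<in>W. \<forall>y\<in>W. \<rho> x y \<le> i"
    "sum w T powr (1 - 1 / t) \<le> sum w W"
    using ramsey_ultrametric[of t s T w i, OF assms(5) s finT w1 far' diam' T0] by auto
  have "sum w T > 0" using wT False finU by (simp add: card_gt_0_iff)
  then have "sum w T powr (1 - 1 / t) > 0" by simp
  then have W0: "W \<noteq> {}" using W(4) by (metis leD sum.empty)
  have WS: "W \<subseteq> S" using W(1) TS by blast
  have U': "U \<inter> W \<times> S \<subseteq> W \<times> S" "(x, x) \<notin> U \<inter> W \<times> S" for x using U(2) by auto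
  obtain F where F: "\<And>x y. \<bar>F x - F y\<bar> \<le> 8 * real t * real q * dist x y"
     "real (card {(x, y) \<in> U \<inter> W \<times> S. \<bar>F x - F y\<bar> \<ge> dist x y / 16}) \<ge> (1 - 1 / q) * card (U \<inter> W \<times> S)"
    using ultrametric_line_embedding[OF assms(1) WS W0 s assms(4,5) W(2,3) far diam U'] by blast
  \<comment> \<open>Rescaling by 16 turns the resolution dist / 16 into dist and the Lipschitz
    constant 8 t q into 128 t q.\<close>
  define G where "G x = 16 * F x" for x
  have GF: "\<bar>G x - G y\<bar> = 16 * \<bar>F x - F y\<bar>" for x y
  proof -
    have "G x - G y = 16 * (F x - F y)" by (simp add: G_def)
    then show ?thesis by (simp only: abs_mult)
  qed
  have "(1 - 1 / q) * card U powr (1 - 1 / t) \<le> (1 - 1 / q) * card (U \<inter> W \<times> S)"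
    using W(4) assms(4) unfolding cardW[OF W(1)] wT by (intro mult_left_mono) auto
  also have "\<dots> \<le> real (card {(x, y) \<in> U \<inter> W \<times> S. \<bar>F x - F y\<bar> \<ge> dist x y / 16})" by (rule F(2))
  also have "\<dots> \<le> real (card {(x, y) \<in> U. \<bar>G x - G y\<bar> \<ge> dist x y})"
    using finU by (intro of_nat_mono card_mono finite_subset[OF _ finU]) (auto simp: GF)
  finally have card: "(1 - 1 / q) * card U powr (1 - 1 / t) \<le> real (card {(x, y) \<in> U. \<bar>G x - G y\<bar> \<ge> dist x y})" .
  have "\<bar>G x - G y\<bar> \<le> 128 * real t * real q * dist x y" for x y
  proof -
    have "16 * \<bar>F x - F y\<bar> \<le> 16 * (8 * real t * real q * dist x y)"
      using F(1)[of x y] by (intro mult_left_mono) auto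
    then show ?thesis unfolding GF by (simp add: mult_ac)
  qed
  then show ?thesis using card by blast
qed

text \<open>Each new map is chosen for the pairs that are still unresolved. There are at most
  \<open>card S ^ 2\<close> of them, so \<open>card U powr (1 - 1 / t)\<close> is at least the fixed
  proportion \<open>card S powr (- 2 / t)\<close> of \<open>card U\<close>, and the decay is
  geometric.\<close>

lemma line_maps_unresolved_pairs:
  fixes S :: "'a::metric_space set"
  assumes "finite S" "q \<ge> 1" "t \<ge> 1"
  defines "\<eta> \<equiv> 1 - (1 - 1 / real q) * real (card S) powr (- 2 / real t)"
  shows "\<exists>F. (\<forall>i x y. \<bar>F i x - F i y\<bar> \<le> 128 * real t * real q * dist x y) \<and>
     real (card {(x, y) \<in> S \<times> S. x \<noteq> y \<and> (\<forall>i<k. \<bar>F i x - F i y\<bar> < dist x y)})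
       \<le> \<eta> ^ k * real (card S) ^ 2"
proof (induction k)
  case 0
  have "card {(x, y) \<in> S \<times> S. x \<noteq> y} \<le> card (S \<times> S)"
    using assms(1) by (intro card_mono) auto
  then have "real (card {(x, y) \<in> S \<times> S. x \<noteq> y}) \<le> real (card S) ^ 2"
    by (simp add: card_cartesian_product power2_eq_square flip: of_nat_mult)
  then show ?case by (intro exI[of _ "\<lambda>_ _. 0"]) auto
next
  case (Suc k)
  then obtain F where F: "\<And>i x y. \<bar>F i x - F i y\<bar> \<le> 128 * real t * real q * dist x y"
    "real (card {(x, y) \<in> S \<times> S. x \<noteq> y \<and> (\<forall>i<k. \<bar>F i x - F i y\<bar> < dist x y)})
       \<le> \<eta> ^ k * real (card S) ^ 2" by blast
  define U where "U = {(x, y) \<in> S \<times> S. x \<noteq> y \<and> (\<forall>i<k. \<bar>F i x - F i y\<bar> < dist x y)}"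
  have U: "U \<subseteq> S \<times> S" "(x, x) \<notin> U" for x by (auto simp: U_def)
  have finU: "finite U" using U(1) assms(1) by (meson finite_SigmaI finite_subset)
  obtain G where G: "\<And>x y. \<bar>G x - G y\<bar> \<le> 128 * real t * real q * dist x y"
     "real (card {(x, y) \<in> U. \<bar>G x - G y\<bar> \<ge> dist x y}) \<ge> (1 - 1 / q) * card U powr (1 - 1 / t)"
    using line_map_resolving_pairs[OF assms(1) U assms(2,3)] by blast
  have "card U \<le> card (S \<times> S)" using U(1) assms(1) by (intro card_mono) auto
  then have cU: "real (card U) \<le> real (card S) ^ 2"
    by (simp add: card_cartesian_product power2_eq_square flip: of_nat_mult)
  have res: "real (card U) * (1 - \<eta>) \<le> (1 - 1 / q) * card U powr (1 - 1 / t)"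
  proof (cases "U = {}")
    case False
    then have pos: "real (card U) > 0" using finU by (simp add: card_gt_0_iff)
    have "S \<noteq> {}" using False U(1) by blast
    then have Spos: "real (card S) > 0" using assms(1) by (simp add: card_gt_0_iff)
    have "real (card S) powr (- 2 / real t) = (real (card S) ^ 2) powr (- 1 / t)"
      using Spos by (simp add: powr_powr flip: powr_numeral)
    also have "\<dots> \<le> card U powr (- 1 / t)"
      using pos cU by (intro powr_mono2') auto
    finally have "card U * real (card S) powr (- 2 / real t) \<le> card U * card U powr (- 1 / t)"
      by (intro mult_left_mono) auto
    also have "\<dots> = card U powr (1 - 1 / t)" using pos by (simp add: powr_diff powr_minus_divide)
    finally have "(1 - 1 / q) * (card U * real (card S) powr (- 2 / real t)) \<le> (1 - 1 / q) * card U powr (1 - 1 / t)"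
      using assms(2) by (intro mult_left_mono) auto
    then show ?thesis by (simp add: \<eta>_def mult_ac)
  qed simp
  have "U = {(x, y) \<in> U. \<bar>G x - G y\<bar> \<ge> dist x y} \<union> {(x, y) \<in> U. \<bar>G x - G y\<bar> < dist x y}" by auto
  then have "card U = card {(x, y) \<in> U. \<bar>G x - G y\<bar> \<ge> dist x y} + card {(x, y) \<in> U. \<bar>G x - G y\<bar> < dist x y}"
    using finU by (subst card_Un_disjoint[symmetric]) (auto intro: finite_subset[of _ U])
  then have "real (card {(x, y) \<in> U. \<bar>G x - G y\<bar> < dist x y}) \<le> card U - (1 - \<eta>) * card U"
    using G(2) res by (simp add: mult.commute)
  also have "\<dots> = \<eta> * card U" by (simp add: algebra_simps)
  also have "\<dots> \<le> \<eta> * (\<eta> ^ k * real (card S) ^ 2)"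
  proof (intro mult_left_mono)
    show "real (card U) \<le> \<eta> ^ k * real (card S) ^ 2" using F(2) by (simp add: U_def)
    have "real (card S) powr (- 2 / real t) \<le> 1"
    proof (cases "card S = 0")
      case False
      then show ?thesis using powr_mono[of "- 2 / real t" 0 "real (card S)"] by simp
    qed simp
    then have "(1 - 1 / real q) * real (card S) powr (- 2 / real t) \<le> 1 * 1"
      using assms(2) by (intro mult_mono) auto
    then show "\<eta> \<ge> 0" by (simp add: \<eta>_def)
  qed
  finally have fin: "real (card {(x, y) \<in> U. \<bar>G x - G y\<bar> < dist x y}) \<le> \<eta> ^ Suc k * real (card S) ^ 2"
    by simp
  have "{(x, y) \<in> U. \<bar>G x - G y\<bar> < dist x y} =
      {(x, y) \<in> S \<times> S. x \<noteq> y \<and> (\<forall>i<Suc k. \<bar>(F(k := G)) i x - (F(k := G)) i y\<bar> < dist x y)}"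
    by (auto simp: U_def less_Suc_eq)
  then show ?case
    using fin F(1) G(1) by (intro exI[of _ "F(k := G)"]) auto
qed

section \<open>Coordinate subspaces of the space of bounded sequences\<close>

definition unit_seq :: "nat \<Rightarrow> linf" where
  "unit_seq i = Bcontfun (\<lambda>j. if j = i then 1 else 0)"

definition finite_seq :: "nat \<Rightarrow> (nat \<Rightarrow> real) \<Rightarrow> linf" where
  "finite_seq k c = (\<Sum>i<k. c i *\<^sub>R unit_seq i)"

lemma bounded_seq_in_bcontfun:
  fixes f :: "nat \<Rightarrow> real"
  assumes "\<And>i. \<bar>f i\<bar> \<le> B"
  shows "f \<in> bcontfun"
  unfolding bcontfun_def using assms
  by (auto simp: bounded_iff intro!: continuous_on_discrete exI[of _ B])

lemma apply_unit_seq [simp]: "apply_bcontfun (unit_seq i) j = (if j = i then 1 else 0)"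
  unfolding unit_seq_def by (subst Bcontfun_inverse) (auto intro: bounded_seq_in_bcontfun[of _ 1])

lemma apply_finite_seq [simp]: "apply_bcontfun (finite_seq k c) j = (if j < k then c j else 0)"
proof -
  have "apply_bcontfun (finite_seq k c) j = (\<Sum>i<k. if j = i then c i else 0)"
    unfolding finite_seq_def
    by (induction k) (auto simp: plus_bcontfun.rep_eq scaleR_bcontfun.rep_eq zero_bcontfun.rep_eq)
  then show ?thesis by simp
qed

lemma finite_seq_in_span: "finite_seq k c \<in> span (unit_seq ` {..<k})"
  unfolding finite_seq_def by (intro span_sum span_scale span_base) auto

lemma unit_seq_inj: "inj unit_seq"
proof (rule injI)
  fix i j assume "unit_seq i = unit_seq j"
  then have "apply_bcontfun (unit_seq i) i = apply_bcontfun (unit_seq j) i" by simp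
  then show "i = j" by (simp split: if_splits)
qed

lemma span_unit_seq_dimension: "has_dimension (span (unit_seq ` {..<k})) k"
proof -
  have "independent (unit_seq ` {..<k})"
  proof (rule independent_if_scalars_zero)
    fix f x assume z: "(\<Sum>x\<in>unit_seq ` {..<k}. f x *\<^sub>R x) = 0" and x: "x \<in> unit_seq ` {..<k}"
    have "(\<Sum>x\<in>unit_seq ` {..<k}. f x *\<^sub>R x) = finite_seq k (\<lambda>i. f (unit_seq i))"
      unfolding finite_seq_def by (subst sum.reindex) (auto intro: inj_on_subset[OF unit_seq_inj])
    moreover obtain i where "i < k" "x = unit_seq i" using x by auto
    ultimately have "f x = apply_bcontfun (\<Sum>x\<in>unit_seq ` {..<k}. f x *\<^sub>R x) i" by simp
    then show "f x = 0" using z by simp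
  qed simp
  moreover have "card (unit_seq ` {..<k}) = k"
    by (simp add: card_image inj_on_subset[OF unit_seq_inj])
  ultimately show ?thesis unfolding has_dimension_def by blast
qed

lemma embeds_in_finite_seqs:
  fixes S :: "'a::metric_space set"
  assumes "\<alpha> > 0"
    and "\<And>i x y. x \<in> S \<Longrightarrow> y \<in> S \<Longrightarrow> \<bar>F i x - F i y\<bar> \<le> \<alpha> * dist x y"
    and "\<And>x y. x \<in> S \<Longrightarrow> y \<in> S \<Longrightarrow> x \<noteq> y \<Longrightarrow> \<exists>i<k. \<bar>F i x - F i y\<bar> \<ge> dist x y"
  shows "embeds_with_distortion S dist (span (unit_seq ` {..<k})) dist \<alpha>"
  unfolding embeds_with_distortion_def
proof (intro bexI ballI conjI)
  let ?f = "\<lambda>x. finite_seq k (\<lambda>i. F i x / \<alpha>)"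
  show "?f \<in> S \<rightarrow> span (unit_seq ` {..<k})" using finite_seq_in_span by blast
  fix x y assume xy: "x \<in> S" "y \<in> S"
  show "dist (?f x) (?f y) \<le> dist x y"
    using assms(1) assms(2)[OF xy]
    by (intro dist_bound) (simp add: dist_real_def diff_divide_distrib[symmetric] divide_le_eq mult.commute)
  show "dist x y \<le> \<alpha> * dist (?f x) (?f y)"
  proof (cases "x = y")
    case False
    then obtain i where i: "i < k" "\<bar>F i x - F i y\<bar> \<ge> dist x y" using assms(3)[OF xy] by blast
    have "\<bar>F i x - F i y\<bar> / \<alpha> = dist (apply_bcontfun (?f x) i) (apply_bcontfun (?f y) i)"
      using i(1) assms(1) by (simp add: dist_real_def diff_divide_distrib[symmetric])
    also have "\<dots> \<le> dist (?f x) (?f y)" by (rule dist_bounded)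
    finally show ?thesis using i(2) assms(1) by (simp add: divide_le_eq mult.commute)
  qed simp
qed

text \<open>Fewer than one unresolved pair means none, and then the k line maps, divided by
  \<alpha>, are the coordinates of the embedding.\<close>

lemma finite_metric_embeds_in_linf_subspace:
  fixes S :: "'a::metric_space set"
  assumes "q \<ge> 1" "t \<ge> 1" "128 * real t * real q \<le> \<alpha>" and S: "finite S" "card S = n"
    and "(1 - (1 - 1 / real q) * real n powr (- 2 / real t)) ^ k * real n ^ 2 < 1"
  shows "\<exists>V::linf set. has_dimension V k \<and> embeds_with_distortion S dist V dist \<alpha>"
proof -
  obtain F where F: "\<And>i x y. \<bar>F i x - F i y\<bar> \<le> 128 * real t * real q * dist x y"
     "real (card {(x, y) \<in> S \<times> S. x \<noteq> y \<and> (\<forall>i<k. \<bar>F i x - F i y\<bar> < dist x y)}) < 1"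
    using line_maps_unresolved_pairs[of S q t k] S assms by fastforce
  have "finite {(x, y) \<in> S \<times> S. x \<noteq> y \<and> (\<forall>i<k. \<bar>F i x - F i y\<bar> < dist x y)}"
    by (rule finite_subset[of _ "S \<times> S"]) (use S in blast)+
  then have "{(x, y) \<in> S \<times> S. x \<noteq> y \<and> (\<forall>i<k. \<bar>F i x - F i y\<bar> < dist x y)} = {}"
    using F(2) by simp
  then have far: "\<exists>i<k. \<bar>F i x - F i y\<bar> \<ge> dist x y" if "x \<in> S" "y \<in> S" "x \<noteq> y" for x y
    using that by force
  have "1 \<le> t * q" using assms(1,2) by simp
  then have "1 \<le> real (t * q)" by (simp only: of_nat_le_iff[of 1, simplified])
  then have "\<alpha> > 0" using assms(3) by simp
  moreover have "\<bar>F i x - F i y\<bar> \<le> \<alpha> * dist x y" for i x y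
    using F(1)[of i x y] mult_right_mono[OF assms(3) zero_le_dist[of x y]] by linarith
  ultimately have "embeds_with_distortion S dist (span (unit_seq ` {..<k})) dist \<alpha>"
    by (rule embeds_in_finite_seqs[where F = F]) (use far in blast)
  then show "\<exists>V::linf set. has_dimension V k \<and> embeds_with_distortion S dist V dist \<alpha>"
    using span_unit_seq_dimension by blast
qed

lemma dim_red_modulus_le:
  assumes "q \<ge> 1" "t \<ge> 1" "128 * real t * real q \<le> \<alpha>"
    and "(1 - (1 - 1 / real q) * real n powr (- 2 / real t)) ^ k * real n ^ 2 < 1"
  shows "dim_red_modulus TYPE(linf) n \<alpha> \<le> k"
  unfolding dim_red_modulus_def
  by (intro Least_le allI impI finite_metric_embeds_in_linf_subspace[OF assms(1-3) _ _ assms(4)]) auto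

text \<open>The \<open>LEAST\<close> in the definition of the modulus is meaningful once some
  dimension serves all n-point sets. The choice q = 2, t = 1 provides one, and 128 * 1 * 2 is the
  origin of the bound 256.\<close>

lemma dim_red_modulus_embeds:
  fixes S :: "linf set"
  assumes "\<alpha> \<ge> 256" "finite S" "card S = n" "n \<ge> 1"
  shows "\<exists>V::linf set. has_dimension V (dim_red_modulus TYPE(linf) n \<alpha>) \<and>
    embeds_with_distortion S dist V dist \<alpha>"
proof -
  let ?\<eta> = "1 - (1 - 1 / real 2) * real n powr (- 2 / real 1)"
  have p: "0 < real n powr (- 2 / real 1)" "real n powr (- 2 / real 1) \<le> 1"
    using assms(4) powr_mono[of "-2" 0 "real n"] by auto
  then obtain k where "?\<eta> ^ k < 1 / real n ^ 2"
    using real_arch_pow_inv[of "1 / real n ^ 2" ?\<eta>] assms(4) by auto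
  then have "?\<eta> ^ k * real n ^ 2 < 1" using assms(4) by (simp add: less_divide_eq)
  then have "\<forall>S::linf set. finite S \<and> card S = n \<longrightarrow>
      (\<exists>V::linf set. has_dimension V k \<and> embeds_with_distortion S dist V dist \<alpha>)"
    using assms(1) by (intro allI impI finite_metric_embeds_in_linf_subspace[of 2 1]) auto
  then have "\<forall>S::linf set. finite S \<and> card S = n \<longrightarrow>
      (\<exists>V::linf set. has_dimension V (dim_red_modulus TYPE(linf) n \<alpha>) \<and> embeds_with_distortion S dist V dist \<alpha>)"
    unfolding dim_red_modulus_def by (rule LeastI)
  then show ?thesis using assms(2,3) by blast
qed

section \<open>Asymptotic upper bound for the modulus\<close>

lemma eventually_ln_ge:
  obtains n0 where "\<And>n. n \<ge> n0 \<Longrightarrow> ln (real n) \<ge> c"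
proof -
  have "filterlim (\<lambda>n. ln (real n)) at_top sequentially"
    by (rule filterlim_compose[OF ln_at_top filterlim_real_sequentially])
  then have "eventually (\<lambda>n. ln (real n) \<ge> c) sequentially"
    by (simp only: filterlim_at_top)
  then show ?thesis using that by (auto simp: eventually_sequentially)
qed

lemma ln_one_plus_le:
  fixes A :: real assumes "A \<ge> 2" shows "ln (1 + A) \<le> 2 * ln A"
proof -
  have "1 + A \<le> A ^ 2" using assms mult_mono[of 2 A A A] unfolding power2_eq_square by linarith
  then have "ln (1 + A) \<le> ln (A ^ 2)" using assms by simp
  then show ?thesis using assms by (simp add: ln_realpow)
qed

lemma nat_floor_ge_half:
  fixes x :: real assumes "x \<ge> 1" shows "real (nat \<lfloor>x\<rfloor>) \<ge> x / 2" "real (nat \<lfloor>x\<rfloor>) \<le> x" "nat \<lfloor>x\<rfloor> \<ge> 1"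
proof -
  have "real (nat \<lfloor>x\<rfloor>) = of_int \<lfloor>x\<rfloor>" using assms by simp
  moreover have "\<lfloor>x\<rfloor> \<ge> 1" using assms by simp
  ultimately show "real (nat \<lfloor>x\<rfloor>) \<ge> x / 2" using floor_correct[of x] by linarith
  show "real (nat \<lfloor>x\<rfloor>) \<le> x" using assms by linarith
  show "nat \<lfloor>x\<rfloor> \<ge> 1" using assms by linarith
qed

text \<open>The factor by which one line map decreases the number of unresolved pairs: for bounded
  \<open>\<alpha> / ln n\<close> it is bounded away from \<open>1\<close>, and for large \<open>\<alpha> / ln n = A\<close> the choice \<open>q \<approx> \<surd>A\<close>
  makes it at most \<open>A powr (- 1 / 4)\<close>.\<close>

lemma unresolved_factor_le:
  fixes \<beta> :: real
  assumes "\<beta> > 0"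
  obtains c where "c > 0" "\<And>n \<alpha>. n \<ge> 3 \<Longrightarrow> \<beta> * ln (real n) \<ge> 256 \<Longrightarrow> \<beta> * ln (real n) \<le> \<alpha> \<Longrightarrow> ln (real n) \<ge> 512 \<Longrightarrow>
     \<exists>q t. q \<ge> 1 \<and> t \<ge> 1 \<and> 128 * real t * real q \<le> \<alpha> \<and>
       1 - (1 - 1 / real q) * real n powr (- 2 / real t) \<le> exp (- c * ln (1 + \<alpha> / ln (real n)))"
proof -
  \<comment> \<open>For large A and B = A powr (1 / 4) the factor turns out to be at most 1025 / B ^
    2, with 1025 = 1 + 1024 from the losses in q and in t; beyond this threshold that is at most 1 /
    B.\<close>
  define A1 :: real where "A1 = 1025 ^ 4"
  \<comment> \<open>With q = 2 and t \<ge> \<alpha> / 512 the power \<open>n powr (- 2 / t)\<close>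
    is at least exp (- 1024 / \<beta>), and q = 2 halves it.\<close>
  define \<eta> where "\<eta> = exp (- 1024 / \<beta>) / 2"
  \<comment> \<open>The entry 1 / 8 comes from ln B = ln A / 4 and ln (1 + A) \<le> 2 ln A; the
    other entry lets the constant exp (- \<eta>) serve for all A \<le> A1.\<close>
  define c where "c = min (1 / 8) (\<eta> / ln (1 + A1))"
  have \<eta>: "\<eta> > 0" by (simp add: \<eta>_def)
  have lnA1: "ln (1 + A1) > 0" by (simp add: A1_def)
  have c: "c > 0" using \<eta> lnA1 by (simp add: c_def)
  have "\<exists>q t. q \<ge> 1 \<and> t \<ge> 1 \<and> 128 * real t * real q \<le> \<alpha> \<and>
       1 - (1 - 1 / real q) * real n powr (- 2 / real t) \<le> exp (- c * ln (1 + \<alpha> / ln (real n)))"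
    if n: "n \<ge> 3" and n1: "\<beta> * ln (real n) \<ge> 256" and \<alpha>: "\<beta> * ln (real n) \<le> \<alpha>" and L512: "ln (real n) \<ge> 512" for n \<alpha>
  proof -
    define L where "L = ln (real n)"
    have L: "L \<ge> 512" using L512 by (simp add: L_def)
    define A where "A = \<alpha> / L"
    have AL: "\<alpha> = A * L" using L by (simp add: A_def)
    have A\<beta>: "A \<ge> \<beta>" using \<alpha> L by (simp add: A_def L_def le_divide_eq)
    have A0: "A > 0" using A\<beta> assms by simp
    have npow: "real n powr x = exp (x * L)" for x using n by (simp add: powr_def L_def)
    show ?thesis
    proof (cases "A \<le> A1")
      case True
      define t where "t = nat \<lfloor>\<alpha> / 256\<rfloor>"
      have a256: "\<alpha> / 256 \<ge> 1" using n1 \<alpha> by simp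
      have t1: "t \<ge> 1" and tle: "real t \<le> \<alpha> / 256" and tge: "real t \<ge> \<alpha> / 512"
        using nat_floor_ge_half[OF a256] by (simp_all add: t_def)
      have "2 / real t * L \<le> 2 / (\<beta> * L / 512) * L"
      proof (intro mult_right_mono divide_left_mono)
        show "\<beta> * L / 512 \<le> real t" using tge \<alpha> by (simp add: L_def)
        show "0 < real t * (\<beta> * L / 512)" using t1 assms L by simp
      qed (use L in auto)
      also have "\<dots> = 1024 / \<beta>" using L assms by (simp add: field_simps)
      finally have "real n powr (- 2 / real t) \<ge> 2 * \<eta>" by (simp add: npow \<eta>_def)
      then have "1 - (1 - 1 / real 2) * real n powr (- 2 / real t) \<le> 1 - \<eta>" by simp
      also have "\<dots> \<le> exp (- \<eta>)" using exp_ge_add_one_self[of "- \<eta>"] by simp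
      also have "\<dots> \<le> exp (- c * ln (1 + A))"
      proof -
        have "c * ln (1 + A) \<le> (\<eta> / ln (1 + A1)) * ln (1 + A1)"
          using True A0 \<eta> lnA1 by (intro mult_mono) (auto simp: c_def)
        then show ?thesis using lnA1 by simp
      qed
      finally have "1 - (1 - 1 / real 2) * real n powr (- 2 / real t) \<le> exp (- c * ln (1 + \<alpha> / ln (real n)))"
        by (simp add: A_def L_def)
      moreover have "128 * real t * real 2 \<le> \<alpha>" using tle by simp
      ultimately show ?thesis using t1 by (intro exI[of _ 2] exI[of _ t]) auto
    next
      case False
      then have A1A: "A > A1" by simp
      define B where "B = sqrt (sqrt A)"
      have "sqrt (sqrt A1) = 1025"
      proof -
        have "A1 = (1025 ^ 2) ^ 2" by (simp add: A1_def)
        then show ?thesis by (simp only: real_sqrt_abs) simp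
      qed
      then have B: "B > 1025" using A1A unfolding B_def by (metis real_sqrt_less_mono)
      have B2: "B ^ 2 = sqrt A" and B4: "B ^ 4 = A"
      proof -
        show 1: "B ^ 2 = sqrt A" using A0 by (simp add: B_def)
        have "B ^ 4 = (B ^ 2) ^ 2" by simp
        also have "\<dots> = A" unfolding 1 using A0 by simp
        finally show "B ^ 4 = A" .
      qed
      have B2ge: "B ^ 2 \<ge> 1025" using B power_mono[of 1025 B 2] by simp
      \<comment> \<open>This balances the two losses: under the constraint 128 t q \<le> \<alpha>,
        both 1 / q and 2 L / t become of order 1 / sqrt A.\<close>
      define q where "q = nat \<lceil>B ^ 2\<rceil>"
      have qge: "real q \<ge> B ^ 2" unfolding q_def by linarith
      have qle: "real q \<le> 2 * B ^ 2" using B2ge unfolding q_def by linarith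
      have q1: "q \<ge> 1" using qge B2ge by linarith
      define x where "x = \<alpha> / (128 * real q)"
      have \<alpha>B: "\<alpha> = B ^ 2 * (B ^ 2 * L)" by (simp add: AL B4[symmetric] flip: power_add mult.assoc)
      have xge: "x \<ge> B ^ 2 * L / 256"
      proof -
        have "B ^ 2 * L / 256 * (128 * real q) \<le> B ^ 2 * L / 256 * (128 * (2 * B ^ 2))"
          using qle L by (intro mult_left_mono) auto
        also have "\<dots> = \<alpha>" unfolding \<alpha>B by simp
        finally show ?thesis using q1 by (simp add: x_def le_divide_eq)
      qed
      have x1: "x \<ge> 1"
      proof -
        have "1 * 256 \<le> B ^ 2 * L" using B2ge L by (intro mult_mono) auto
        then show ?thesis using xge by simp
      qed
      define t where "t = nat \<lfloor>x\<rfloor>"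
      have t1: "t \<ge> 1" and tle: "real t \<le> x" and tge: "real t \<ge> x / 2"
        using nat_floor_ge_half[OF x1] by (simp_all add: t_def)
      have "128 * real t * real q \<le> \<alpha>"
        using tle q1 by (simp add: x_def le_divide_eq mult_ac)
      moreover have "1 - (1 - 1 / real q) * real n powr (- 2 / real t) \<le> exp (- c * ln (1 + \<alpha> / ln (real n)))"
      proof -
        have "2 / real t * L \<le> 2 / (B ^ 2 * L / 512) * L"
        proof (intro mult_right_mono divide_left_mono)
          show "B ^ 2 * L / 512 \<le> real t" using tge xge by simp
          show "0 < real t * (B ^ 2 * L / 512)" using t1 B L by simp
        qed (use L in auto)
        also have "\<dots> = 1024 / B ^ 2" using L B by (simp add: field_simps)
        finally have e: "real n powr (- 2 / real t) \<ge> exp (- (1024 / B ^ 2))" by (simp add: npow)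
        have "exp (- (1024 / B ^ 2)) \<ge> 1 - 1024 / B ^ 2" using exp_ge_add_one_self[of "- (1024 / B ^ 2)"] by simp
        then have e1: "real n powr (- 2 / real t) \<ge> 1 - 1024 / B ^ 2" using e by linarith
        have e2: "1 - 1 / real q \<ge> 1 - 1 / B ^ 2" using qge B q1 by (simp add: frac_le)
        have "(1 - 1 / B ^ 2) * (1 - 1024 / B ^ 2) \<le> (1 - 1 / real q) * real n powr (- 2 / real t)"
          using e1 e2 B2ge q1 by (intro mult_mono) (auto simp: divide_le_eq)
        moreover have "(1 - y) * (1 - 1024 * y) = 1 - 1025 * y + y * (1024 * y)" for y :: real
          by (simp add: algebra_simps)
        from this[of "1 / B ^ 2"]
        have "(1 - 1 / B ^ 2) * (1 - 1024 / B ^ 2) = 1 - 1025 / B ^ 2 + (1 / B ^ 2) * (1024 / B ^ 2)"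
          by simp
        moreover have "(1 / B ^ 2) * (1024 / B ^ 2) \<ge> 0" by simp
        ultimately have "1 - (1 - 1 / real q) * real n powr (- 2 / real t) \<le> 1025 / B ^ 2" by linarith
        also have "\<dots> \<le> B / B ^ 2" using B by (intro divide_right_mono) auto
        also have "\<dots> = exp (- ln B)" using B by (simp add: exp_minus power2_eq_square field_simps)
        also have "\<dots> \<le> exp (- c * ln (1 + A))"
        proof -
          have "ln A = 4 * ln B" using B by (simp add: B4[symmetric] ln_realpow)
          moreover have "A \<ge> 2" using A1A by (simp add: A1_def)
          then have "ln (1 + A) \<le> 2 * ln A" by (rule ln_one_plus_le)
          moreover have "c * ln (1 + A) \<le> (1 / 8) * ln (1 + A)"
          proof (rule mult_right_mono)
            show "c \<le> 1 / 8" unfolding c_def by (rule min.cobounded1)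
          qed (use A0 in simp)
          ultimately show ?thesis by simp
        qed
        finally show ?thesis by (simp add: A_def L_def)
      qed
      ultimately show ?thesis using q1 t1 by blast
    qed
  qed
  then show ?thesis using that c by blast
qed

text \<open>After k maps at most exp (- c k ln (1 + A)) n ^ 2 pairs are unresolved, where A =
  \<alpha> / ln n, so any k above 2 ln n / (c ln (1 + A)) leaves none.\<close>

lemma dim_red_modulus_upper_bound:
  fixes \<beta> :: real
  assumes "\<beta> > 0"
  obtains C n0 where "C > 0" "\<And>n \<alpha>. n \<ge> n0 \<Longrightarrow> \<beta> * ln (real n) \<le> \<alpha> \<Longrightarrow> \<alpha> \<le> real n \<Longrightarrow>
     real (dim_red_modulus TYPE(linf) n \<alpha>) \<le> C * (ln (real n) / ln (1 + \<alpha> / ln (real n)))"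
proof -
  obtain c where c: "c > 0" "\<And>n \<alpha>. n \<ge> 3 \<Longrightarrow> \<beta> * ln (real n) \<ge> 256 \<Longrightarrow> \<beta> * ln (real n) \<le> \<alpha> \<Longrightarrow> ln (real n) \<ge> 512 \<Longrightarrow>
     \<exists>q t. q \<ge> 1 \<and> t \<ge> 1 \<and> 128 * real t * real q \<le> \<alpha> \<and>
       1 - (1 - 1 / real q) * real n powr (- 2 / real t) \<le> exp (- c * ln (1 + \<alpha> / ln (real n)))"
    using unresolved_factor_le[OF assms] by blast
  define C where "C = 2 / c + 1"
  obtain n1 where n1: "\<And>n. n \<ge> n1 \<Longrightarrow> ln (real n) \<ge> max 512 (256 / \<beta>)"
    using eventually_ln_ge by blast
  have "real (dim_red_modulus TYPE(linf) n \<alpha>) \<le> C * (ln (real n) / ln (1 + \<alpha> / ln (real n)))"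
    if n: "n \<ge> max 3 n1" and \<alpha>: "\<beta> * ln (real n) \<le> \<alpha>" "\<alpha> \<le> real n" for n \<alpha>
  proof -
    define L where "L = ln (real n)"
    have L: "L \<ge> 512" and L\<beta>: "L \<ge> 256 / \<beta>" using n1[of n] n by (auto simp: L_def)
    define l where "l = ln (1 + \<alpha> / L)"
    have "\<beta> * L > 0" using assms L by simp
    then have "\<alpha> > 0" using \<alpha>(1) unfolding L_def by linarith
    then have "1 < 1 + \<alpha> / L" using L by simp
    then have l: "l > 0" unfolding l_def by (rule ln_gt_zero)
    have "\<beta> * L \<ge> 256" using L\<beta> assms by (simp add: field_simps)
    then obtain q t where qt: "q \<ge> 1" "t \<ge> 1" "128 * real t * real q \<le> \<alpha>"
       "1 - (1 - 1 / real q) * real n powr (- 2 / real t) \<le> exp (- c * l)"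
      using c(2)[of n \<alpha>] n \<alpha>(1) L unfolding L_def l_def by (meson max.boundedE)
    define k where "k = nat \<lfloor>2 * L / (c * l)\<rfloor> + 1"
    have kge: "real k > 2 * L / (c * l)" and kle: "real k \<le> 2 * L / (c * l) + 1"
    proof -
      have "2 * L / (c * l) \<ge> 0" using L l c(1) by simp
      then have "real k = of_int \<lfloor>2 * L / (c * l)\<rfloor> + 1" by (simp add: k_def)
      then show "real k > 2 * L / (c * l)" "real k \<le> 2 * L / (c * l) + 1" by simp_all
    qed
    let ?\<eta> = "1 - (1 - 1 / real q) * real n powr (- 2 / real t)"
    have "real n powr (- 2 / real t) \<le> real n powr 0" using n by (intro powr_mono) auto
    then have "(1 - 1 / real q) * real n powr (- 2 / real t) \<le> 1 * 1"
      using qt(1) n by (intro mult_mono) auto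
    then have "?\<eta> ^ k \<le> exp (- c * l) ^ k" using qt(4) by (intro power_mono) auto
    also have "\<dots> = exp (- (real k * (c * l)))" by (simp add: exp_of_nat_mult[symmetric])
    also have "\<dots> < exp (- (2 * L))" using kge c(1) l by (simp add: divide_less_eq)
    finally have "?\<eta> ^ k * real n ^ 2 < exp (- (2 * L)) * real n ^ 2" using n by (intro mult_strict_right_mono) auto
    also have "\<dots> = 1"
    proof -
      have "exp (2 * L) = exp L ^ 2" by (simp add: exp_of_nat_mult[of 2, simplified])
      also have "exp L = real n" using n by (simp add: L_def)
      finally have "exp (2 * L) = real n ^ 2" .
      then show ?thesis by (metis exp_minus_inverse mult.commute)
    qed
    finally have "dim_red_modulus TYPE(linf) n \<alpha> \<le> k" using dim_red_modulus_le[OF qt(1-3)] by blast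
    then have "real (dim_red_modulus TYPE(linf) n \<alpha>) \<le> 2 * L / (c * l) + 1" using kle by linarith
    \<comment> \<open>The 1 from rounding k is absorbed because l \<le> L; this is where \<alpha>
      \<le> n enters.\<close>
    also have "\<dots> \<le> 2 * L / (c * l) + L / l"
    proof -
      have "1 + \<alpha> / L \<le> 1 + real n / 512" using \<alpha>(2) L n by (intro add_left_mono frac_le) auto
      also have "\<dots> \<le> real n" using n by simp
      finally have "ln (1 + \<alpha> / L) \<le> ln (real n)" using \<open>1 < 1 + \<alpha> / L\<close> by (intro ln_mono) auto
      then have "l \<le> L" by (simp add: l_def L_def)
      then show ?thesis using l by simp
    qed
    also have "\<dots> = C * (L / l)" using c(1) l by (simp add: C_def field_simps)
    finally show ?thesis by (simp add: L_def l_def)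
  qed
  moreover have "C > 0" using c(1) by (simp add: C_def add_pos_pos)
  ultimately show ?thesis using that by blast
qed

section \<open>Shortest-path metrics of regular graphs\<close>

lemma sym_relpow_mem:
  assumes "sym R" "(u, v) \<in> R ^^ l" shows "(v, u) \<in> R ^^ l"
  using assms(2)
proof (induction l arbitrary: v)
  case (Suc l)
  then obtain w where w: "(u, w) \<in> R ^^ l" "(w, v) \<in> R" by auto
  then have "(v, w) \<in> R" using assms(1) by (blast dest: symD)
  then show ?case using Suc.IH[OF w(1)] by (rule relpow_Suc_I2)
qed simp

lemma sym_adj: "sym (adj E)"
  by (auto simp: sym_def adj_def insert_commute)

abbreviation connected_regular_graphs :: "nat \<Rightarrow> nat \<Rightarrow> nat set set set" where
  "connected_regular_graphs n \<Delta> \<equiv> {E \<in> regular_graphs n \<Delta>. connected_graph n E}"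

abbreviation embeddable_graphs :: "nat \<Rightarrow> nat \<Rightarrow> real \<Rightarrow> real \<Rightarrow> nat set set set" where
  "embeddable_graphs n \<Delta> d \<alpha> \<equiv> {E \<in> regular_graphs n \<Delta>. connected_graph n E \<and>
     embeds_in_dimension_at_most {1..n} (graph_dist E) d \<alpha>}"

lemma regular_graph_edge:
  assumes "E \<in> regular_graphs n \<Delta>" "{u, v} \<in> E"
  shows "u \<in> {1..n}" "v \<in> {1..n}" "u \<noteq> v"
  using assms unfolding regular_graphs_def by (fastforce simp: card_insert_if)+

lemma regular_graph_edgeE:
  assumes "E \<in> regular_graphs n \<Delta>" "e \<in> E"
  obtains u v where "e = {u, v}"
proof -
  have "card e = 2" using assms by (auto simp: regular_graphs_def)
  then show ?thesis using that by (auto simp: card_2_iff)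
qed

lemma regular_graph_degree:
  assumes E: "E \<in> regular_graphs n \<Delta>" and u: "u \<in> {1..n}"
  shows "finite {v. {u, v} \<in> E}" "card {v. {u, v} \<in> E} = \<Delta>"
proof -
  show "finite {v. {u, v} \<in> E}"
    by (rule finite_subset[of _ "{1..n}"]) (use regular_graph_edge[OF E] in blast)+
  have "{e \<in> E. u \<in> e} = (\<lambda>v. {u, v}) ` {v. {u, v} \<in> E}"
  proof (intro equalityI subsetI)
    fix e assume e: "e \<in> {e \<in> E. u \<in> e}"
    then obtain a b where ab: "e = {a, b}" using regular_graph_edgeE[OF E] by blast
    then show "e \<in> (\<lambda>v. {u, v}) ` {v. {u, v} \<in> E}" using e by (auto simp: insert_commute)
  qed auto
  moreover have "inj_on (\<lambda>v. {u, v}) {v. {u, v} \<in> E}"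
    by (auto simp: inj_on_def doubleton_eq_iff)
  ultimately have "card {e \<in> E. u \<in> e} = card {v. {u, v} \<in> E}" by (simp add: card_image)
  then show "card {v. {u, v} \<in> E} = \<Delta>" using E u by (auto simp: regular_graphs_def)
qed

definition hop_dist :: "nat set set \<Rightarrow> nat \<Rightarrow> nat \<Rightarrow> nat" where
  "hop_dist E u v = (LEAST l. (u, v) \<in> adj E ^^ l)"

lemma graph_dist_eq_hop_dist: "graph_dist E u v = real (hop_dist E u v)"
  by (simp add: graph_dist_def hop_dist_def)

context
  fixes E :: "nat set set" and n \<Delta> :: nat
  assumes E: "E \<in> regular_graphs n \<Delta>" and con: "connected_graph n E"
begin

lemma hop_dist_walk:
  assumes "u \<in> {1..n}" "v \<in> {1..n}"
  shows "(u, v) \<in> adj E ^^ hop_dist E u v"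
proof -
  have "(u, v) \<in> (adj E)\<^sup>*" using con assms by (auto simp: connected_graph_def)
  then show ?thesis unfolding hop_dist_def by (meson LeastI rtrancl_imp_relpow)
qed

lemma hop_dist_le: "(u, v) \<in> adj E ^^ l \<Longrightarrow> hop_dist E u v \<le> l"
  unfolding hop_dist_def by (rule Least_le)

lemma hop_dist_self [simp]: "hop_dist E u u = 0"
  using hop_dist_le[of u u 0] by simp

lemma hop_dist_eq_0: "u \<in> {1..n} \<Longrightarrow> v \<in> {1..n} \<Longrightarrow> hop_dist E u v = 0 \<longleftrightarrow> u = v"
  using hop_dist_walk[of u v] by force

lemma hop_dist_commute: "u \<in> {1..n} \<Longrightarrow> v \<in> {1..n} \<Longrightarrow> hop_dist E u v = hop_dist E v u"
  using hop_dist_le hop_dist_walk sym_relpow_mem[OF sym_adj] by (metis le_antisym)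

lemma hop_dist_triangle:
  "u \<in> {1..n} \<Longrightarrow> v \<in> {1..n} \<Longrightarrow> w \<in> {1..n} \<Longrightarrow> hop_dist E u w \<le> hop_dist E u v + hop_dist E v w"
  using hop_dist_le hop_dist_walk relpow_trans by metis

lemma hop_dist_edge: "{u, v} \<in> E \<Longrightarrow> hop_dist E u v \<le> 1"
  using hop_dist_le[of u v 1] by (simp add: adj_def)

lemma hop_dist_parent:
  assumes "u \<in> {1..n}" "v \<in> {1..n}" "u \<noteq> v"
  shows "\<exists>p. p \<in> {1..n} \<and> {p, v} \<in> E \<and> hop_dist E u v = Suc (hop_dist E u p)"
proof -
  obtain l where l: "hop_dist E u v = Suc l"
    using hop_dist_eq_0[OF assms(1,2)] assms(3) by (cases "hop_dist E u v") auto
  then have "(u, v) \<in> adj E ^^ Suc l" using hop_dist_walk[OF assms(1,2)] by simp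
  then obtain p where p: "(u, p) \<in> adj E ^^ l" "{p, v} \<in> E" by (auto simp: adj_def)
  have pV: "p \<in> {1..n}" using regular_graph_edge[OF E p(2)] by blast
  have "hop_dist E u v \<le> hop_dist E u p + hop_dist E p v" using hop_dist_triangle assms pV by blast
  then have "hop_dist E u v \<le> hop_dist E u p + 1" using hop_dist_edge[OF p(2)] by linarith
  moreover have "hop_dist E u p \<le> l" by (rule hop_dist_le[OF p(1)])
  ultimately show ?thesis using l pV p(2) by (intro exI[of _ p]) auto
qed

text \<open>Moving from v to its parent towards u lowers the distance by exactly one, so no value is
  skipped. Consequently distances stay below the number of vertices.\<close>

lemma hop_dist_attains:
  assumes "u \<in> {1..n}" "v \<in> {1..n}" "l \<le> hop_dist E u v"
  shows "\<exists>w\<in>{1..n}. hop_dist E u w = l"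
  using assms(2,3)
proof (induction "hop_dist E u v" arbitrary: v)
  case 0
  then show ?case by auto
next
  case (Suc k)
  show ?case
  proof (cases "l = Suc k")
    case False
    have "u \<noteq> v" using Suc.hyps(2) by auto
    then obtain p where p: "p \<in> {1..n}" "hop_dist E u v = Suc (hop_dist E u p)"
      using hop_dist_parent[OF assms(1) Suc.prems(1)] by blast
    then show ?thesis using Suc.hyps Suc.prems False by (metis Suc_inject le_Suc_eq)
  qed (use Suc in auto)
qed

lemma hop_dist_less:
  assumes "u \<in> {1..n}" "v \<in> {1..n}"
  shows "hop_dist E u v < n"
proof -
  have "{..hop_dist E u v} \<subseteq> hop_dist E u ` {1..n}"
    using hop_dist_attains[OF assms] by force
  then have "card {..hop_dist E u v} \<le> card (hop_dist E u ` {1..n})" by (intro card_mono) auto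
  also have "\<dots> \<le> card {1..n}" by (intro card_image_le) simp
  finally show ?thesis by simp
qed

lemma card_walks_le:
  assumes "u \<in> {1..n}"
  shows "finite {v. (u, v) \<in> adj E ^^ l} \<and> {v. (u, v) \<in> adj E ^^ l} \<subseteq> {1..n} \<and> card {v. (u, v) \<in> adj E ^^ l} \<le> \<Delta> ^ l"
proof (induction l)
  case 0
  have "{v. u = v} = {u}" by auto
  then show ?case using assms by simp
next
  case (Suc l)
  let ?W = "{v. (u, v) \<in> adj E ^^ l}"
  have eq: "{v. (u, v) \<in> adj E ^^ Suc l} = (\<Union>w\<in>?W. {v. {w, v} \<in> E})"
    by (auto simp: adj_def relcomp_unfold)
  have "card (\<Union>w\<in>?W. {v. {w, v} \<in> E}) \<le> (\<Sum>w\<in>?W. card {v. {w, v} \<in> E})"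
    using Suc by (intro card_UN_le) auto
  also have "\<dots> = (\<Sum>w\<in>?W. \<Delta>)"
    using Suc regular_graph_degree(2)[OF E] by (intro sum.cong) auto
  also have "\<dots> \<le> \<Delta> ^ Suc l" using Suc by simp
  finally have "card {v. (u, v) \<in> adj E ^^ Suc l} \<le> \<Delta> ^ Suc l" unfolding eq .
  moreover have "{v. (u, v) \<in> adj E ^^ Suc l} \<subseteq> {1..n}"
    unfolding eq using regular_graph_edge[OF E] by blast
  ultimately show ?case using finite_subset[of _ "{1..n}"] by blast
qed

lemma card_hop_ball_le:
  assumes "u \<in> {1..n}" "\<Delta> \<ge> 2"
  shows "card {v \<in> {1..n}. hop_dist E u v \<le> l} \<le> \<Delta> ^ Suc l"
proof -
  have "{v \<in> {1..n}. hop_dist E u v \<le> l} \<subseteq> (\<Union>j\<le>l. {v. (u, v) \<in> adj E ^^ j})"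
    using hop_dist_walk[OF assms(1)] by blast
  moreover have "finite (\<Union>j\<le>l. {v. (u, v) \<in> adj E ^^ j})" using card_walks_le[OF assms(1)] by blast
  ultimately have "card {v \<in> {1..n}. hop_dist E u v \<le> l} \<le> card (\<Union>j\<le>l. {v. (u, v) \<in> adj E ^^ j})"
    by (rule card_mono[rotated])
  also have "\<dots> \<le> (\<Sum>j\<le>l. card {v. (u, v) \<in> adj E ^^ j})" by (intro card_UN_le) simp
  also have "\<dots> \<le> (\<Sum>j\<le>l. \<Delta> ^ j)" using card_walks_le[OF assms(1)] by (intro sum_mono) blast
  also have "\<dots> \<le> \<Delta> ^ Suc l"
  proof (induction l)
    case (Suc l)
    have "2 * \<Delta> ^ Suc l \<le> \<Delta> * \<Delta> ^ Suc l" using assms(2) by (intro mult_right_mono) auto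
    then have "(\<Sum>j\<le>l. \<Delta> ^ j) + \<Delta> ^ Suc l \<le> \<Delta> * \<Delta> ^ Suc l" using Suc by linarith
    then show ?case by simp
  qed (use assms(2) in simp)
  finally show ?thesis .
qed

end

section \<open>The Frechet embedding of finite metrics and of connected graphs\<close>

lemma finite_metric_isometric_in_linf:
  fixes d :: "nat \<Rightarrow> nat \<Rightarrow> real"
  assumes d: "\<And>x. x \<in> {1..n} \<Longrightarrow> d x x = 0" "\<And>x y. x \<in> {1..n} \<Longrightarrow> y \<in> {1..n} \<Longrightarrow> d x y = d y x"
    "\<And>x y z. x \<in> {1..n} \<Longrightarrow> y \<in> {1..n} \<Longrightarrow> z \<in> {1..n} \<Longrightarrow> d x z \<le> d x y + d y z"
  defines "\<phi> \<equiv> \<lambda>x. finite_seq n (\<lambda>i. d x (Suc i))"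
  assumes xy: "x \<in> {1..n}" "y \<in> {1..n}"
  shows "dist (\<phi> x) (\<phi> y) = d x y"
proof (rule antisym)
  have pos: "d x y \<ge> 0" using d(1)[OF xy(1)] d(2)[OF xy] d(3)[OF xy(1) xy(2) xy(1)] by simp
  show "dist (\<phi> x) (\<phi> y) \<le> d x y"
  proof (rule dist_bound)
    fix i
    show "dist (apply_bcontfun (\<phi> x) i) (apply_bcontfun (\<phi> y) i) \<le> d x y"
    proof (cases "i < n")
      case True
      then have i: "Suc i \<in> {1..n}" by simp
      show ?thesis using True d(3)[OF xy i] d(3)[OF xy(2,1) i] d(2)[OF xy]
        by (simp add: \<phi>_def dist_real_def abs_le_iff)
    qed (use pos in \<open>simp add: \<phi>_def\<close>)
  qed
  \<comment> \<open>The coordinate that belongs to y itself attains the distance.\<close>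
  obtain j where j: "y = Suc j" "j < n" using xy(2) by (cases y) auto
  have "d x y \<le> dist (apply_bcontfun (\<phi> x) j) (apply_bcontfun (\<phi> y) j)"
    using j d(1)[OF xy(2)] by (simp add: \<phi>_def dist_real_def)
  also have "\<dots> \<le> dist (\<phi> x) (\<phi> y)" by (rule dist_bounded)
  finally show "d x y \<le> dist (\<phi> x) (\<phi> y)" .
qed

lemma embeds_in_dimension_of_subspace:
  fixes V :: "'a::real_normed_vector set"
  assumes "has_dimension V k" "embeds_with_distortion M d V dist \<alpha>"
  shows "embeds_in_dimension_at_most M d k \<alpha>"
proof -
  from normed_space_in_coordinates[OF assms(1)] obtain N \<psi> where
    N: "norm_on_coord_space k N" and bij: "bij_betw \<psi> (coord_space k) V" and
    props: "\<forall>x\<in>coord_space k. norm (\<psi> x) = N x"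
      "\<forall>x\<in>coord_space k. \<forall>y\<in>coord_space k. \<psi> (\<lambda>i. x i + y i) = \<psi> x + \<psi> y"
      "\<forall>a. \<forall>x\<in>coord_space k. \<psi> (\<lambda>i. a * x i) = a *\<^sub>R \<psi> x"
    by (elim exE conjE)
  note nrm = props(1)[rule_format] and add = props(2)[rule_format] and scale = props(3)[rule_format]
  obtain f where f: "f \<in> M \<rightarrow> V" "\<And>s s'. s \<in> M \<Longrightarrow> s' \<in> M \<Longrightarrow> dist (f s) (f s') \<le> d s s' \<and> d s s' \<le> \<alpha> * dist (f s) (f s')"
    using assms(2) by (auto simp: embeds_with_distortion_def)
  define \<zeta> where "\<zeta> = inv_into (coord_space k) \<psi>"
  have \<zeta>: "\<zeta> v \<in> coord_space k" "\<psi> (\<zeta> v) = v" if "v \<in> V" for v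
    using bij that unfolding \<zeta>_def bij_betw_def by (auto simp: inv_into_into f_inv_into_f)
  have N_diff: "N (\<lambda>i. x i - y i) = dist (\<psi> x) (\<psi> y)" if xy: "x \<in> coord_space k" "y \<in> coord_space k" for x y
  proof -
    have my: "(\<lambda>i. (- 1) * y i) \<in> coord_space k" and s: "(\<lambda>i. x i - y i) \<in> coord_space k"
      using xy by (auto simp: coord_space_def)
    have "\<psi> (\<lambda>i. x i - y i) = \<psi> (\<lambda>i. x i + (- 1) * y i)" by simp
    also have "\<dots> = \<psi> x + (- 1) *\<^sub>R \<psi> y" using add[OF xy(1) my] scale[OF xy(2), of "- 1"] by simp
    finally show ?thesis using nrm[OF s] by (simp add: dist_norm)
  qed
  have "embeds_with_distortion M d (coord_space k) (\<lambda>x y. N (\<lambda>i. x i - y i)) \<alpha>"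
    unfolding embeds_with_distortion_def
  proof (intro bexI[of _ "\<lambda>s. \<zeta> (f s)"] ballI)
    show "(\<lambda>s. \<zeta> (f s)) \<in> M \<rightarrow> coord_space k" using f(1) \<zeta>(1) by blast
    fix s s' assume s: "s \<in> M" "s' \<in> M"
    then have fs: "f s \<in> V" "f s' \<in> V" using f(1) by auto
    show "N (\<lambda>i. \<zeta> (f s) i - \<zeta> (f s') i) \<le> d s s' \<and> d s s' \<le> \<alpha> * N (\<lambda>i. \<zeta> (f s) i - \<zeta> (f s') i)"
      using f(2)[OF s] N_diff[OF \<zeta>(1)[OF fs(1)] \<zeta>(1)[OF fs(2)]] \<zeta>(2)[OF fs(1)] \<zeta>(2)[OF fs(2)] by simp
  qed
  then show ?thesis unfolding embeds_in_dimension_at_most_def using N by blast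
qed

text \<open>The modulus speaks about n-point subsets of \<open>linf\<close>, so the graph is first
  replaced by an isometric copy there; injectivity ensures that the copy has exactly n
  points.\<close>

lemma connected_regular_graph_embeds:
  assumes E: "E \<in> regular_graphs n \<Delta>" and con: "connected_graph n E" and \<alpha>: "\<alpha> \<ge> 256" and n: "n \<ge> 1"
  shows "embeds_in_dimension_at_most {1..n} (graph_dist E) (dim_red_modulus TYPE(linf) n \<alpha>) \<alpha>"
proof -
  define d where "d = graph_dist E"
  define \<phi> where "\<phi> x = finite_seq n (\<lambda>i. d x (Suc i))" for x
  have d_eq: "d x y = real (hop_dist E x y)" for x y by (simp add: d_def graph_dist_eq_hop_dist)
  have iso: "dist (\<phi> x) (\<phi> y) = d x y" if "x \<in> {1..n}" "y \<in> {1..n}" for x y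
    unfolding \<phi>_def
  proof (rule finite_metric_isometric_in_linf)
    show "d x x = 0" for x using hop_dist_self[OF E con] by (simp add: d_eq)
    show "d x y = d y x" if "x \<in> {1..n}" "y \<in> {1..n}" for x y
      using hop_dist_commute[OF E con that] by (simp add: d_eq)
    show "d x z \<le> d x y + d y z" if "x \<in> {1..n}" "y \<in> {1..n}" "z \<in> {1..n}" for x y z
      using hop_dist_triangle[OF E con that] by (simp add: d_eq flip: of_nat_add)
  qed (use that in auto)
  have "inj_on \<phi> {1..n}"
  proof (rule inj_onI)
    fix x y assume xy: "x \<in> {1..n}" "y \<in> {1..n}" "\<phi> x = \<phi> y"
    then have "d x y = 0" using iso[of x y] by simp
    then show "x = y" using hop_dist_eq_0[OF E con xy(1,2)] by (simp add: d_eq)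
  qed
  then have card: "card (\<phi> ` {1..n}) = n" by (simp add: card_image)
  obtain V :: "linf set" where V: "has_dimension V (dim_red_modulus TYPE(linf) n \<alpha>)"
      "embeds_with_distortion (\<phi> ` {1..n}) dist V dist \<alpha>"
    using dim_red_modulus_embeds[OF \<alpha> _ card n] by auto
  then obtain g where g: "g \<in> \<phi> ` {1..n} \<rightarrow> V"
     "\<And>s s'. s \<in> \<phi> ` {1..n} \<Longrightarrow> s' \<in> \<phi> ` {1..n} \<Longrightarrow> dist (g s) (g s') \<le> dist s s' \<and> dist s s' \<le> \<alpha> * dist (g s) (g s')"
    by (auto simp: embeds_with_distortion_def)
  have "embeds_with_distortion {1..n} d V dist \<alpha>"
    unfolding embeds_with_distortion_def
  proof (intro bexI[of _ "\<lambda>x. g (\<phi> x)"] ballI)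
    fix x y assume xy: "x \<in> {1..n}" "y \<in> {1..n}"
    show "dist (g (\<phi> x)) (g (\<phi> y)) \<le> d x y \<and> d x y \<le> \<alpha> * dist (g (\<phi> x)) (g (\<phi> y))"
      using g(2)[of "\<phi> x" "\<phi> y"] iso[OF xy] xy by simp
  qed (use g(1) in auto)
  then show ?thesis using embeds_in_dimension_of_subspace[OF V(1)] by (simp add: d_def)
qed

section \<open>Packing and norming functionals for seminorms of finite rank\<close>

text \<open>A norm on \<open>coord_space m\<close> lives on a set of functions. Composed with the
  truncation to m coordinates it becomes a function on the vector space \<open>linf\<close>, at the
  price of a kernel; hence seminorms, with a rank in place of the dimension.\<close>

definition seminorm :: "('a::real_vector \<Rightarrow> real) \<Rightarrow> bool" where
  "seminorm N \<longleftrightarrow> (\<forall>x y. N (x + y) \<le> N x + N y) \<and> (\<forall>a x. N (a *\<^sub>R x) = \<bar>a\<bar> * N x)"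

text \<open>The quotient by the kernel of the seminorm has dimension at most \<open>m\<close>.\<close>

definition seminorm_rank_le :: "('a::real_vector \<Rightarrow> real) \<Rightarrow> nat \<Rightarrow> bool" where
  "seminorm_rank_le N m \<longleftrightarrow> (\<exists>B. finite B \<and> card B \<le> m \<and> (\<forall>x. \<exists>y\<in>span B. N (x - y) = 0))"

context
  fixes N :: "'a::real_vector \<Rightarrow> real"
  assumes N: "seminorm N"
begin

lemma seminorm_triangle: "N (x + y) \<le> N x + N y"
  using N by (simp add: seminorm_def)

lemma seminorm_scale: "N (a *\<^sub>R x) = \<bar>a\<bar> * N x"
  using N by (simp add: seminorm_def)

lemma seminorm_zero: "N 0 = 0"
  using seminorm_scale[of 0 0] by simp

lemma seminorm_minus: "N (- x) = N x"
  using seminorm_scale[of "-1" x] by simp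

lemma seminorm_nonneg: "N x \<ge> 0"
  using seminorm_triangle[of x "- x"] by (simp add: seminorm_zero seminorm_minus)

lemma seminorm_minus_commute: "N (x - y) = N (y - x)"
  using seminorm_minus[of "x - y"] by simp

lemma seminorm_triangle_minus: "N (x - y) \<le> N x + N y"
  using seminorm_triangle[of x "- y"] by (simp add: seminorm_minus)

lemma seminorm_triangle_rev: "N x - N y \<le> N (x - y)"
  using seminorm_triangle[of "x - y" y] by simp

lemma seminorm_sum: "N (sum f A) \<le> (\<Sum>i\<in>A. N (f i))"
proof (induction A rule: infinite_finite_induct)
  case (insert a A)
  then show ?case using seminorm_triangle[of "f a" "sum f A"] by simp
qed (simp_all add: seminorm_zero)

text \<open>A volume argument without volumes: the points \<open>s\<^sub>0 + l s\<^sub>1 + l\<^sup>2 s\<^sub>2 + \<dots>\<close> given by the words of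
  length \<open>T\<close> over \<open>S\<close> are separated by a multiple of \<open>l ^ T\<close> and have bounded coordinates, so there
  are at most a constant times \<open>(1 / l) ^ (m * T)\<close> of them, and the constant disappears when \<open>T\<close>
  tends to infinity.\<close>

lemma seminorm_packing:
  assumes rank: "seminorm_rank_le N m" and S: "finite S" "\<And>x. x \<in> S \<Longrightarrow> N x \<le> R"
    and sep: "\<And>x y. x \<in> S \<Longrightarrow> y \<in> S \<Longrightarrow> x \<noteq> y \<Longrightarrow> N (x - y) \<ge> r" and r: "r > 0" and R: "R \<ge> 0"
  shows "real (card S) \<le> (2 + 4 * R / r) ^ m"
proof -
  obtain B where B: "finite B" "card B \<le> m" "\<And>x. \<exists>y\<in>span B. N (x - y) = 0"
    using rank by (auto simp: seminorm_rank_le_def)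
  have "\<exists>a. N (x - (\<Sum>b\<in>B. a b *\<^sub>R b)) = 0" for x
    using B(3)[of x] span_finite[OF B(1)] by auto
  then obtain a where a: "\<And>x. N (x - (\<Sum>b\<in>B. a x b *\<^sub>R b)) = 0" by metis
  \<comment> \<open>Chosen so that \<open>l * (R + r / 2) = r / 4\<close>: points of words then stay
    within R + r / 2, and two tails together contribute at most r / 2. The base of the final bound
    is 1 / l.\<close>
  define l where "l = r / (4 * R + 2 * r)"
  have l0: "l > 0" and l2: "l \<le> 1 / 2" using r R by (auto simp: l_def field_simps)
  have lR: "l * (R + r / 2) = r / 4" using r R by (simp add: l_def field_simps)
  define p where "p xs = foldr (\<lambda>s v. s + l *\<^sub>R v) xs 0" for xs :: "'a list"
  define co where "co b xs = foldr (\<lambda>s v. a s b + l * v) xs 0" for b xs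
  have p_simps: "p [] = 0" "p (s # xs) = s + l *\<^sub>R p xs" for s xs by (auto simp: p_def)
  have co_simps: "co b [] = 0" "co b (s # xs) = a s b + l * co b xs" for b s xs by (auto simp: co_def)
  have pR: "N (p xs) \<le> R + r / 2" if "set xs \<subseteq> S" for xs
    using that
  proof (induction xs)
    case (Cons s xs)
    have "N (p (s # xs)) \<le> N s + l * N (p xs)"
      using seminorm_triangle[of s "l *\<^sub>R p xs"] l0 by (simp add: p_simps seminorm_scale)
    also have "\<dots> \<le> R + l * (R + r / 2)"
      using Cons S(2)[of s] l0 by (intro add_mono mult_left_mono) auto
    finally show ?case using lR r by simp
  qed (use r R in \<open>simp add: p_simps seminorm_zero\<close>)
  \<comment> \<open>The first letter in which two words differ decides: there the points are r
    apart, the tails take away at most r / 2, and each common letter before it costs a factor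
    l.\<close>
  have psep: "N (p xs - p ys) \<ge> l ^ T * r / 2"
    if "set xs \<subseteq> S" "set ys \<subseteq> S" "length xs = T" "length ys = T" "xs \<noteq> ys" for xs ys T
    using that
  proof (induction T arbitrary: xs ys)
    case (Suc T)
    obtain x xs' y ys' where xy: "xs = x # xs'" "ys = y # ys'"
      using Suc.prems(3,4) by (metis length_Suc_conv)
    have diff: "p xs - p ys = (x - y) + l *\<^sub>R (p xs' - p ys')"
      by (simp add: xy p_simps scaleR_diff_right)
    show ?case
    proof (cases "x = y")
      case True
      then have "N (p xs - p ys) = l * N (p xs' - p ys')"
        using diff l0 by (simp add: seminorm_scale)
      moreover have "N (p xs' - p ys') \<ge> l ^ T * r / 2"
        using Suc.IH[of xs' ys'] Suc.prems xy True by simp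
      ultimately show ?thesis using l0 mult_left_mono[of "l ^ T * r / 2" "N (p xs' - p ys')" l] by simp
    next
      case False
      have "N (x - y) \<ge> r" using sep[of x y] Suc.prems(1,2) xy False by simp
      moreover have "N (l *\<^sub>R (p xs' - p ys')) \<le> r / 2"
      proof -
        have "N (p xs' - p ys') \<le> 2 * (R + r / 2)"
          using seminorm_triangle_minus[of "p xs'" "p ys'"] pR[of xs'] pR[of ys'] Suc.prems(1,2) xy by simp
        then have "l * N (p xs' - p ys') \<le> l * (2 * (R + r / 2))" using l0 by (intro mult_left_mono) auto
        also have "\<dots> = 2 * (l * (R + r / 2))" by simp
        also have "\<dots> = r / 2" unfolding lR by simp
        finally show ?thesis using l0 by (simp add: seminorm_scale)
      qed
      moreover have "N (x - y) - N (- (l *\<^sub>R (p xs' - p ys'))) \<le> N (p xs - p ys)"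
        unfolding diff using seminorm_triangle_rev[of "x - y" "- (l *\<^sub>R (p xs' - p ys'))"] by simp
      ultimately have "N (p xs - p ys) \<ge> r / 2" by (simp add: seminorm_minus)
      moreover have "l ^ Suc T * r \<le> 1 * r"
        using l0 l2 r by (intro mult_right_mono power_le_one) auto
      ultimately show ?thesis by simp
    qed
  qed simp
  have pco: "N (p xs - (\<Sum>b\<in>B. co b xs *\<^sub>R b)) = 0" for xs
  proof (induction xs)
    case (Cons s xs)
    have "p (s # xs) - (\<Sum>b\<in>B. co b (s # xs) *\<^sub>R b) =
        (s - (\<Sum>b\<in>B. a s b *\<^sub>R b)) + l *\<^sub>R (p xs - (\<Sum>b\<in>B. co b xs *\<^sub>R b))"
      by (simp add: p_simps co_simps scaleR_add_left sum.distrib scaleR_diff_right scaleR_sum_right algebra_simps)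
    then have "N (p (s # xs) - (\<Sum>b\<in>B. co b (s # xs) *\<^sub>R b)) \<le> 0"
      using seminorm_triangle[of "s - (\<Sum>b\<in>B. a s b *\<^sub>R b)" "l *\<^sub>R (p xs - (\<Sum>b\<in>B. co b xs *\<^sub>R b))"]
        Cons a by (simp add: seminorm_scale)
    then show ?case using seminorm_nonneg by (metis order_antisym)
  qed (simp add: p_simps co_simps seminorm_zero)
  define A where "A = (\<Sum>s\<in>S. \<Sum>b\<in>B. \<bar>a s b\<bar>)"
  have A0: "A \<ge> 0" by (simp add: A_def sum_nonneg)
  have aA: "\<bar>a s b\<bar> \<le> A" if "s \<in> S" "b \<in> B" for s b
  proof -
    have "\<bar>a s b\<bar> \<le> (\<Sum>b\<in>B. \<bar>a s b\<bar>)" using that B(1) by (intro member_le_sum) auto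
    also have "\<dots> \<le> A" unfolding A_def using that S(1)
      by (intro member_le_sum[where f = "\<lambda>s. \<Sum>b\<in>B. \<bar>a s b\<bar>"]) (auto intro: sum_nonneg)
    finally show ?thesis .
  qed
  have coA: "\<bar>co b xs\<bar> \<le> 2 * A" if "set xs \<subseteq> S" "b \<in> B" for b xs
    using that(1)
  proof (induction xs)
    case (Cons s xs)
    have "\<bar>co b (s # xs)\<bar> \<le> \<bar>a s b\<bar> + l * \<bar>co b xs\<bar>"
      using abs_triangle_ineq[of "a s b" "l * co b xs"] l0 by (simp add: co_simps abs_mult)
    also have "\<dots> \<le> A + (1 / 2) * (2 * A)"
      using Cons aA[of s b] that(2) l0 l2 by (intro add_mono mult_mono) auto
    finally show ?case by simp
  qed (use A0 in \<open>simp add: co_simps\<close>)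
  \<comment> \<open>A mesh of \<open>l ^ T * g0\<close> in the coordinates moves the seminorm by
    less than \<open>l ^ T * r / 2\<close>, so words with equal rounded coordinates are
    equal.\<close>
  define g0 where "g0 = r / (4 * ((\<Sum>b\<in>B. N b) + 1))"
  have NB: "(\<Sum>b\<in>B. N b) \<ge> 0" by (intro sum_nonneg seminorm_nonneg)
  have g0: "g0 > 0" using r NB by (simp add: g0_def)
  define C where "C = 4 * A / g0 + 5"
  have C1: "C \<ge> 1" using A0 g0 by (simp add: C_def)
  \<comment> \<open>There are \<open>card S ^ T\<close> words of length T and at most (C / l ^ T) ^
    m families of rounded coordinates. Since C does not depend on T, large T excludes
    \<open>card S * l ^ m > 1\<close>.\<close>
  have key: "(real (card S) * l ^ m) ^ T \<le> C ^ m" for T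
  proof -
    define g where "g = l ^ T * g0"
    have g: "g > 0" using l0 g0 by (simp add: g_def)
    define Z where "Z = nat (\<lceil>2 * A / g\<rceil> + 1)"
    define \<Phi> where "\<Phi> xs = (\<lambda>b\<in>B. \<lfloor>co b xs / g\<rfloor>)" for xs
    let ?L = "{xs. set xs \<subseteq> S \<and> length xs = T}"
    have "inj_on \<Phi> ?L"
    proof (rule inj_onI, rule ccontr)
      fix xs ys assume xs: "xs \<in> ?L" and ys: "ys \<in> ?L" and eq: "\<Phi> xs = \<Phi> ys" and ne: "xs \<noteq> ys"
      have close: "\<bar>co b xs - co b ys\<bar> \<le> g" if "b \<in> B" for b
      proof -
        have "\<lfloor>co b xs / g\<rfloor> = \<lfloor>co b ys / g\<rfloor>" using fun_cong[OF eq, of b] that by (simp add: \<Phi>_def)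
        then have "\<bar>co b xs / g - co b ys / g\<bar> \<le> 1" by linarith
        then show ?thesis using g by (simp add: diff_divide_distrib[symmetric] divide_le_eq)
      qed
      define u where "u zs = p zs - (\<Sum>b\<in>B. co b zs *\<^sub>R b)" for zs
      have eq: "p xs - p ys = (u xs + (\<Sum>b\<in>B. (co b xs - co b ys) *\<^sub>R b)) - u ys"
        by (simp add: u_def scaleR_diff_left sum_subtractf)
      have u0: "N (u zs) = 0" for zs unfolding u_def by (rule pco)
      have "N (p xs - p ys) \<le> N (\<Sum>b\<in>B. (co b xs - co b ys) *\<^sub>R b)"
        unfolding eq
        using seminorm_triangle_minus[of "u xs + (\<Sum>b\<in>B. (co b xs - co b ys) *\<^sub>R b)" "u ys"]
          seminorm_triangle[of "u xs" "\<Sum>b\<in>B. (co b xs - co b ys) *\<^sub>R b"] u0[of xs] u0[of ys] by linarith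
      also have "\<dots> \<le> (\<Sum>b\<in>B. \<bar>co b xs - co b ys\<bar> * N b)"
        using seminorm_sum[of "\<lambda>b. (co b xs - co b ys) *\<^sub>R b" B] by (simp add: seminorm_scale)
      also have "\<dots> \<le> (\<Sum>b\<in>B. g * N b)" using close seminorm_nonneg by (intro sum_mono mult_right_mono) auto
      also have "\<dots> = l ^ T * (g0 * (\<Sum>b\<in>B. N b))" by (simp add: sum_distrib_left g_def mult_ac)
      also have "\<dots> < l ^ T * (r / 2)"
      proof -
        have "g0 * (\<Sum>b\<in>B. N b) < r / 2" using r NB by (simp add: g0_def field_simps add_pos_nonneg)
        then show ?thesis using l0 by simp
      qed
      finally show False using psep[of xs ys T] xs ys ne by auto
    qed
    moreover have "\<Phi> ` ?L \<subseteq> PiE B (\<lambda>_. {- int Z..int Z})"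
    proof (intro image_subsetI PiE_I)
      fix xs b assume xs: "xs \<in> ?L" and b: "b \<in> B"
      have "\<bar>co b xs\<bar> \<le> 2 * A" using coA[of xs b] xs b by simp
      then have "\<bar>co b xs / g\<bar> \<le> 2 * A / g" using g by (simp add: divide_right_mono)
      then have "\<lfloor>co b xs / g\<rfloor> \<le> \<lceil>2 * A / g\<rceil> + 1" "\<lfloor>co b xs / g\<rfloor> \<ge> - (\<lceil>2 * A / g\<rceil> + 1)" by linarith+
      then show "\<Phi> xs b \<in> {- int Z..int Z}" using b by (auto simp: \<Phi>_def Z_def)
    qed (auto simp: \<Phi>_def)
    ultimately have "card ?L \<le> card (PiE B (\<lambda>_. {- int Z..int Z}))"
      using B(1) by (intro card_inj_on_le) (auto intro: finite_PiE)
    moreover have "card {- int Z..int Z} = 2 * Z + 1" unfolding card_atLeastAtMost_int by arith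
    ultimately have "card S ^ T \<le> (2 * Z + 1) ^ card B"
      using B(1) S(1) by (simp only: card_lists_length_eq[OF S(1)] card_PiE[OF B(1)] prod_constant)
    then have "real (card S) ^ T \<le> real (2 * Z + 1) ^ card B"
      by (metis of_nat_le_iff of_nat_power)
    also have "\<dots> \<le> (C / l ^ T) ^ card B"
    proof (rule power_mono)
      have "2 * A / g \<ge> 0" using A0 g by simp
      then have "real (2 * Z + 1) \<le> 4 * A / g + 5" unfolding Z_def
        by (simp add: of_nat_nat) linarith
      also have "\<dots> \<le> 4 * A / g + 5 / l ^ T"
        using l0 l2 by (simp add: le_divide_eq power_le_one)
      also have "\<dots> = C / l ^ T" using l0 g0 by (simp add: g_def C_def field_simps)
      finally show "real (2 * Z + 1) \<le> C / l ^ T" .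
    qed simp
    also have "\<dots> \<le> (C / l ^ T) ^ m"
    proof (rule power_increasing[OF B(2)])
      have "l ^ T \<le> 1" using l0 l2 by (intro power_le_one) auto
      then show "1 \<le> C / l ^ T" using C1 l0 by (simp add: le_divide_eq)
    qed
    also have "\<dots> = C ^ m / (l ^ m) ^ T"
      by (simp add: power_divide flip: power_mult) (simp add: mult.commute)
    finally show ?thesis using l0 by (simp add: power_mult_distrib le_divide_eq)
  qed
  have "real (card S) * l ^ m \<le> 1"
  proof (rule ccontr)
    assume "\<not> ?thesis"
    then obtain T where "C ^ m < (real (card S) * l ^ m) ^ T"
      using real_arch_pow[of "real (card S) * l ^ m" "C ^ m"] by auto
    then show False using key[of T] by simp
  qed
  then have "real (card S) \<le> (1 / l) ^ m" using l0 by (simp add: power_divide le_divide_eq)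
  also have "1 / l = 2 + 4 * R / r" using r R by (simp add: l_def field_simps)
  finally show ?thesis .
qed

text \<open>A separated subset of largest cardinality is a net; the packing bound makes a largest
  one exist.\<close>

lemma seminorm_net:
  assumes rank: "seminorm_rank_le N m" and r: "r > 0" and R: "R \<ge> 0"
  obtains Q where "finite Q" "real (card Q) \<le> (2 + 4 * R / r) ^ m" "\<And>q. q \<in> Q \<Longrightarrow> N q \<le> R"
    "\<And>x. N x \<le> R \<Longrightarrow> \<exists>q\<in>Q. N (x - q) \<le> r"
proof -
  define P where "P Q \<longleftrightarrow> finite Q \<and> (\<forall>q\<in>Q. N q \<le> R) \<and> (\<forall>x\<in>Q. \<forall>y\<in>Q. x \<noteq> y \<longrightarrow> N (x - y) \<ge> r)" for Q
  have bnd: "real (card Q) \<le> (2 + 4 * R / r) ^ m" if "P Q" for Q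
    using that r R by (intro seminorm_packing[OF rank]) (auto simp: P_def)
  then have "card Q < Suc (nat \<lceil>(2 + 4 * R / r) ^ m\<rceil>)" if "P Q" for Q
  proof -
    have "real (card Q) \<le> real (nat \<lceil>(2 + 4 * R / r) ^ m\<rceil>)"
      using bnd[OF that] real_nat_ceiling_ge by (rule order_trans)
    then show ?thesis by simp
  qed
  moreover have "P {}" by (simp add: P_def)
  ultimately obtain Q where Q: "P Q" "\<And>Q'. P Q' \<Longrightarrow> card Q' \<le> card Q"
    using ex_has_greatest_nat[of P "{}" card] by metis
  have "\<exists>q\<in>Q. N (x - q) \<le> r" if x: "N x \<le> R" for x
  proof (rule ccontr)
    assume "\<not> ?thesis"
    then have far: "\<And>q. q \<in> Q \<Longrightarrow> N (x - q) > r" by force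
    then have "x \<notin> Q" using r seminorm_zero by force
    moreover have "P (insert x Q)"
      using Q(1) x far seminorm_minus_commute unfolding P_def
      by (metis finite_insert insertE less_eq_real_def)
    ultimately show False using Q(2)[of "insert x Q"] Q(1) by (simp add: P_def)
  qed
  then show ?thesis using that[of Q] Q(1) bnd by (auto simp: P_def)
qed

end

section \<open>Hahn-Banach extension and norming functionals\<close>

definition sublinear :: "('a::real_vector \<Rightarrow> real) \<Rightarrow> bool" where
  "sublinear p \<longleftrightarrow> (\<forall>x y. p (x + y) \<le> p x + p y) \<and> (\<forall>c x. c > 0 \<longrightarrow> p (c *\<^sub>R x) = c * p x)"

lemma sublinear_zero:
  assumes "sublinear p" shows "p 0 = 0"
proof -
  have "p (2 *\<^sub>R 0) = 2 * p 0" using assms unfolding sublinear_def by (metis zero_less_numeral)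
  then show ?thesis by simp
qed

lemma sublinear_minus: "sublinear p \<Longrightarrow> - p (- x) \<le> p x"
proof -
  assume p: "sublinear p"
  have "p (x + (- x)) \<le> p x + p (- x)" using p unfolding sublinear_def by blast
  then show ?thesis using sublinear_zero[OF p] by simp
qed

text \<open>From - p' (- b) \<le> p' b \<le> p b = - p (- b) \<le> - p' (- b): along a vector where
  p is already odd, no smaller sublinear functional can change it. This allows vectors to be treated
  one at a time.\<close>

lemma sublinear_minorant_symmetric:
  assumes "sublinear p" "sublinear p'" "\<And>x. p' x \<le> p x" "p (- b) = - p b"
  shows "p' (- b) = - p' b" "p' b = p b"
  using sublinear_minus[OF assms(2), of b] assms(3)[of b] assms(3)[of "- b"] assms(4) by linarith+

text \<open>Hahn--Banach in finite dimension: minorants linear along one more vector at each step.\<close>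

lemma sublinear_minorant_along:
  assumes p: "sublinear p"
  shows "\<exists>p'. sublinear p' \<and> (\<forall>x. p' x \<le> p x) \<and> p' (- e) = - p' e \<and> p' e = p e"
proof -
  have add: "p (x + y) \<le> p x + p y" for x y using p by (simp add: sublinear_def)
  have scale: "p (c *\<^sub>R x) = c * p x" if "c \<ge> 0" for c x
    using that p sublinear_zero[OF p] by (cases "c = 0") (auto simp: sublinear_def)
  \<comment> \<open>The infimum over t \<ge> 0 of p (x + t e) - t p e is bounded below by - p (- x).
    At x = - e the value t = 1 gives - p e, which forces oddness along e.\<close>
  define V where "V x = (\<lambda>t. p (x + t *\<^sub>R e) - t * p e) ` {0..}" for x
  define p' where "p' x = Inf (V x)" for x
  have low: "- p (- x) \<le> p (x + t *\<^sub>R e) - t * p e" if "t \<ge> 0" for x t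
    using add[of "x + t *\<^sub>R e" "- x"] scale[OF that, of e] by simp
  have bdd: "bdd_below (V x)" for x
    unfolding V_def using low by (intro bdd_belowI[of _ "- p (- x)"]) auto
  have ne: "V x \<noteq> {}" for x by (simp add: V_def)
  have p'le: "p' x \<le> p (x + t *\<^sub>R e) - t * p e" if "t \<ge> 0" for x t
    unfolding p'_def using bdd that by (intro cInf_lower) (auto simp: V_def)
  have p'ge: "z \<le> p' x" if "\<And>t. t \<ge> 0 \<Longrightarrow> z \<le> p (x + t *\<^sub>R e) - t * p e" for x z
    unfolding p'_def using ne that by (intro cInf_greatest) (auto simp: V_def)
  have sub: "p' (x + y) \<le> p' x + p' y" for x y
  proof -
    have "p' (x + y) - (p (y + s *\<^sub>R e) - s * p e) \<le> p' x" if "s \<ge> 0" for s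
    proof (rule p'ge)
      fix t :: real assume t: "t \<ge> 0"
      have "p' (x + y) \<le> p ((x + t *\<^sub>R e) + (y + s *\<^sub>R e)) - (t + s) * p e"
        using p'le[of "t + s" "x + y"] t that by (simp add: scaleR_add_left algebra_simps)
      then show "p' (x + y) - (p (y + s *\<^sub>R e) - s * p e) \<le> p (x + t *\<^sub>R e) - t * p e"
        using add[of "x + t *\<^sub>R e" "y + s *\<^sub>R e"] by (simp add: algebra_simps)
    qed
    then have "p' (x + y) - p' x \<le> p' y" by (intro p'ge) (simp add: algebra_simps)
    then show ?thesis by simp
  qed
  have half: "c * p' x \<le> p' (c *\<^sub>R x)" if c: "c > 0" for c x
  proof (rule p'ge)
    fix t :: real assume t: "t \<ge> 0"
    have "p' x \<le> p (x + (t / c) *\<^sub>R e) - (t / c) * p e" using p'le[of "t / c" x] t c by simp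
    then have "c * p' x \<le> c * (p (x + (t / c) *\<^sub>R e) - (t / c) * p e)" using c by simp
    also have "\<dots> = p (c *\<^sub>R (x + (t / c) *\<^sub>R e)) - t * p e"
      using scale[of c "x + (t / c) *\<^sub>R e"] c by (simp add: right_diff_distrib)
    also have "c *\<^sub>R (x + (t / c) *\<^sub>R e) = c *\<^sub>R x + t *\<^sub>R e" using c by (simp add: scaleR_add_right)
    finally show "c * p' x \<le> p (c *\<^sub>R x + t *\<^sub>R e) - t * p e" .
  qed
  have "p' (c *\<^sub>R x) = c * p' x" if c: "c > 0" for c x
  proof (rule antisym)
    have "(1 / c) * p' (c *\<^sub>R x) \<le> p' x" using half[of "1 / c" "c *\<^sub>R x"] c by simp
    then show "p' (c *\<^sub>R x) \<le> c * p' x" using c by (simp add: field_simps)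
  qed (rule half[OF c])
  then have sl: "sublinear p'" using sub by (simp add: sublinear_def)
  have le: "p' x \<le> p x" for x using p'le[of 0 x] by simp
  have me: "p' (- e) \<le> - p e" using p'le[of 1 "- e"] sublinear_zero[OF p] by simp
  have "p' e = p e \<and> p' (- e) = - p e"
    using me le[of e] sublinear_minus[OF sl, of e] by linarith
  then show ?thesis using sl le by (intro exI[of _ p']) auto
qed

lemma sublinear_minorant_finite:
  assumes "finite B" "sublinear p"
  shows "\<exists>p'. sublinear p' \<and> (\<forall>x. p' x \<le> p x) \<and> (\<forall>b\<in>B. p' (- b) = - p' b)"
  using assms(1)
proof induction
  case empty
  then show ?case using assms(2) by auto
next
  case (insert b B)
  then obtain p1 where p1: "sublinear p1" "\<And>x. p1 x \<le> p x" "\<And>b. b \<in> B \<Longrightarrow> p1 (- b) = - p1 b" by blast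
  obtain p2 where p2: "sublinear p2" "\<And>x. p2 x \<le> p1 x" "p2 (- b) = - p2 b"
    using sublinear_minorant_along[OF p1(1), of b] by blast
  have "p2 (- c) = - p2 c" if "c \<in> insert b B" for c
    using that p2(3) sublinear_minorant_symmetric(1)[OF p1(1) p2(1,2) p1(3)] by blast
  then show ?case using p2(1,2) p1(2) by (intro exI[of _ p2]) (auto intro: order_trans)
qed

text \<open>Passing to a minorant along x0 first fixes the value N x0; minorants along a basis
  modulo the kernel follow. The vectors at which the result is odd form a subspace, which contains
  the basis and, by domination, the kernel, hence everything; an odd sublinear functional is
  linear.\<close>

lemma seminorm_norming_functional:
  assumes N: "seminorm N" and rank: "seminorm_rank_le N m"
  shows "\<exists>\<phi>. linear \<phi> \<and> (\<forall>x. \<bar>\<phi> x\<bar> \<le> N x) \<and> \<phi> x0 = N x0"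
proof -
  have sN: "sublinear N" using N by (simp add: sublinear_def seminorm_def)
  obtain p1 where p1: "sublinear p1" "\<And>x. p1 x \<le> N x" "p1 (- x0) = - p1 x0" "p1 x0 = N x0"
    using sublinear_minorant_along[OF sN, of x0] by blast
  obtain B where B: "finite B" "\<And>x. \<exists>y\<in>span B. N (x - y) = 0"
    using rank by (auto simp: seminorm_rank_le_def)
  obtain p where p: "sublinear p" "\<And>x. p x \<le> p1 x" "\<And>b. b \<in> B \<Longrightarrow> p (- b) = - p b"
    using sublinear_minorant_finite[OF B(1) p1(1)] by blast
  have add: "p (x + y) \<le> p x + p y" for x y using p by (simp add: sublinear_def)
  have scale: "p (c *\<^sub>R x) = c * p x" if "c \<ge> 0" for c x
    using that p sublinear_zero[OF p(1)] by (cases "c = 0") (auto simp: sublinear_def)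
  have pN: "p x \<le> N x" for x using p(2) p1(2) order_trans by blast
  define U where "U = {x. p (- x) = - p x}"
  have Uadd: "p (x + y) = p x + p y" if "x \<in> U" "y \<in> U" for x y
    using add[of x y] add[of "- x" "- y"] sublinear_minus[OF p(1), of "x + y"] that by (simp add: U_def)
  have subU: "subspace U"
    unfolding subspace_def
  proof (intro conjI ballI allI)
    show "0 \<in> U" using sublinear_zero[OF p(1)] by (simp add: U_def)
    fix x y assume xy: "x \<in> U" "y \<in> U"
    then have m: "- x \<in> U" "- y \<in> U" by (auto simp: U_def)
    show "x + y \<in> U" using Uadd[OF xy] Uadd[OF m] xy by (simp add: U_def)
  next
    fix c x assume x: "x \<in> U"
    show "c *\<^sub>R x \<in> U"
    proof (cases "c \<ge> 0")
      case True
      then show ?thesis using scale[of c x] scale[of c "- x"] x by (simp add: U_def)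
    next
      case False
      then show ?thesis using scale[of "- c" x] scale[of "- c" "- x"] x by (simp add: U_def)
    qed
  qed
  have "B \<subseteq> U" using p(3) by (auto simp: U_def)
  then have spanU: "span B \<subseteq> U" using subU by (rule span_minimal)
  have U: "x \<in> U" for x
  proof -
    obtain y where y: "y \<in> span B" "N (x - y) = 0" using B(2) by blast
    have "p (x - y) \<le> 0" "p (- (x - y)) \<le> 0"
      using pN[of "x - y"] pN[of "- (x - y)"] y(2) seminorm_minus[OF N, of "x - y"] by auto
    then have "x - y \<in> U" using sublinear_minus[OF p(1), of "x - y"] by (simp add: U_def)
    then show ?thesis using subspace_add[OF subU, of "x - y" y] y(1) spanU by auto
  qed
  then have neg: "p (- x) = - p x" for x by (simp add: U_def)
  have "linear p"
  proof (rule linearI)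
    show "p (x + y) = p x + p y" for x y using Uadd U by blast
    show "p (c *\<^sub>R x) = c *\<^sub>R p x" for c x
      using scale[of c x] scale[of "- c" x] neg[of "- (c *\<^sub>R x)"] by (cases "c \<ge> 0") auto
  qed
  moreover have "\<bar>p x\<bar> \<le> N x" for x
    using pN[of x] pN[of "- x"] neg[of x] seminorm_minus[OF N, of x] by linarith
  moreover have "p x0 = N x0"
    using sublinear_minorant_symmetric(2)[OF p1(1) p(1,2) p1(3)] p1(4) by simp
  ultimately show ?thesis by blast
qed

text \<open>The functionals norm the points of a 1/4-net of the unit ball. Replacing a unit vector
  by a net point loses 1/4 in the norm and 1/4 in the functional, which leaves 1/2. The packing
  bound for this net has base 2 + 4 / (1 / 4) = 18.\<close>

lemma seminorm_norming_family:
  assumes N: "seminorm N" and rank: "seminorm_rank_le N m"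
  obtains \<phi> :: "nat \<Rightarrow> 'a::real_vector \<Rightarrow> real" and K where
    "real K \<le> 18 ^ m" "\<And>j. linear (\<phi> j)" "\<And>j x. \<bar>\<phi> j x\<bar> \<le> N x" "\<And>x. \<exists>j<K. N x \<le> 2 * \<bar>\<phi> j x\<bar>"
proof -
  obtain Q where Q: "finite Q" "real (card Q) \<le> (2 + 4 * 1 / (1 / 4)) ^ m"
    "\<And>x. N x \<le> 1 \<Longrightarrow> \<exists>q\<in>Q. N (x - q) \<le> 1 / 4"
    by (rule seminorm_net[OF N rank, of "1 / 4" 1]) auto
  obtain e where e: "bij_betw e {..<card Q} Q"
    using ex_bij_betw_nat_finite[OF Q(1)] by (auto simp: lessThan_atLeast0)
  have "\<forall>j. \<exists>\<phi>. linear \<phi> \<and> (\<forall>x. \<bar>\<phi> x\<bar> \<le> N x) \<and> \<phi> (e j) = N (e j)"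
    using seminorm_norming_functional[OF N rank] by blast
  then obtain \<phi> where \<phi>: "\<And>j. linear (\<phi> j)" "\<And>j x. \<bar>\<phi> j x\<bar> \<le> N x" "\<And>j. \<phi> j (e j) = N (e j)"
    by metis
  have "\<exists>j<card Q. N x \<le> 2 * \<bar>\<phi> j x\<bar>" for x
  proof -
    define u where "u = (if N x = 0 then 0 else (1 / N x) *\<^sub>R x)"
    have xu: "N x \<noteq> 0 \<Longrightarrow> x = N x *\<^sub>R u" by (simp add: u_def)
    have Nu: "N u \<le> 1" using seminorm_nonneg[OF N, of x]
      by (simp add: u_def seminorm_zero[OF N] seminorm_scale[OF N])
    then obtain q where q: "q \<in> Q" "N (u - q) \<le> 1 / 4" using Q(3) by blast
    obtain j where j: "j < card Q" "q = e j" using q(1) e by (auto simp: bij_betw_def)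
    have "N x \<le> 2 * \<bar>\<phi> j x\<bar>"
    proof (cases "N x = 0")
      case False
      have "N u = 1" using xu[OF False] seminorm_scale[OF N, of "N x" u] seminorm_nonneg[OF N, of x] False
        by (metis abs_of_nonneg mult_cancel_left1)
      then have "N q \<ge> 1 - N (u - q)" using seminorm_triangle_rev[OF N, of u q] by linarith
      moreover have "\<phi> j u = \<phi> j q + \<phi> j (u - q)" using linear_diff[OF \<phi>(1)[of j], of u q] by simp
      moreover have "\<bar>\<phi> j (u - q)\<bar> \<le> N (u - q)" by (rule \<phi>(2))
      moreover have "\<phi> j q = N q" using \<phi>(3)[of j] j(2) by simp
      ultimately have "\<phi> j u \<ge> 1 / 2" using q(2) by linarith
      moreover have "\<phi> j x = N x * \<phi> j u"
        using linear_scale[OF \<phi>(1)[of j], of "N x" u] xu[OF False] by simp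
      ultimately show ?thesis
        using seminorm_nonneg[OF N, of x] mult_left_mono[of "1 / 2" "\<phi> j u" "N x"] by linarith
    qed simp
    then show ?thesis using j(1) by blast
  qed
  then show ?thesis using that[of "card Q" \<phi>] Q(2) \<phi>(1,2) by simp
qed

section \<open>Counting graphs that embed into low dimension\<close>

text \<open>The map is multiplied by \<alpha>, so that it does not contract distances, and the norm
  is pulled back to \<open>linf\<close> along the truncation to m coordinates.\<close>

lemma embedding_gives_seminorm:
  assumes "embeds_in_dimension_at_most M d D \<alpha>" and "\<alpha> > 0"
  obtains m and N :: "linf \<Rightarrow> real" and g where "real m \<le> D" "seminorm N" "seminorm_rank_le N m"
    "\<And>u v. u \<in> M \<Longrightarrow> v \<in> M \<Longrightarrow> d u v \<le> N (g u - g v) \<and> N (g u - g v) \<le> \<alpha> * d u v"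
proof -
  obtain m N0 f where m: "real m \<le> D" and N0: "norm_on_coord_space m N0" and
    f: "f \<in> M \<rightarrow> coord_space m"
      "\<And>u v. u \<in> M \<Longrightarrow> v \<in> M \<Longrightarrow> N0 (\<lambda>i. f u i - f v i) \<le> d u v \<and> d u v \<le> \<alpha> * N0 (\<lambda>i. f u i - f v i)"
    using assms(1) unfolding embeds_in_dimension_at_most_def embeds_with_distortion_def by blast
  define trunc where "trunc x = (\<lambda>i. if i < m then apply_bcontfun x i else 0)" for x :: linf
  define N where "N x = N0 (trunc x)" for x
  have tr: "trunc x \<in> coord_space m" for x by (simp add: trunc_def coord_space_def)
  have tr_add: "trunc (x + y) = (\<lambda>i. trunc x i + trunc y i)" for x y
    by (auto simp: trunc_def plus_bcontfun.rep_eq)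
  have tr_scale: "trunc (a *\<^sub>R x) = (\<lambda>i. a * trunc x i)" for a x
    by (auto simp: trunc_def scaleR_bcontfun.rep_eq)
  have "seminorm N"
    using N0 tr unfolding seminorm_def N_def tr_add tr_scale norm_on_coord_space_def by blast
  moreover have "seminorm_rank_le N m"
    unfolding seminorm_rank_le_def
  proof (intro exI[of _ "unit_seq ` {..<m}"] conjI allI)
    show "card (unit_seq ` {..<m}) \<le> m" using card_image_le[of "{..<m}" unit_seq] by simp
    fix x
    have "trunc (x - finite_seq m (apply_bcontfun x)) = (\<lambda>_. 0)"
      by (auto simp: trunc_def minus_bcontfun.rep_eq)
    moreover have "N0 (\<lambda>_. 0) = 0"
      using N0 by (auto simp: norm_on_coord_space_def coord_space_def)
    ultimately have "N (x - finite_seq m (apply_bcontfun x)) = 0" by (simp add: N_def)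
    then show "\<exists>y\<in>span (unit_seq ` {..<m}). N (x - y) = 0" using finite_seq_in_span by blast
  qed simp
  moreover have "d u v \<le> N (finite_seq m (\<lambda>i. \<alpha> * f u i) - finite_seq m (\<lambda>i. \<alpha> * f v i)) \<and>
      N (finite_seq m (\<lambda>i. \<alpha> * f u i) - finite_seq m (\<lambda>i. \<alpha> * f v i)) \<le> \<alpha> * d u v"
    if uv: "u \<in> M" "v \<in> M" for u v
  proof -
    have fuv: "f u \<in> coord_space m" "f v \<in> coord_space m" using f(1) uv by auto
    then have diff: "(\<lambda>i. f u i - f v i) \<in> coord_space m" by (auto simp: coord_space_def)
    have "trunc (finite_seq m (\<lambda>i. \<alpha> * f u i) - finite_seq m (\<lambda>i. \<alpha> * f v i)) = (\<lambda>i. \<alpha> * (f u i - f v i))"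
    proof
      fix i
      have "f u i = 0" "f v i = 0" if "\<not> i < m" using fuv that by (auto simp: coord_space_def)
      then show "trunc (finite_seq m (\<lambda>i. \<alpha> * f u i) - finite_seq m (\<lambda>i. \<alpha> * f v i)) i = \<alpha> * (f u i - f v i)"
        by (cases "i < m") (simp_all add: trunc_def minus_bcontfun.rep_eq right_diff_distrib)
    qed
    then have "N (finite_seq m (\<lambda>i. \<alpha> * f u i) - finite_seq m (\<lambda>i. \<alpha> * f v i)) = \<bar>\<alpha>\<bar> * N0 (\<lambda>i. f u i - f v i)"
      using N0 diff by (simp add: N_def norm_on_coord_space_def)
    then have "N (finite_seq m (\<lambda>i. \<alpha> * f u i) - finite_seq m (\<lambda>i. \<alpha> * f v i)) = \<alpha> * N0 (\<lambda>i. f u i - f v i)"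
      using assms(2) by (simp only: abs_of_pos)
    moreover have "\<alpha> * N0 (\<lambda>i. f u i - f v i) \<le> \<alpha> * d u v"
      using f(2)[OF uv] assms(2) by (intro mult_left_mono) auto
    ultimately show ?thesis using f(2)[OF uv] by linarith
  qed
  ultimately show ?thesis by (rule that[OF m])
qed

text \<open>The sum of \<open>h\<close> along the path from \<open>v\<close> to the root \<open>1\<close>. Cutting off after \<open>n\<close> steps makes it
  meaningful for every map \<open>p\<close>, so that the codes form a full product.\<close>

definition path_sum :: "nat \<Rightarrow> (nat \<Rightarrow> nat) \<Rightarrow> (nat \<Rightarrow> int) \<Rightarrow> nat \<Rightarrow> int" where
  "path_sum n p h v = (\<Sum>s\<in>{s. s < n \<and> (p ^^ s) v \<noteq> 1}. h ((p ^^ s) v))"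

text \<open>For the parent map of a tree of depth below n the cut-off has no effect: the iterates of
  v differ from the root exactly during the first \<open>dep v\<close> steps.\<close>

lemma path_sum_rec:
  fixes dep :: "nat \<Rightarrow> nat"
  assumes dep: "\<And>v. v \<in> V \<Longrightarrow> v \<noteq> 1 \<Longrightarrow> p v \<in> V \<and> dep v = Suc (dep (p v))"
    and "dep 1 = 0" "p 1 = 1" "1 \<in> V" "\<And>v. v \<in> V \<Longrightarrow> dep v < n"
  shows "path_sum n p h 1 = 0" and "v \<in> V \<Longrightarrow> v \<noteq> 1 \<Longrightarrow> path_sum n p h v = h v + path_sum n p h (p v)"
proof -
  have p1: "(p ^^ s) 1 = 1" for s using assms(3) by (induction s) auto
  then show "path_sum n p h 1 = 0" by (simp add: path_sum_def)
  have root: "dep v = 0 \<longleftrightarrow> v = 1" if "v \<in> V" for v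
    using dep[OF that] assms(2) by (metis nat.distinct(1))
  have iter: "(p ^^ s) v \<in> V \<and> dep ((p ^^ s) v) = dep v - s" if "v \<in> V" for v s
  proof (induction s)
    case (Suc s)
    show ?case
    proof (cases "(p ^^ s) v = 1")
      case True
      then show ?thesis using Suc assms(2,3,4) by auto
    next
      case False
      then show ?thesis using Suc dep[of "(p ^^ s) v"] by auto
    qed
  qed (use that in simp)
  have "(p ^^ s) v = 1 \<longleftrightarrow> dep v \<le> s" if "v \<in> V" for v s
    using iter[OF that, of s] root by (metis diff_is_0_eq)
  then have set: "{s. s < n \<and> (p ^^ s) v \<noteq> 1} = {..<dep v}" if "v \<in> V" for v
    using that assms(5)[OF that] by (auto simp: not_le)
  assume v: "v \<in> V" "v \<noteq> 1"
  have "path_sum n p h v = (\<Sum>s<Suc (dep (p v)). h ((p ^^ s) v))"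
    using set[OF v(1)] dep[OF v] by (simp add: path_sum_def)
  also have "\<dots> = h v + (\<Sum>s<dep (p v). h ((p ^^ s) (p v)))"
    by (subst sum.lessThan_Suc_shift) (simp add: funpow_swap1)
  also have "(\<Sum>s<dep (p v). h ((p ^^ s) (p v))) = path_sum n p h (p v)"
    using set[of "p v"] dep[OF v] by (simp add: path_sum_def)
  finally show "path_sum n p h v = h v + path_sum n p h (p v)" .
qed

text \<open>For the code of an embedded graph, the path sum with index j approximates n times the
  j-th norming functional at the position of a vertex, so this relation stands for closeness in the
  norm. It is computed from the code alone, without the graph.\<close>

definition code_close :: "nat \<Rightarrow> nat \<Rightarrow> int \<Rightarrow> (nat \<Rightarrow> nat) \<Rightarrow> (nat \<Rightarrow> nat) \<Rightarrow> (nat \<times> nat \<Rightarrow> int) \<Rightarrow> nat \<Rightarrow> nat \<Rightarrow> bool" where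
  "code_close n K T p i M u v \<longleftrightarrow>
     (\<forall>j<K. \<bar>path_sum n p (\<lambda>w. M (j, i w)) u - path_sum n p (\<lambda>w. M (j, i w)) v\<bar> \<le> T)"

text \<open>A largest subset with mutual hop distances above l has an l-separated image, as
  distances are not contracted, so packing bounds its size; its hop balls of radius l cover all the
  vertices in question.\<close>

lemma card_seminorm_close_le:
  fixes N :: "'a::real_vector \<Rightarrow> real" and R :: real
  assumes E: "E \<in> regular_graphs n \<Delta>" and con: "connected_graph n E" and "\<Delta> \<ge> 2"
    and N: "seminorm N" "seminorm_rank_le N m"
    and g: "\<And>u v. u \<in> {1..n} \<Longrightarrow> v \<in> {1..n} \<Longrightarrow> hop_dist E u v \<le> N (g u - g v)"
    and u: "u \<in> {1..n}" and R: "R \<ge> 0" and l: "l \<ge> 1"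
  shows "real (card {v \<in> {1..n}. N (g u - g v) \<le> R}) \<le> (2 + 4 * R / l) ^ m * real \<Delta> ^ Suc l"
proof -
  define A where "A = {v \<in> {1..n}. N (g u - g v) \<le> R}"
  have finA: "finite A" by (simp add: A_def)
  define P where "P Z \<longleftrightarrow> Z \<subseteq> A \<and> (\<forall>x\<in>Z. \<forall>y\<in>Z. x \<noteq> y \<longrightarrow> hop_dist E x y > l)" for Z
  have "card Z < Suc (card A)" if "P Z" for Z
    using that card_mono[OF finA] by (auto simp: P_def less_Suc_eq_le)
  moreover have "P {}" by (simp add: P_def)
  ultimately obtain Z where Z: "P Z" "\<And>Z'. P Z' \<Longrightarrow> card Z' \<le> card Z"
    using ex_has_greatest_nat[of P "{}" card] by metis
  have ZA: "Z \<subseteq> A" and finZ: "finite Z" using Z(1) finA by (auto simp: P_def finite_subset)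
  have ZV: "z \<in> {1..n}" if "z \<in> Z" for z using that ZA by (auto simp: A_def)
  have cover: "A \<subseteq> (\<Union>z\<in>Z. {v \<in> {1..n}. hop_dist E z v \<le> l})"
  proof (rule ccontr)
    assume "\<not> ?thesis"
    then obtain v where v: "v \<in> A" "\<And>z. z \<in> Z \<Longrightarrow> \<not> hop_dist E z v \<le> l" by (auto simp: A_def)
    have vV: "v \<in> {1..n}" using v(1) by (simp add: A_def)
    have "v \<notin> Z" using v(2)[of v] hop_dist_self[OF E con] by auto
    moreover have "P (insert v Z)"
      unfolding P_def
    proof (intro conjI ballI impI)
      show "insert v Z \<subseteq> A" using v ZA by blast
      fix x y assume xy: "x \<in> insert v Z" "y \<in> insert v Z" "x \<noteq> y"
      then consider "x = v" "y \<in> Z" | "x \<in> Z" "y = v" | "x \<in> Z" "y \<in> Z" by blast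
      then show "hop_dist E x y > l"
      proof cases
        case 1
        then show ?thesis using v(2)[of y] hop_dist_commute[OF E con vV ZV[of y]] by simp
      next
        case 2
        then show ?thesis using v(2)[of x] by simp
      next
        case 3
        then show ?thesis using Z(1) xy(3) by (simp add: P_def)
      qed
    qed
    ultimately show False using Z(2)[of "insert v Z"] finZ by simp
  qed
  define S where "S = (\<lambda>z. g z - g u) ` Z"
  have sep: "N ((g x - g u) - (g y - g u)) \<ge> l" if "x \<in> Z" "y \<in> Z" "x \<noteq> y" for x y
  proof -
    have "hop_dist E x y > l" using Z(1) that by (simp add: P_def)
    then have "real l \<le> hop_dist E x y" by simp
    also have "\<dots> \<le> N (g x - g y)" using g ZV that by blast
    finally show ?thesis by simp
  qed
  have "inj_on (\<lambda>z. g z - g u) Z"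
  proof (rule inj_onI, rule ccontr)
    fix x y assume "x \<in> Z" "y \<in> Z" "g x - g u = g y - g u" "x \<noteq> y"
    then show False using sep[of x y] l seminorm_zero[OF N(1)] by simp
  qed
  then have "card Z = card S" by (simp add: S_def card_image)
  moreover have "real (card S) \<le> (2 + 4 * R / real l) ^ m"
  proof (rule seminorm_packing[OF N])
    fix x assume "x \<in> S"
    then obtain z where z: "z \<in> Z" "x = g z - g u" by (auto simp: S_def)
    then have "N (g u - g z) \<le> R" using ZA by (auto simp: A_def)
    then show "N x \<le> R" using seminorm_minus_commute[OF N(1), of "g z" "g u"] z(2) by simp
  next
    show "N (x - y) \<ge> real l" if "x \<in> S" "y \<in> S" "x \<noteq> y" for x y
    proof -
      obtain z z' where z: "z \<in> Z" "z' \<in> Z" "x = g z - g u" "y = g z' - g u"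
        using \<open>x \<in> S\<close> \<open>y \<in> S\<close> by (auto simp: S_def)
      then have "z \<noteq> z'" using \<open>x \<noteq> y\<close> by blast
      then show ?thesis using sep[OF z(1,2)] z(3,4) by simp
    qed
  qed (use finZ l R in \<open>auto simp: S_def\<close>)
  ultimately have cZ: "real (card Z) \<le> (2 + 4 * R / l) ^ m" by simp
  have "card A \<le> card (\<Union>z\<in>Z. {v \<in> {1..n}. hop_dist E z v \<le> l})"
    by (rule card_mono[OF _ cover]) (use finZ in auto)
  also have "\<dots> \<le> (\<Sum>z\<in>Z. card {v \<in> {1..n}. hop_dist E z v \<le> l})" by (rule card_UN_le[OF finZ])
  also have "\<dots> \<le> (\<Sum>z\<in>Z. \<Delta> ^ Suc l)"
    using card_hop_ball_le[OF E con ZV assms(3)] by (intro sum_mono) auto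
  also have "\<dots> = card Z * \<Delta> ^ Suc l" by simp
  finally have "real (card A) \<le> real (card Z) * real (\<Delta> ^ Suc l)" by (metis of_nat_le_iff of_nat_mult)
  also have "\<dots> \<le> (2 + 4 * R / l) ^ m * real (\<Delta> ^ Suc l)" using cZ by (rule mult_right_mono) simp
  finally show ?thesis by (simp only: A_def of_nat_power)
qed

text \<open>A graph close to a low-dimensional normed space is described by a spanning tree, the
  index of a net point for the rounded displacement along each tree edge, where the rounding error
  is fed back and so does not accumulate, and the rounded values of a norming family of functionals
  on the net.\<close>

lemma embedded_graph_has_code:
  fixes N :: "'a::real_vector \<Rightarrow> real" and \<alpha> :: real
  assumes E: "E \<in> regular_graphs n \<Delta>" and con: "connected_graph n E" and "\<Delta> \<ge> 2" "n \<ge> 1"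
    and N: "seminorm N" "seminorm_rank_le N m"
    and g: "\<And>u v. u \<in> {1..n} \<Longrightarrow> v \<in> {1..n} \<Longrightarrow>
        hop_dist E u v \<le> N (g u - g v) \<and> N (g u - g v) \<le> \<alpha> * hop_dist E u v"
    and \<alpha>: "\<alpha> > 0" and l: "l \<ge> 1"
    and K: "18 ^ m \<le> real K" "(2 + 4 * (\<alpha> + l) / l) ^ m \<le> real K"
    and B: "real n * (\<alpha> + l) + 1 \<le> real B"
    and D: "(2 + 4 * (2 * \<alpha> + 6 * real l + 10) / l) ^ m * real \<Delta> ^ Suc l \<le> real D"
    and T: "T = \<lceil>real n * (\<alpha> + 2 * real l + 2)\<rceil>"
  shows "\<exists>p\<in>PiE {1..n} (\<lambda>_. {1..n}). \<exists>i\<in>PiE {1..n} (\<lambda>_. {..<K}).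
    \<exists>M\<in>PiE ({..<K} \<times> {..<K}) (\<lambda>_. {- int B..int B}).
      (\<forall>u v. {u, v} \<in> E \<longrightarrow> code_close n K T p i M u v) \<and>
      (\<forall>u\<in>{1..n}. card {v \<in> {1..n}. code_close n K T p i M u v} \<le> D)"
proof -
  let ?V = "{1..n}"
  have V1: "1 \<in> ?V" using assms(4) by simp
  define r where "r = real l"
  have r: "r > 0" using l by (simp add: r_def)
  define dep where "dep v = hop_dist E 1 v" for v
  have dep1: "dep 1 = 0" using hop_dist_self[OF E con] by (simp add: dep_def)
  have "\<forall>v\<in>?V. v \<noteq> 1 \<longrightarrow> (\<exists>p. p \<in> ?V \<and> {p, v} \<in> E \<and> dep v = Suc (dep p))"
    using hop_dist_parent[OF E con V1] unfolding dep_def by blast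
  then obtain p0 where p0: "\<And>v. v \<in> ?V \<Longrightarrow> v \<noteq> 1 \<Longrightarrow> p0 v \<in> ?V \<and> {p0 v, v} \<in> E \<and> dep v = Suc (dep (p0 v))"
    by metis
  \<comment> \<open>A breadth-first tree. The root is its own parent, so the iterates in
    \<open>path_sum\<close> stay there.\<close>
  define p where "p = (\<lambda>v\<in>?V. if v = 1 then 1 else p0 v)"
  have p: "p v \<in> ?V \<and> {p v, v} \<in> E \<and> dep v = Suc (dep (p v))" if "v \<in> ?V" "v \<noteq> 1" for v
    using p0[OF that] that by (simp add: p_def)
  have p1: "p 1 = 1" using V1 by (simp add: p_def)
  have pP: "p \<in> PiE ?V (\<lambda>_. ?V)" using p0 V1 by (auto simp: p_def)
  have depn: "dep v < n" if "v \<in> ?V" for v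
    using hop_dist_less[OF E con V1 that] by (simp add: dep_def)
  have dep0: "v = 1" if "v \<in> ?V" "dep v = 0" for v using p[OF that(1)] that(2) by fastforce
  obtain Q where Q: "finite Q" "real (card Q) \<le> (2 + 4 * (\<alpha> + r) / r) ^ m" "\<And>q. q \<in> Q \<Longrightarrow> N q \<le> \<alpha> + r"
    "\<And>x. N x \<le> \<alpha> + r \<Longrightarrow> \<exists>q\<in>Q. N (x - q) \<le> r"
    using seminorm_net[OF N r, of "\<alpha> + r"] \<alpha> r by (metis add_nonneg_nonneg less_imp_le)
  have cQ: "card Q \<le> K" using order_trans[OF Q(2)[unfolded r_def] K(2)] by simp
  obtain e where e: "bij_betw e {..<card Q} Q"
    using ex_bij_betw_nat_finite[OF Q(1)] by (auto simp: lessThan_atLeast0)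
  have "\<forall>x. \<exists>a. N x \<le> \<alpha> + r \<longrightarrow> a < card Q \<and> N (x - e a) \<le> r"
  proof
    fix x
    have "\<exists>a. a < card Q \<and> N (x - e a) \<le> r" if x: "N x \<le> \<alpha> + r"
    proof -
      obtain q where q: "q \<in> Q" "N (x - q) \<le> r" using Q(4)[OF x] by blast
      then obtain a where "a < card Q" "q = e a" using e by (auto simp: bij_betw_def)
      then show ?thesis using q(2) by blast
    qed
    then show "\<exists>a. N x \<le> \<alpha> + r \<longrightarrow> a < card Q \<and> N (x - e a) \<le> r" by blast
  qed
  then obtain near where near: "\<And>x. N x \<le> \<alpha> + r \<Longrightarrow> near x < card Q \<and> N (x - e (near x)) \<le> r" by metis
  have Q0: "0 < card Q" using near[of 0] seminorm_zero[OF N(1)] \<alpha> r by fastforce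
  \<comment> \<open>Recursion on the depth, since the approximate position of v starts from that of
    its parent. What is rounded is the true position of v minus the approximate position of the
    parent; it has seminorm at most \<alpha> + r, which is why the net covers that radius.\<close>
  define F where "F = rec_nat (\<lambda>_. 0) (\<lambda>k Fk v. Fk (p v) + e (near (g v - g 1 - Fk (p v))))"
  define fh where "fh v = F (dep v) v" for v
  define idx where "idx v = near (g v - g 1 - fh (p v))" for v
  have fh1: "fh 1 = 0" unfolding fh_def dep1 F_def by simp
  have fhS: "fh v = fh (p v) + e (idx v)" if "v \<in> ?V" "v \<noteq> 1" for v
    using p[OF that] by (simp add: fh_def F_def idx_def)
  have edge: "N (g u - g v) \<le> \<alpha>" if "{u, v} \<in> E" for u v
  proof -
    have uv: "u \<in> ?V" "v \<in> ?V" using regular_graph_edge[OF E that] by auto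
    have "real (hop_dist E u v) \<le> 1" using hop_dist_edge[OF E con that] by simp
    then have "\<alpha> * hop_dist E u v \<le> \<alpha> * 1" using \<alpha> by (intro mult_left_mono) auto
    then show ?thesis using g[OF uv] by linarith
  qed
  have step: "N (g v - g 1 - fh (p v)) \<le> \<alpha> + r"
    if v: "v \<in> ?V" "v \<noteq> 1" and h: "N (g (p v) - g 1 - fh (p v)) \<le> r" for v
  proof -
    have "g v - g 1 - fh (p v) = (g v - g (p v)) + (g (p v) - g 1 - fh (p v))" by simp
    then have "N (g v - g 1 - fh (p v)) \<le> N (g v - g (p v)) + N (g (p v) - g 1 - fh (p v))"
      using seminorm_triangle[OF N(1)] by metis
    moreover have "N (g v - g (p v)) \<le> \<alpha>" using edge p[OF v] by (metis insert_commute)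
    ultimately show ?thesis using h by linarith
  qed
  have close: "N (g v - g 1 - fh v) \<le> r" if "v \<in> ?V" for v
    using that
  proof (induction "dep v" arbitrary: v)
    case 0
    then have v1: "v = 1" using dep0 by simp
    show ?case unfolding v1 fh1 using seminorm_zero[OF N(1)] r by simp
  next
    case (Suc k)
    then have v: "v \<noteq> 1" using dep1 by auto
    have h: "N (g (p v) - g 1 - fh (p v)) \<le> r"
      using Suc.hyps(1)[of "p v"] Suc.hyps(2) p[OF Suc.prems v] by simp
    have "N ((g v - g 1 - fh (p v)) - e (idx v)) \<le> r"
      using near[OF step[OF Suc.prems v h]] by (simp add: idx_def)
    moreover have "g v - g 1 - fh v = (g v - g 1 - fh (p v)) - e (idx v)"
      unfolding fhS[OF Suc.prems v] by simp
    ultimately show ?case by (simp only:)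
  qed
  have idxQ: "idx v < card Q" if "v \<in> ?V" "v \<noteq> 1" for v
    using near[OF step[OF that close]] p[OF that] by (simp add: idx_def)
  define i where "i = (\<lambda>v\<in>?V. if v = 1 then 0 else idx v)"
  have iP: "i \<in> PiE ?V (\<lambda>_. {..<K})"
  proof (rule PiE_I)
    fix v assume v: "v \<in> ?V"
    show "i v \<in> {..<K}"
    proof (cases "v = 1")
      case True
      then show ?thesis using v cQ Q0 by (simp add: i_def)
    next
      case False
      then show ?thesis using v idxQ[OF v False] cQ by (simp add: i_def)
    qed
  qed (auto simp: i_def)
  obtain \<phi> :: "nat \<Rightarrow> 'a \<Rightarrow> real" and K' where \<phi>: "real K' \<le> 18 ^ m" "\<And>j. linear (\<phi> j)" "\<And>j x. \<bar>\<phi> j x\<bar> \<le> N x"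
      "\<And>x. \<exists>j<K'. N x \<le> 2 * \<bar>\<phi> j x\<bar>"
    by (rule seminorm_norming_family[OF N]) (rule that; assumption)
  have K': "K' \<le> K" using order_trans[OF \<phi>(1) K(1)] by simp
  \<comment> \<open>Here rounding errors do accumulate along the tree path, over fewer than n edges.
    The factor n makes the accumulated error at most 1 in terms of the functional itself.\<close>
  define M where "M = (\<lambda>(j, a)\<in>{..<K} \<times> {..<K}. if a < card Q then round (real n * \<phi> j (e a)) else 0)"
  have MP: "M \<in> PiE ({..<K} \<times> {..<K}) (\<lambda>_. {- int B..int B})"
  proof (rule PiE_I)
    fix x assume x: "x \<in> {..<K} \<times> {..<K}"
    obtain j a where ja: "x = (j, a)" by (cases x)
    show "M x \<in> {- int B..int B}"
    proof (cases "a < card Q")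
      case True
      then have "e a \<in> Q" using e by (auto simp: bij_betw_def)
      then have "\<bar>\<phi> j (e a)\<bar> \<le> \<alpha> + r" using \<phi>(3)[of j "e a"] Q(3) by force
      then have "real n * \<bar>\<phi> j (e a)\<bar> \<le> real n * (\<alpha> + r)" by (intro mult_left_mono) auto
      then have "\<bar>real n * \<phi> j (e a)\<bar> \<le> real n * (\<alpha> + r)" by (simp add: abs_mult)
      moreover have "\<bar>of_int (round (real n * \<phi> j (e a))) - real n * \<phi> j (e a)\<bar> \<le> 1 / 2"
        by (rule of_int_round_abs_le)
      ultimately have "\<bar>real_of_int (round (real n * \<phi> j (e a)))\<bar> \<le> real B" using B unfolding r_def by linarith
      then show ?thesis using x True by (simp add: ja M_def) linarith
    qed (use x in \<open>auto simp: ja M_def\<close>)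
  qed (auto simp: M_def)
  have Mr: "\<bar>of_int (M (j, i v)) - real n * \<phi> j (e (idx v))\<bar> \<le> 1" if "j < K" "v \<in> ?V" "v \<noteq> 1" for j v
    using of_int_round_abs_le[of "real n * \<phi> j (e (idx v))"] idxQ[OF that(2,3)] cQ that
    by (simp add: M_def i_def)
  define h where "h j v = path_sum n p (\<lambda>w. M (j, i w)) v" for j v
  have pdep: "p v \<in> ?V \<and> dep v = Suc (dep (p v))" if "v \<in> ?V" "v \<noteq> 1" for v using p[OF that] by blast
  have ps1: "path_sum n p h 1 = 0" for h
    using path_sum_rec(1)[of ?V p dep n h] pdep dep1 p1 V1 depn by blast
  have ps2: "path_sum n p h v = h v + path_sum n p h (p v)" if "v \<in> ?V" "v \<noteq> 1" for h v
    using path_sum_rec(2)[of ?V p dep n v h] pdep dep1 p1 V1 depn that by blast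
  have happ: "\<bar>of_int (h j v) - real n * \<phi> j (fh v)\<bar> \<le> dep v" if j: "j < K" and "v \<in> ?V" for j v
    using that(2)
  proof (induction "dep v" arbitrary: v)
    case 0
    then have v1: "v = 1" using dep0 by simp
    show ?case unfolding v1 fh1 h_def ps1 using linear_0[OF \<phi>(2)] by simp
  next
    case (Suc k)
    then have v: "v \<noteq> 1" using dep1 by auto
    have "\<bar>of_int (h j (p v)) - real n * \<phi> j (fh (p v))\<bar> \<le> dep (p v)"
      using Suc.hyps(1)[of "p v"] Suc.hyps(2) p[OF Suc.prems v] by simp
    moreover have "h j v = M (j, i v) + h j (p v)" unfolding h_def by (rule ps2[OF Suc.prems v]) 
    moreover have "\<phi> j (fh v) = \<phi> j (fh (p v)) + \<phi> j (e (idx v))"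
      using fhS[OF Suc.prems v] linear_add[OF \<phi>(2)] by simp
    then have "real n * \<phi> j (fh v) = real n * \<phi> j (fh (p v)) + real n * \<phi> j (e (idx v))"
      by (simp add: distrib_left)
    ultimately show ?case using Mr[OF j Suc.prems v] p[OF Suc.prems v] by simp
  qed
  have happ_n: "\<bar>of_int (h j v) - real n * \<phi> j (fh v)\<bar> \<le> n" if "j < K" "v \<in> ?V" for j v
    using happ[OF that] depn[OF that(2)] by linarith
  have fhg: "N (fh u - fh v) \<le> N (g u - g v) + 2 * r \<and> N (g u - g v) \<le> N (fh u - fh v) + 2 * r"
    if "u \<in> ?V" "v \<in> ?V" for u v
  proof -
    define a b where "a = g u - g 1 - fh u" and "b = g v - g 1 - fh v"
    have ab: "N a \<le> r" "N b \<le> r" using close that by (auto simp: a_def b_def)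
    have "fh u - fh v = (g u - g v) + (b - a)" "g u - g v = (fh u - fh v) + (a - b)"
      by (auto simp: a_def b_def)
    then have "N (fh u - fh v) \<le> N (g u - g v) + N (b - a)" "N (g u - g v) \<le> N (fh u - fh v) + N (a - b)"
      using seminorm_triangle[OF N(1)] by metis+
    moreover have "N (b - a) \<le> 2 * r" "N (a - b) \<le> 2 * r"
      using seminorm_triangle_minus[OF N(1), of b a] seminorm_triangle_minus[OF N(1), of a b] ab by linarith+
    ultimately show ?thesis by linarith
  qed
  have \<phi>diff: "real n * \<phi> j (fh u) - real n * \<phi> j (fh v) = real n * \<phi> j (fh u - fh v)" for j u v
    using linear_diff[OF \<phi>(2)] by (simp add: right_diff_distrib)
  \<comment> \<open>The summands of T, per factor n: \<alpha> from the edge, r = l at each end from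
    the approximate positions, and 1 at each end from the rounded functionals.\<close>
  have "code_close n K T p i M u v" if uv: "{u, v} \<in> E" for u v
    unfolding code_close_def
  proof (intro allI impI)
    fix j assume j: "j < K"
    have uvV: "u \<in> ?V" "v \<in> ?V" using regular_graph_edge[OF E uv] by auto
    have "\<bar>\<phi> j (fh u - fh v)\<bar> \<le> \<alpha> + 2 * r"
      using \<phi>(3)[of j "fh u - fh v"] fhg[OF uvV] edge[OF uv] by linarith
    then have "real n * \<bar>\<phi> j (fh u - fh v)\<bar> \<le> real n * (\<alpha> + 2 * r)" by (intro mult_left_mono) auto
    then have "\<bar>real n * \<phi> j (fh u - fh v)\<bar> \<le> real n * (\<alpha> + 2 * r)" by (simp add: abs_mult)
    then have "\<bar>of_int (h j u) - of_int (h j v)\<bar> \<le> real n * (\<alpha> + 2 * r) + 2 * real n"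
      using happ_n[OF j uvV(1)] happ_n[OF j uvV(2)] \<phi>diff[of j u v] by linarith
    then have "of_int \<bar>h j u - h j v\<bar> \<le> real n * (\<alpha> + 2 * real l + 2)" by (simp add: r_def algebra_simps)
    then have "\<bar>h j u - h j v\<bar> \<le> T" unfolding T by (simp add: le_ceiling_iff)
    then show "\<bar>path_sum n p (\<lambda>w. M (j, i w)) u - path_sum n p (\<lambda>w. M (j, i w)) v\<bar> \<le> T" by (simp add: h_def)
  qed
  moreover have "card {v \<in> ?V. code_close n K T p i M u v} \<le> D" if u: "u \<in> ?V" for u
  proof -
    \<comment> \<open>Conversely, the ceiling in T and the rounding at both ends raise \<alpha> + 2
      l + 2 to at most \<alpha> + 2 l + 5; the norming family doubles this and the approximate
      positions add 2 l.\<close>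
    have "N (g u - g v) \<le> 2 * \<alpha> + 6 * real l + 10" if v: "v \<in> ?V" and cc: "code_close n K T p i M u v" for v
    proof -
      obtain j where j: "j < K'" "N (fh u - fh v) \<le> 2 * \<bar>\<phi> j (fh u - fh v)\<bar>" using \<phi>(4) by blast
      have jK: "j < K" using j(1) K' by simp
      have "\<bar>h j u - h j v\<bar> \<le> T" using cc jK by (simp add: code_close_def h_def)
      then have "of_int \<bar>h j u - h j v\<bar> \<le> real_of_int T" by (simp only: of_int_le_iff)
      then have "\<bar>of_int (h j u) - of_int (h j v)\<bar> \<le> real n * (\<alpha> + 2 * real l + 2) + 1"
        unfolding T by simp linarith
      then have "\<bar>real n * \<phi> j (fh u - fh v)\<bar> \<le> real n * (\<alpha> + 2 * real l + 2) + 1 + 2 * real n"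
        using happ_n[OF jK u] happ_n[OF jK v] \<phi>diff[of j u v] by linarith
      also have "\<dots> \<le> real n * (\<alpha> + 2 * real l + 5)" using assms(4) by (simp add: algebra_simps)
      finally have "real n * \<bar>\<phi> j (fh u - fh v)\<bar> \<le> real n * (\<alpha> + 2 * real l + 5)" by (simp add: abs_mult)
      then have "\<bar>\<phi> j (fh u - fh v)\<bar> \<le> \<alpha> + 2 * real l + 5" using assms(4) by simp
      then show ?thesis using j(2) fhg[OF u v] by (simp add: r_def)
    qed
    then have "card {v \<in> ?V. code_close n K T p i M u v} \<le> card {v \<in> ?V. N (g u - g v) \<le> 2 * \<alpha> + 6 * real l + 10}"
      by (intro card_mono) auto
    then have "real (card {v \<in> ?V. code_close n K T p i M u v}) \<le> real (card {v \<in> ?V. N (g u - g v) \<le> 2 * \<alpha> + 6 * real l + 10})"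
      by simp
    also have "\<dots> \<le> (2 + 4 * (2 * \<alpha> + 6 * real l + 10) / l) ^ m * real \<Delta> ^ Suc l"
      by (rule card_seminorm_close_le[OF E con assms(3) N _ u _ l]) (use g \<alpha> in auto)
    also have "\<dots> \<le> real D" by (rule D)
    finally show ?thesis by simp
  qed
  ultimately show ?thesis using pP iP MP by blast
qed

text \<open>A graph is determined by its neighbourhoods, each of which is one of at most
  \<open>D ^ \<Delta>\<close> subsets of \<open>H u\<close>.\<close>

lemma card_regular_subgraphs_le:
  assumes "\<And>u. u \<in> {1..n} \<Longrightarrow> card (H u) \<le> D" "\<And>u. u \<in> {1..n} \<Longrightarrow> finite (H u)"
  shows "finite {E \<in> regular_graphs n \<Delta>. \<forall>u v. {u, v} \<in> E \<longrightarrow> v \<in> H u}"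
    "card {E \<in> regular_graphs n \<Delta>. \<forall>u v. {u, v} \<in> E \<longrightarrow> v \<in> H u} \<le> (D ^ \<Delta>) ^ n"
proof -
  let ?G = "{E \<in> regular_graphs n \<Delta>. \<forall>u v. {u, v} \<in> E \<longrightarrow> v \<in> H u}"
  let ?P = "PiE {1..n} (\<lambda>u. {A. A \<subseteq> H u \<and> card A = \<Delta>})"
  define nb where "nb E = (\<lambda>u\<in>{1..n}. {v. {u, v} \<in> E})" for E :: "nat set set"
  have inj: "inj_on nb ?G"
  proof (rule inj_onI)
    have sub: "E \<subseteq> E'" if E: "E \<in> ?G" and E': "E' \<in> ?G" and eq: "nb E = nb E'" for E E'
    proof
      fix e assume e: "e \<in> E"
      obtain u v where uv: "e = {u, v}" using regular_graph_edgeE[of E n \<Delta> e] E e by blast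
      have "u \<in> {1..n}" using regular_graph_edge(1)[of E n \<Delta> u v] E e uv by blast
      then have "{v. {u, v} \<in> E} = {v. {u, v} \<in> E'}" using fun_cong[OF eq, of u] by (simp add: nb_def)
      then show "e \<in> E'" using e uv by blast
    qed
    fix E E' assume "E \<in> ?G" "E' \<in> ?G" "nb E = nb E'"
    then show "E = E'" using sub[of E E'] sub[of E' E] by simp
  qed
  have fin: "finite ?P" using assms(2) by (intro finite_PiE) (auto intro: finite_subset[of _ "Pow (H _)"])
  have img: "nb ` ?G \<subseteq> ?P"
    using regular_graph_degree(2) by (fastforce simp: nb_def)
  show "finite ?G" using finite_imageD[OF finite_subset[OF img fin] inj] .
  have "card ?G \<le> card ?P" by (rule card_inj_on_le[OF inj img fin])
  also have "\<dots> = (\<Prod>u\<in>{1..n}. card {A. A \<subseteq> H u \<and> card A = \<Delta>})" by (simp add: card_PiE)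
  also have "\<dots> \<le> (\<Prod>u\<in>{1..n}. D ^ \<Delta>)"
  proof (rule prod_mono, intro conjI)
    fix u assume u: "u \<in> {1..n}"
    have "card {A. A \<subseteq> H u \<and> card A = \<Delta>} = card (H u) choose \<Delta>" using n_subsets[OF assms(2)[OF u]] .
    also have "\<dots> \<le> card (H u) ^ \<Delta>"
      by (cases "\<Delta> \<le> card (H u)") (auto simp: binomial_le_pow binomial_eq_0)
    also have "\<dots> \<le> D ^ \<Delta>" using assms(1)[OF u] by (rule power_mono) simp
    finally show "card {A. A \<subseteq> H u \<and> card A = \<Delta>} \<le> D ^ \<Delta>" .
  qed simp
  also have "\<dots> = (D ^ \<Delta>) ^ n" by simp
  finally show "card ?G \<le> (D ^ \<Delta>) ^ n" .
qed

text \<open>A union bound over the codes: the factors count parent maps, net indices, tables of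
  rounded functional values, and the graphs compatible with one code. The table is shared by all
  vertices, so its number of entries is K * K rather than a multiple of n. The bounds are uniform in
  m, which lets all dimensions share the same codes.\<close>

lemma card_embeddable_graphs_le:
  assumes "\<Delta> \<ge> 2" "n \<ge> 1" "\<alpha> > 0" "l \<ge> 1"
    and K: "\<And>m. real m \<le> d \<Longrightarrow> 18 ^ m \<le> real K" "\<And>m. real m \<le> d \<Longrightarrow> (2 + 4 * (\<alpha> + l) / l) ^ m \<le> real K"
    and B: "real n * (\<alpha> + l) + 1 \<le> real B"
    and D: "\<And>m. real m \<le> d \<Longrightarrow> (2 + 4 * (2 * \<alpha> + 6 * real l + 10) / l) ^ m * real \<Delta> ^ Suc l \<le> real D"
  shows "card (embeddable_graphs n \<Delta> d \<alpha>) \<le>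
    n ^ n * K ^ n * (2 * B + 1) ^ (K * K) * (D ^ \<Delta>) ^ n"
proof -
  define T where "T = \<lceil>real n * (\<alpha> + 2 * real l + 2)\<rceil>"
  define C where "C = PiE {1..n} (\<lambda>_. {1..n}) \<times> PiE {1..n} (\<lambda>_. {..<K}) \<times>
      PiE ({..<K} \<times> {..<K}) (\<lambda>_. {- int B..int B})"
  define H where "H = (\<lambda>(p, i, M) u. {v \<in> {1..n}. code_close n K T p i M u v})"
  \<comment> \<open>An arbitrary element of the product may leave too many candidate neighbours; a
    code of an embedded graph does not.\<close>
  define C' where "C' = {c \<in> C. \<forall>u\<in>{1..n}. card (H c u) \<le> D}"
  define G where "G c = {E \<in> regular_graphs n \<Delta>. \<forall>u v. {u, v} \<in> E \<longrightarrow> v \<in> H c u}" for c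
  have finC: "finite C" by (auto simp: C_def intro!: finite_cartesian_product finite_PiE)
  then have finC': "finite C'" by (simp add: C'_def)
  have finH: "finite (H c u)" for c u by (cases c) (simp add: H_def)
  have G: "finite (G c)" "card (G c) \<le> (D ^ \<Delta>) ^ n" if "c \<in> C'" for c
    using card_regular_subgraphs_le[of n "H c" D \<Delta>] that finH by (auto simp: G_def C'_def)
  have sub: "embeddable_graphs n \<Delta> d \<alpha> \<subseteq> (\<Union>c\<in>C'. G c)"
  proof
    fix E assume "E \<in> embeddable_graphs n \<Delta> d \<alpha>"
    then have E: "E \<in> regular_graphs n \<Delta>" "connected_graph n E"
       "embeds_in_dimension_at_most {1..n} (graph_dist E) d \<alpha>" by auto
    obtain m and N :: "linf \<Rightarrow> real" and g where m: "real m \<le> d" "seminorm N" "seminorm_rank_le N m"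
      "\<And>u v. u \<in> {1..n} \<Longrightarrow> v \<in> {1..n} \<Longrightarrow> graph_dist E u v \<le> N (g u - g v) \<and> N (g u - g v) \<le> \<alpha> * graph_dist E u v"
      using embedding_gives_seminorm[OF E(3) assms(3)] by blast
    obtain p i M where c: "(p, i, M) \<in> C" "\<And>u v. {u, v} \<in> E \<Longrightarrow> code_close n K T p i M u v"
      "\<And>u. u \<in> {1..n} \<Longrightarrow> card {v \<in> {1..n}. code_close n K T p i M u v} \<le> D"
      using embedded_graph_has_code[OF E(1,2) assms(1,2) m(2,3) m(4)[unfolded graph_dist_eq_hop_dist] assms(3,4)
          K(1)[OF m(1)] K(2)[OF m(1)] B D[OF m(1)] T_def]
      unfolding C_def by blast
    have "(p, i, M) \<in> C'" using c by (simp add: C'_def H_def)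
    moreover have "E \<in> G (p, i, M)"
      using c(2) E(1) regular_graph_edge[OF E(1)] by (simp add: G_def H_def)
    ultimately show "E \<in> (\<Union>c\<in>C'. G c)" by blast
  qed
  have "card (embeddable_graphs n \<Delta> d \<alpha>) \<le> card (\<Union>c\<in>C'. G c)"
    by (rule card_mono[OF _ sub]) (use finC' G in auto)
  also have "\<dots> \<le> (\<Sum>c\<in>C'. card (G c))" by (rule card_UN_le[OF finC'])
  also have "\<dots> \<le> (\<Sum>c\<in>C'. (D ^ \<Delta>) ^ n)" using G by (intro sum_mono) auto
  also have "\<dots> = card C' * (D ^ \<Delta>) ^ n" by simp
  also have "\<dots> \<le> card C * (D ^ \<Delta>) ^ n" using card_mono[OF finC, of C'] by (intro mult_right_mono) (auto simp: C'_def)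
  also have "card C = n ^ n * K ^ n * (2 * B + 1) ^ (K * K)"
  proof -
    have "card {- int B..int B} = 2 * B + 1" unfolding card_atLeastAtMost_int by arith
    then show ?thesis by (simp only: C_def card_cartesian_product card_PiE finite_atLeastAtMost finite_lessThan
        finite_cartesian_product prod_constant card_atLeastAtMost card_lessThan) simp
  qed
  finally show ?thesis .
qed

section \<open>Counting connected regular graphs\<close>

definition relation_graph :: "nat \<Rightarrow> (nat \<Rightarrow> nat \<Rightarrow> bool) \<Rightarrow> nat set set" where
  "relation_graph n A = {{u, v} | u v. u \<in> {1..n} \<and> v \<in> {1..n} \<and> A u v}"

lemma relation_graph_edge:
  assumes "\<And>u v. A u v \<Longrightarrow> A v u"
  shows "{u, v} \<in> relation_graph n A \<longleftrightarrow> u \<in> {1..n} \<and> v \<in> {1..n} \<and> A u v"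
  using assms unfolding relation_graph_def by (auto simp: doubleton_eq_iff)

lemma relation_graph_regular:
  assumes sym: "\<And>u v. A u v \<Longrightarrow> A v u" and irr: "\<And>u. \<not> A u u"
    and deg: "\<And>u. u \<in> {1..n} \<Longrightarrow> card {v \<in> {1..n}. A u v} = \<Delta>"
  shows "relation_graph n A \<in> regular_graphs n \<Delta>"
proof -
  have "card {e \<in> relation_graph n A. u \<in> e} = \<Delta>" if u: "u \<in> {1..n}" for u
  proof -
    have "{e \<in> relation_graph n A. u \<in> e} = (\<lambda>v. {u, v}) ` {v \<in> {1..n}. A u v}"
      unfolding relation_graph_def using u sym by (auto simp: insert_commute)
    moreover have "inj_on (\<lambda>v. {u, v}) {v \<in> {1..n}. A u v}" by (auto simp: inj_on_def doubleton_eq_iff)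
    ultimately show ?thesis using deg[OF u] by (simp add: card_image)
  qed
  moreover have "e \<subseteq> {1..n} \<and> card e = 2" if e: "e \<in> relation_graph n A" for e
  proof -
    obtain u v where "e = {u, v}" "u \<in> {1..n}" "v \<in> {1..n}" "A u v"
      using e unfolding relation_graph_def by blast
    then show ?thesis using irr[of u] by (cases "u = v") auto
  qed
  ultimately show ?thesis unfolding regular_graphs_def by blast
qed

lemma finite_regular_graphs: "finite (regular_graphs n \<Delta>)"
  by (rule finite_subset[of _ "Pow (Pow {1..n})"]) (auto simp: regular_graphs_def)

section \<open>Circulant graphs: Cayley graphs of the integers modulo n\<close>

definition circulant :: "nat \<Rightarrow> int set \<Rightarrow> nat \<Rightarrow> nat \<Rightarrow> bool" where
  "circulant n S u v \<longleftrightarrow> (int u - int v) mod int n \<in> S"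

lemma circulant_sym:
  assumes "\<And>s. s \<in> S \<Longrightarrow> int n - s \<in> S" "S \<subseteq> {1..<int n}" "circulant n S u v"
  shows "circulant n S v u"
proof -
  have nz: "(int u - int v) mod int n \<noteq> 0" using assms(2,3) by (force simp: circulant_def)
  have "(int v - int u) mod int n = (- (int u - int v)) mod int n" by simp
  also have "\<dots> = int n - (int u - int v) mod int n" using nz by (simp only: zmod_zminus1_eq_if) auto
  finally show ?thesis using assms(1,3) by (simp add: circulant_def)
qed

lemma circulant_degree:
  assumes "S \<subseteq> {1..<int n}"
  shows "card {v \<in> {1..n}. circulant n S u v} = card S"
proof -
  let ?f = "\<lambda>v::nat. (int u - int v) mod int n"
  have inj: "inj_on ?f {1..n}"
  proof (rule inj_onI)
    fix v w assume vw: "v \<in> {1..n}" "w \<in> {1..n}" and eq: "?f v = ?f w"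
    then have "int n dvd (int u - int v) - (int u - int w)" by (simp add: mod_eq_dvd_iff)
    then have "int n dvd int w - int v" by simp
    moreover have "\<bar>int w - int v\<bar> < int n" using vw by auto
    ultimately have "int w - int v = 0" using zdvd_imp_le[of "int n" "\<bar>int w - int v\<bar>"] by force
    then show "v = w" by simp
  qed
  have "?f ` {1..n} \<subseteq> {0..<int n}"
  proof
    fix x assume "x \<in> ?f ` {1..n}"
    then obtain v where "v \<in> {1..n}" "x = ?f v" by blast
    then show "x \<in> {0..<int n}" by simp
  qed
  moreover have "card (?f ` {1..n}) = card {0..<int n}" using card_image[OF inj] by simp
  ultimately have img: "?f ` {1..n} = {0..<int n}" by (simp add: card_subset_eq)
  have "?f ` {v \<in> {1..n}. circulant n S u v} = S"
  proof
    show "S \<subseteq> ?f ` {v \<in> {1..n}. circulant n S u v}"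
    proof
      fix s assume s: "s \<in> S"
      then have "s \<in> ?f ` {1..n}" unfolding img using assms by force
      then show "s \<in> ?f ` {v \<in> {1..n}. circulant n S u v}" using s by (auto simp: circulant_def)
    qed
  qed (auto simp: circulant_def)
  moreover have "inj_on ?f {v \<in> {1..n}. circulant n S u v}" by (rule inj_on_subset[OF inj]) auto
  ultimately show ?thesis by (metis (no_types, lifting) card_image)
qed

section \<open>Switching the edges of an induced matching\<close>

definition switched :: "(nat \<Rightarrow> nat \<Rightarrow> bool) \<Rightarrow> nat \<Rightarrow> (nat \<Rightarrow> nat) \<Rightarrow> (nat \<Rightarrow> nat) \<Rightarrow> (nat \<Rightarrow> nat) \<Rightarrow> nat \<Rightarrow> nat \<Rightarrow> bool" where
  "switched A l a b \<tau> u v \<longleftrightarrow>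
     (A u v \<and> \<not> (\<exists>i<l. {u, v} = {a i, b i})) \<or> (\<exists>i<l. {u, v} = {a i, b (\<tau> i)})"

text \<open>The case y = x is included on purpose: at a fixed point of the permutation the removed
  edge is put back.\<close>

lemma card_exchange:
  assumes "finite N" "x \<in> N" "y \<notin> N - {x}"
  shows "card (insert y (N - {x})) = card N"
  using assms by (metis card.remove card_insert_disjoint finite_Diff)

text \<open>\<open>Aab\<close> says that the matching edges are the only edges of \<open>A\<close>
  between the two sides. So the inserted edges are new or just removed, which preserves degrees, and
  after switching the edges between the sides spell out the permutation.\<close>

locale switchable_matching =
  fixes A :: "nat \<Rightarrow> nat \<Rightarrow> bool" and n l :: nat and a b :: "nat \<Rightarrow> nat"
  assumes A_sym: "\<And>u v. A u v \<Longrightarrow> A v u" and A_irr: "\<And>u. \<not> A u u"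
    and inj_a: "inj_on a {..<l}" and inj_b: "inj_on b {..<l}"
    and ab: "\<And>i j. i < l \<Longrightarrow> j < l \<Longrightarrow> a i \<noteq> b j"
    and aV: "\<And>i. i < l \<Longrightarrow> a i \<in> {1..n}" and bV: "\<And>i. i < l \<Longrightarrow> b i \<in> {1..n}"
    and Aab: "\<And>i j. i < l \<Longrightarrow> j < l \<Longrightarrow> A (a i) (b j) \<longleftrightarrow> i = j"
begin

lemma switched_sym: "switched A l a b \<tau> u v \<Longrightarrow> switched A l a b \<tau> v u"
  unfolding switched_def using A_sym by (metis insert_commute)

context
  fixes \<tau> :: "nat \<Rightarrow> nat"
  assumes \<tau>: "\<tau> permutes {..<l}"
begin

lemma switched_perm_less: "i < l \<Longrightarrow> \<tau> i < l"
  using permutes_in_image[OF \<tau>] by auto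

lemma switched_irrefl: "\<not> switched A l a b \<tau> u u"
  unfolding switched_def using A_irr ab switched_perm_less by (auto simp: doubleton_eq_iff) metis

lemma switched_between: "i < l \<Longrightarrow> j < l \<Longrightarrow> switched A l a b \<tau> (a i) (b j) \<longleftrightarrow> j = \<tau> i"
proof -
  assume ij: "i < l" "j < l"
  have eq: "{a i, b j} = {a k, b m} \<longleftrightarrow> i = k \<and> j = m" if "k < l" "m < l" for k m
    using inj_onD[OF inj_a, of i k] inj_onD[OF inj_b, of j m] ab ij that
    by (auto simp: doubleton_eq_iff)
  show ?thesis
    unfolding switched_def using eq switched_perm_less Aab[OF ij] ij by blast
qed

lemma switched_degree:
  assumes u: "u \<in> {1..n}"
  shows "card {v \<in> {1..n}. switched A l a b \<tau> u v} = card {v \<in> {1..n}. A u v}"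
proof -
  let ?N = "{v \<in> {1..n}. A u v}"
  consider i where "i < l" "u = a i" | j where "j < l" "u = b j" | "u \<notin> a ` {..<l}" "u \<notin> b ` {..<l}" by blast
  then show ?thesis
  proof cases
    case 1
    have "switched A l a b \<tau> (a i) v \<longleftrightarrow> (A (a i) v \<and> v \<noteq> b i) \<or> v = b (\<tau> i)" for v
    proof -
      have "{a i, v} = {a k, b m} \<longleftrightarrow> i = k \<and> v = b m" if "k < l" "m < l" for k m
        using inj_onD[OF inj_a, of i k] ab[of i m] 1(1) that by (auto simp: doubleton_eq_iff)
      then show ?thesis unfolding switched_def using switched_perm_less 1(1) by blast
    qed
    then have "{v \<in> {1..n}. switched A l a b \<tau> u v} = insert (b (\<tau> i)) (?N - {b i})"
      using 1 bV switched_perm_less by auto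
    moreover have "b (\<tau> i) \<notin> ?N - {b i}" using 1 Aab[of i "\<tau> i"] switched_perm_less[of i] by auto
    moreover have "b i \<in> ?N" using 1 Aab[of i i] bV[of i] by auto
    ultimately show ?thesis using card_exchange[of ?N "b i"] by simp
  next
    case 2
    define k where "k = inv \<tau> j"
    have k: "k < l" "\<tau> k = j"
      using permutes_in_image[OF permutes_inv[OF \<tau>], of j] 2(1) permutes_inverses(1)[OF \<tau>] by (auto simp: k_def)
    have kk: "i = k" if "\<tau> i = j" for i using that k(2) permutes_inj[OF \<tau>] by (metis injD)
    have "switched A l a b \<tau> (b j) v \<longleftrightarrow> (A (b j) v \<and> v \<noteq> a j) \<or> v = a k" for v
    proof -
      have "{b j, v} = {a i, b m} \<longleftrightarrow> j = m \<and> v = a i" if "i < l" "m < l" for i m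
        using inj_onD[OF inj_b, of j m] ab[of i j] 2(1) that by (auto simp: doubleton_eq_iff)
      then have e: "(\<exists>i<l. {b j, v} = {a i, b i}) \<longleftrightarrow> v = a j"
        "(\<exists>i<l. {b j, v} = {a i, b (\<tau> i)}) \<longleftrightarrow> (\<exists>i<l. \<tau> i = j \<and> v = a i)"
        using switched_perm_less 2(1) by auto
      have "(\<exists>i<l. \<tau> i = j \<and> v = a i) \<longleftrightarrow> v = a k" using k kk by blast
      then show ?thesis unfolding switched_def e by blast
    qed
    then have "{v \<in> {1..n}. switched A l a b \<tau> u v} = insert (a k) (?N - {a j})"
      using 2 aV k by auto
    moreover have "a k \<notin> ?N - {a j}" using 2 Aab[of k j] k A_sym by auto
    moreover have "a j \<in> ?N" using 2 Aab[of j j] aV[of j] A_sym by auto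
    ultimately show ?thesis using card_exchange[of ?N "a j"] by simp
  next
    case 3
    have "switched A l a b \<tau> u v \<longleftrightarrow> A u v" for v
      unfolding switched_def using 3 switched_perm_less by (auto simp: doubleton_eq_iff image_iff)
    then show ?thesis by simp
  qed
qed

end

end

text \<open>A relabelling of a graph with the Hamiltonian path \<open>1, \<dots>, n\<close> is determined by the relabelled graph
  up to the choice of a walk in it.\<close>

lemma card_relabelled_hamiltonian:
  fixes A :: "'t \<Rightarrow> nat \<Rightarrow> nat \<Rightarrow> bool"
  assumes "n \<ge> 1" and sym: "\<And>t u v. t \<in> X \<Longrightarrow> A t u v \<Longrightarrow> A t v u" and irr: "\<And>t u. t \<in> X \<Longrightarrow> \<not> A t u u"
    and deg: "\<And>t u. t \<in> X \<Longrightarrow> u \<in> {1..n} \<Longrightarrow> card {v \<in> {1..n}. A t u v} = \<Delta>"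
    and path: "\<And>t s. t \<in> X \<Longrightarrow> 1 \<le> s \<Longrightarrow> s < n \<Longrightarrow> A t s (Suc s)"
    and inj: "\<And>t t'. t \<in> X \<Longrightarrow> t' \<in> X \<Longrightarrow> (\<And>u v. u \<in> {1..n} \<Longrightarrow> v \<in> {1..n} \<Longrightarrow> A t u v \<longleftrightarrow> A t' u v) \<Longrightarrow> t = t'"
  shows "fact n * card X \<le> card (connected_regular_graphs n \<Delta>) * (n * \<Delta> ^ (n - 1))"
proof -
  let ?V = "{1..n}"
  define P where "P = {\<pi>. \<pi> permutes ?V}"
  define G where "G \<pi> t = relation_graph n (\<lambda>u v. A t (inv \<pi> u) (inv \<pi> v))" for \<pi> t
  have edge: "{\<pi> u, \<pi> v} \<in> G \<pi> t \<longleftrightarrow> A t u v"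
    if \<pi>: "\<pi> \<in> P" and t: "t \<in> X" and uv: "u \<in> ?V" "v \<in> ?V" for \<pi> t u v
  proof -
    have pi: "\<pi> permutes ?V" using \<pi> by (simp add: P_def)
    have "\<pi> u \<in> ?V" "\<pi> v \<in> ?V" using permutes_in_image[OF pi] uv by blast+
    moreover have "{\<pi> u, \<pi> v} \<in> G \<pi> t \<longleftrightarrow> \<pi> u \<in> ?V \<and> \<pi> v \<in> ?V \<and> A t (inv \<pi> (\<pi> u)) (inv \<pi> (\<pi> v))"
      unfolding G_def using sym[OF t] by (intro relation_graph_edge) blast
    ultimately show ?thesis by (simp only: permutes_inverses(2)[OF pi]) blast
  qed
  have reg: "G \<pi> t \<in> regular_graphs n \<Delta>" if \<pi>: "\<pi> \<in> P" and t: "t \<in> X" for \<pi> t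
    unfolding G_def
  proof (rule relation_graph_regular)
    have pi: "\<pi> permutes ?V" using \<pi> by (simp add: P_def)
    have ipi: "inv \<pi> permutes ?V" by (rule permutes_inv[OF pi])
    fix u assume u: "u \<in> ?V"
    have "{v \<in> ?V. A t (inv \<pi> u) (inv \<pi> v)} = \<pi> ` {w \<in> ?V. A t (inv \<pi> u) w}"
    proof (intro equalityI subsetI)
      fix v assume v: "v \<in> {v \<in> ?V. A t (inv \<pi> u) (inv \<pi> v)}"
      then have "inv \<pi> v \<in> {w \<in> ?V. A t (inv \<pi> u) w}" using permutes_in_image[OF ipi] by blast
      moreover have "v = \<pi> (inv \<pi> v)" using permutes_inverses(1)[OF pi] by simp
      ultimately show "v \<in> \<pi> ` {w \<in> ?V. A t (inv \<pi> u) w}" by blast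
    next
      fix v assume "v \<in> \<pi> ` {w \<in> ?V. A t (inv \<pi> u) w}"
      then obtain w where w: "w \<in> ?V" "A t (inv \<pi> u) w" "v = \<pi> w" by blast
      then show "v \<in> {v \<in> ?V. A t (inv \<pi> u) (inv \<pi> v)}"
        using permutes_in_image[OF pi, of w] permutes_inverses(2)[OF pi, of w] by simp
    qed
    moreover have "card (\<pi> ` {w \<in> ?V. A t (inv \<pi> u) w}) = card {w \<in> ?V. A t (inv \<pi> u) w}"
      by (rule card_image) (rule inj_on_subset[OF permutes_inj[OF pi]], simp)
    moreover have "card {w \<in> ?V. A t (inv \<pi> u) w} = \<Delta>"
      using deg[OF t] permutes_in_image[OF ipi] u by blast
    ultimately show "card {v \<in> ?V. A t (inv \<pi> u) (inv \<pi> v)} = \<Delta>" by simp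
  qed (use sym[OF t] irr[OF t] in blast)+
  have con: "connected_graph n (G \<pi> t)" if \<pi>: "\<pi> \<in> P" and t: "t \<in> X" for \<pi> t
  proof -
    have pi: "\<pi> permutes ?V" using \<pi> by (simp add: P_def)
    have from1: "(\<pi> 1, \<pi> s) \<in> (adj (G \<pi> t))\<^sup>*" if "1 \<le> s" "s \<le> n" for s
      using that
    proof (induction s rule: nat_induct_at_least)
      case (Suc s)
      have "(\<pi> s, \<pi> (Suc s)) \<in> adj (G \<pi> t)"
        using edge[OF \<pi> t, of s "Suc s"] path[OF t, of s] Suc by (simp add: adj_def)
      then show ?case using Suc by (meson Suc_leD rtrancl.rtrancl_into_rtrancl)
    qed simp
    have sym': "sym ((adj (G \<pi> t))\<^sup>*)" by (rule sym_rtrancl[OF sym_adj])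
    have reach: "(\<pi> 1, u) \<in> (adj (G \<pi> t))\<^sup>*" if u: "u \<in> ?V" for u
    proof -
      have "inv \<pi> u \<in> ?V" using permutes_in_image[OF permutes_inv[OF pi]] u by blast
      then show ?thesis using from1[of "inv \<pi> u"] permutes_inverses(1)[OF pi, of u] by simp
    qed
    show ?thesis unfolding connected_graph_def
    proof (intro ballI)
      fix u v assume "u \<in> ?V" "v \<in> ?V"
      then show "(u, v) \<in> (adj (G \<pi> t))\<^sup>*" using reach symD[OF sym'] by (meson rtrancl_trans)
    qed
  qed
  \<comment> \<open>With the neighbours of every vertex numbered below \<Delta>, a walk becomes a
    start vertex and a sequence of n - 1 numbers.\<close>
  have "\<exists>h. inj_on h {v. {u, v} \<in> E} \<and> h ` {v. {u, v} \<in> E} \<subseteq> {..<\<Delta>}"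
    if "E \<in> regular_graphs n \<Delta>" "u \<in> ?V" for E u
  proof -
    obtain h where "bij_betw h {v. {u, v} \<in> E} {0..<card {v. {u, v} \<in> E}}"
      using ex_bij_betw_finite_nat[OF regular_graph_degree(1)[OF \<open>E \<in> regular_graphs n \<Delta>\<close> \<open>u \<in> ?V\<close>]] by blast
    then show ?thesis
      unfolding regular_graph_degree(2)[OF that] by (auto simp: bij_betw_def lessThan_atLeast0)
  qed
  then obtain h where h: "\<And>E u. E \<in> regular_graphs n \<Delta> \<Longrightarrow> u \<in> ?V \<Longrightarrow>
      inj_on (h E u) {v. {u, v} \<in> E} \<and> h E u ` {v. {u, v} \<in> E} \<subseteq> {..<\<Delta>}" by metis
  \<comment> \<open>The graph and the numbers recover \<pi> vertex by vertex along the path; undoing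
    \<pi> then gives the relation \<open>A t\<close> and hence t.\<close>
  define code where "code = (\<lambda>(\<pi>, t). (G \<pi> t, \<pi> 1, \<lambda>s\<in>{1..<n}. h (G \<pi> t) (\<pi> s) (\<pi> (Suc s))))"
  let ?C = "connected_regular_graphs n \<Delta> \<times> ?V \<times> PiE {1..<n} (\<lambda>_. {..<\<Delta>})"
  have piV: "\<pi> s \<in> ?V" if "\<pi> \<in> P" "s \<in> ?V" for \<pi> s
    using that permutes_in_image[of \<pi> ?V s] unfolding P_def by blast
  have step: "{\<pi> s, \<pi> (Suc s)} \<in> G \<pi> t" if "\<pi> \<in> P" "t \<in> X" "s \<in> {1..<n}" for \<pi> t s
    using edge[OF that(1,2), of s "Suc s"] path[OF that(2), of s] that(3) by simp
  have "code ` (P \<times> X) \<subseteq> ?C"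
  proof (rule image_subsetI)
    fix x assume "x \<in> P \<times> X"
    then obtain \<pi> t where x: "x = (\<pi>, t)" "\<pi> \<in> P" "t \<in> X" by blast
    have "h (G \<pi> t) (\<pi> s) (\<pi> (Suc s)) \<in> {..<\<Delta>}" if "s \<in> {1..<n}" for s
      using h[OF reg[OF x(2,3)] piV[OF x(2), of s]] step[OF x(2,3) that] that by auto
    then show "code x \<in> ?C" using reg[OF x(2,3)] con[OF x(2,3)] piV[OF x(2), of 1] assms(1)
      by (simp add: x(1) code_def)
  qed
  moreover have "inj_on code (P \<times> X)"
  proof (rule inj_onI, clarify)
    fix \<pi> t \<pi>' t'
    assume P: "\<pi> \<in> P" "\<pi>' \<in> P" and X: "t \<in> X" "t' \<in> X" and eq: "code (\<pi>, t) = code (\<pi>', t')"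
    have "G \<pi> t = G \<pi>' t' \<and> \<pi> 1 = \<pi>' 1 \<and>
        (\<lambda>s\<in>{1..<n}. h (G \<pi> t) (\<pi> s) (\<pi> (Suc s))) = (\<lambda>s\<in>{1..<n}. h (G \<pi>' t') (\<pi>' s) (\<pi>' (Suc s)))"
      using eq[unfolded code_def prod.case prod.inject] .
    then have Geq: "G \<pi> t = G \<pi>' t'" and one: "\<pi> 1 = \<pi>' 1"
      and seq: "(\<lambda>s\<in>{1..<n}. h (G \<pi> t) (\<pi> s) (\<pi> (Suc s))) = (\<lambda>s\<in>{1..<n}. h (G \<pi>' t') (\<pi>' s) (\<pi>' (Suc s)))"
      by blast+
    have pts: "\<pi> s = \<pi>' s" if "1 \<le> s" "s \<le> n" for s
      using that
    proof (induction s rule: nat_induct_at_least)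
      case base
      show ?case by (rule one)
    next
      case (Suc s)
      then have s: "s \<in> {1..<n}" and e: "\<pi> s = \<pi>' s" by auto
      have "h (G \<pi> t) (\<pi> s) (\<pi> (Suc s)) = h (G \<pi> t) (\<pi> s) (\<pi>' (Suc s))"
        using fun_cong[OF seq, of s] s e Geq by simp
      moreover have "\<pi> (Suc s) \<in> {v. {\<pi> s, v} \<in> G \<pi> t}" using step[OF P(1) X(1) s] by simp
      moreover have "\<pi>' (Suc s) \<in> {v. {\<pi> s, v} \<in> G \<pi> t}" using step[OF P(2) X(2) s] by (simp add: e Geq)
      moreover have "inj_on (h (G \<pi> t) (\<pi> s)) {v. {\<pi> s, v} \<in> G \<pi> t}"
        using h[OF reg[OF P(1) X(1)] piV[OF P(1), of s]] s by simp
      ultimately show ?case by (meson inj_onD)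
    qed
    have \<pi>eq: "\<pi> = \<pi>'"
    proof
      fix s
      show "\<pi> s = \<pi>' s"
        using pts[of s] P permutes_not_in[of \<pi> ?V s] permutes_not_in[of \<pi>' ?V s] by (cases "s \<in> ?V") (auto simp: P_def)
    qed
    have "A t u v \<longleftrightarrow> A t' u v" if "u \<in> ?V" "v \<in> ?V" for u v
      using edge[OF P(1) X(1) that] edge[OF P(2) X(2) that] Geq \<pi>eq by simp
    then have "t = t'" using inj[OF X] by blast
    then show "\<pi> = \<pi>' \<and> t = t'" using \<pi>eq by blast
  qed
  moreover have "finite ?C"
    by (intro finite_cartesian_product finite_PiE) (auto intro: finite_subset[OF _ finite_regular_graphs])
  ultimately have "card (P \<times> X) \<le> card ?C" by (intro card_inj_on_le)
  moreover have "card P = fact n" unfolding P_def using card_permutations[of ?V n] by simp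
  ultimately show ?thesis by (simp add: card_cartesian_product card_PiE)
qed

lemma circulant_steps_card:
  fixes n r :: nat
  assumes "2 * r < n"
  shows "card ({1..int r} \<union> {int n - int r..<int n}) = 2 * r"
  using assms by (subst card_Un_disjoint) auto

text \<open>The graph joins residues at distance at most \<Delta> div 2 and, for odd \<Delta>, also
  antipodal ones; n is even in that case. The switched edges have length 2 or n div 2 and start at
  multiples of \<Delta> + 3, shifted by 1, in the first quarter of the cycle, too far apart to
  interact. The edges of length 1 form the Hamiltonian path.\<close>

lemma connected_regular_graphs_lower_bound:
  assumes \<Delta>: "\<Delta> \<ge> 3" and ev: "even (\<Delta> * n)" and n: "n \<ge> 16 * (\<Delta> + 3)"
  shows "fact n * fact (n div (4 * (\<Delta> + 3))) \<le>
    card (connected_regular_graphs n \<Delta>) * (n * \<Delta> ^ (n - 1))"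
proof -
  define D where "D = \<Delta> + 3"
  define l where "l = n div (4 * D)"
  define r where "r = \<Delta> div 2"
  define S where "S = {1..int r} \<union> {int n - int r..<int n} \<union> (if even \<Delta> then {} else {int (n div 2)})"
  define off where "off = (if even \<Delta> then 2 else n div 2)"
  define a where "a i = D * i + 1" for i :: nat
  define b where "b i = a i + off" for i
  define A where "A = circulant n S"
  have D: "D \<ge> 6" "n \<ge> 16 * D" using \<Delta> n by (auto simp: D_def)
  have r: "r \<ge> 1" "r + 3 < D" using \<Delta> by (auto simp: r_def D_def)
  have Dl: "4 * (D * l) \<le> n" unfolding l_def by (metis mult.assoc mult.commute div_times_less_eq_dividend)
  have neven: "n = 2 * (n div 2)" if "odd \<Delta>" using ev that by auto
  have S_sub: "S \<subseteq> {1..<int n}" using D r by (auto simp: S_def split: if_splits)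
  have S_sym: "int n - s \<in> S" if "s \<in> S" for s
    using that neven by (auto simp: S_def split: if_splits)
  have cardS: "card S = \<Delta>"
  proof (cases "even \<Delta>")
    case True
    then show ?thesis using circulant_steps_card[of r n] D r by (simp add: S_def r_def)
  next
    case False
    have "int (n div 2) \<notin> {1..int r} \<union> {int n - int r..<int n}" using D r neven[OF False] by auto
    then have "card S = Suc (card ({1..int r} \<union> {int n - int r..<int n}))" using False by (simp add: S_def)
    then show ?thesis using circulant_steps_card[of r n] D r False by (simp add: r_def)
  qed
  have off2: "off \<ge> 2" using D by (auto simp: off_def)
  have offle: "2 * off \<le> n" using D by (auto simp: off_def)
  have Di: "D * i + D \<le> D * l" if "i < l" for i
    using mult_le_mono2[of "Suc i" l D] that by simp
  have ltDl: "4 * (D * i + D) \<le> n" if "i < l" for i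
    using mult_le_mono2[OF Di[OF that], of 4] Dl by (rule order_trans)
  have D_diff: "D * i + D \<le> D * j" if "i < j" for i j
    using mult_le_mono2[of "Suc i" j D] that by simp
  have a_neq: "a i \<noteq> a j" if "i \<noteq> j" for i j using that D by (auto simp: a_def)
  have S_mem: "y \<in> S \<longleftrightarrow> 1 \<le> y \<and> y \<le> int r \<or> int n - int r \<le> y \<and> y < int n \<or> odd \<Delta> \<and> y = int (n div 2)" for y
    by (auto simp: S_def)
  have ints: "int r + 3 < int D" "16 * int D \<le> int n" "6 \<le> int D" "even \<Delta> \<Longrightarrow> int r \<ge> 2" "int r \<ge> 1"
    using r D \<Delta> by (auto simp: r_def)
  have ioff: "even \<Delta> \<and> int off = 2 \<or> odd \<Delta> \<and> int off = int (n div 2) \<and> int n = 2 * int (n div 2)"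
    using neven by (auto simp: off_def)
  have offb: "int off \<ge> 2" "2 * int off \<le> int n" using off2 offle by linarith+
  \<comment> \<open>The difference is D (i - j) - off modulo n. For i \<noteq> j the spacing D > r +
    3 keeps it away from the short steps and from the antipodal one, and D * l \<le> n / 4 prevents
    it from wrapping around to them.\<close>
  have key: "(int (a i) - int (b j)) mod int n \<in> S \<longleftrightarrow> i = j" if ij: "i < l" "j < l" for i j
  proof -
    define ii jj where "ii = int (D * i)" and "jj = int (D * j)"
    have diff: "int (a i) - int (b j) = ii - jj - int off" by (simp add: a_def b_def ii_def jj_def)
    have "int (4 * (D * i + D)) \<le> int n" "int (4 * (D * j + D)) \<le> int n"
      using ltDl[OF ij(1)] ltDl[OF ij(2)] by (simp_all only: of_nat_le_iff)
    then have up: "4 * ii + 4 * int D \<le> int n" "4 * jj + 4 * int D \<le> int n"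
      by (simp_all only: ii_def jj_def of_nat_mult of_nat_add of_nat_numeral distrib_left)
    have lo: "ii \<ge> 0" "jj \<ge> 0" by (simp_all add: ii_def jj_def)
    have gt: "i < j \<Longrightarrow> ii + int D \<le> jj" "j < i \<Longrightarrow> jj + int D \<le> ii"
      using D_diff unfolding ii_def jj_def by (metis of_nat_add of_nat_le_iff)+
    have shift: "(int (a i) - int (b j)) mod int n = ii - jj - int off + int n"
      if "ii - jj - int off < 0" "ii - jj - int off + int n \<ge> 0"
    proof -
      have "(int (a i) - int (b j)) mod int n = (ii - jj - int off + int n) mod int n" by (simp add: diff)
      also have "\<dots> = ii - jj - int off + int n" using that by (intro mod_pos_pos_trivial) auto
      finally show ?thesis .
    qed
    consider "i = j" | "i < j" | "j < i" by linarith
    then show ?thesis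
    proof cases
      case 1
      then have e: "ii = jj" by (simp add: ii_def jj_def)
      have "(int (a i) - int (b j)) mod int n = ii - jj - int off + int n"
        by (rule shift) (use e offb in linarith)+
      also have "\<dots> \<in> S" unfolding S_mem e using ioff ints by auto
      finally show ?thesis using 1 by simp
    next
      case 2
      note g = gt(1)[OF 2]
      have m: "(int (a i) - int (b j)) mod int n = ii - jj - int off + int n"
        by (rule shift) (use g offb ints(3) up lo in linarith)+
      have "ii - jj - int off + int n \<notin> S"
      proof -
        have "ii - jj - int off + int n > int r" using g offb ints(1,3) up lo by linarith
        moreover have "ii - jj - int off + int n < int n - int r" using g offb ints(1) by linarith
        moreover have "ii - jj - int off + int n \<noteq> int (n div 2)" if "odd \<Delta>"
          using that ioff g ints(3) by linarith
        ultimately show ?thesis unfolding S_mem by auto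
      qed
      then show ?thesis using 2 m by simp
    next
      case 3
      note g = gt(2)[OF 3]
      show ?thesis
      proof (cases "even \<Delta>")
        case True
        then have o2: "int off = 2" using ioff by blast
        have "(int (a i) - int (b j)) mod int n = ii - jj - int off"
          unfolding diff by (rule mod_pos_pos_trivial) (use o2 g ints(2,3) up lo in linarith)+
        moreover have "ii - jj - int off \<notin> S"
        proof -
          have "ii - jj - int off > int r" using o2 g ints(1) by linarith
          moreover have "ii - jj - int off < int n - int r" using o2 ints(1,3) up lo by linarith
          ultimately show ?thesis using True unfolding S_mem by auto
        qed
        ultimately show ?thesis using 3 by simp
      next
        case False
        then have o2: "int off = int (n div 2)" "int n = 2 * int (n div 2)" using ioff by blast+
        have m: "(int (a i) - int (b j)) mod int n = ii - jj - int off + int n"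
          by (rule shift) (use o2 g ints(2,3) up lo in linarith)+
        have "ii - jj - int off + int n \<notin> S"
        proof -
          have "ii - jj - int off + int n > int r" using o2 g ints(1,2) by linarith
          moreover have "ii - jj - int off + int n < int n - int r" using o2 ints(1,3) up lo by linarith
          moreover have "ii - jj - int off + int n \<noteq> int (n div 2)" using o2 g ints(3) by linarith
          ultimately show ?thesis unfolding S_mem by auto
        qed
        then show ?thesis using 3 m by simp
      qed
    qed
  qed
  have A_sym: "A v u" if "A u v" for u v using circulant_sym[OF S_sym S_sub] that by (simp add: A_def)
  have A_irr: "\<not> A u u" for u using S_sub by (auto simp: A_def circulant_def)
  have inj_a: "inj_on a {..<l}" using a_neq by (auto simp: inj_on_def)
  have inj_b: "inj_on b {..<l}" using a_neq by (auto simp: inj_on_def b_def)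
  have ab: "a i \<noteq> b j" if "i < l" "j < l" for i j
  proof -
    consider "i = j" | "i < j" | "j < i" by linarith
    then show ?thesis
    proof cases
      case 3
      then show ?thesis using D_diff[OF 3] ltDl[OF that(1)] D by (auto simp: a_def b_def off_def)
    qed (use off2 D_diff in \<open>auto simp: b_def a_def dest: D_diff\<close>)
  qed
  have aV: "a i \<in> {1..n}" if "i < l" for i using ltDl[OF that] D by (auto simp: a_def)
  have bV: "b i \<in> {1..n}" if "i < l" for i using ltDl[OF that] D offle by (auto simp: a_def b_def)
  have Aab: "A (a i) (b j) \<longleftrightarrow> i = j" if "i < l" "j < l" for i j
    using key[OF that] by (simp add: A_def circulant_def)
  interpret switchable_matching A n l a b
    by unfold_locales (use A_sym A_irr inj_a inj_b ab aV bV Aab in blast)+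
  define X where "X = {\<tau>. \<tau> permutes {..<l}}"
  \<comment> \<open>Path edges have length 1 and removed edges length \<open>off \<ge> 2\<close>, so
    the path survives every switching.\<close>
  have path: "switched A l a b \<tau> s (Suc s)" for \<tau> s
  proof -
    have "(int s - int (Suc s)) mod int n = int n - 1" using D by (simp add: zmod_minus1)
    then have "A s (Suc s)" using r by (auto simp: A_def circulant_def S_def)
    moreover have "{s, Suc s} \<noteq> {a i, b i}" for i using off2 by (auto simp: doubleton_eq_iff b_def)
    ultimately show ?thesis by (simp add: switched_def)
  qed
  have "fact n * card X \<le> card (connected_regular_graphs n \<Delta>) * (n * \<Delta> ^ (n - 1))"
  proof (rule card_relabelled_hamiltonian[where A = "switched A l a b"])
    show "n \<ge> 1" using D by simp
    show "switched A l a b \<tau> v u" if "switched A l a b \<tau> u v" for \<tau> u v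
      using switched_sym that by blast
    show "\<not> switched A l a b \<tau> u u" if "\<tau> \<in> X" for \<tau> u
      using switched_irrefl that by (simp add: X_def)
    show "card {v \<in> {1..n}. switched A l a b \<tau> u v} = \<Delta>" if "\<tau> \<in> X" "u \<in> {1..n}" for \<tau> u
      using switched_degree that circulant_degree[OF S_sub] cardS by (simp add: X_def A_def)
    show "switched A l a b \<tau> s (Suc s)" for \<tau> s by (rule path)
    fix \<tau> \<tau>' assume X: "\<tau> \<in> X" "\<tau>' \<in> X"
      and eq: "\<And>u v. u \<in> {1..n} \<Longrightarrow> v \<in> {1..n} \<Longrightarrow> switched A l a b \<tau> u v \<longleftrightarrow> switched A l a b \<tau>' u v"
    show "\<tau> = \<tau>'"
    proof
      fix i
      show "\<tau> i = \<tau>' i"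
      proof (cases "i < l")
        case True
        have "\<tau> i < l" using X(1) True permutes_in_image[of \<tau> "{..<l}" i] by (simp add: X_def)
        then show ?thesis
          using switched_between[of \<tau> i "\<tau> i"] switched_between[of \<tau>' i "\<tau> i"]
            eq[OF aV[OF True] bV[of "\<tau> i"]] X True by (simp add: X_def)
      next
        case False
        then show ?thesis
          using X permutes_not_in[of \<tau> "{..<l}" i] permutes_not_in[of \<tau>' "{..<l}" i] by (simp add: X_def)
      qed
    qed
  qed
  moreover have "card X = fact l" unfolding X_def using card_permutations[of "{..<l}" l] by simp
  ultimately show ?thesis by (simp add: l_def D_def)
qed

section \<open>Comparison of the counts\<close>

lemma exp_ge_power_over_fact:
  fixes x :: real
  assumes "x \<ge> 0"
  shows "x ^ n / fact n \<le> exp x"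
proof -
  have "(\<Sum>k\<in>{n}. x ^ k /\<^sub>R fact k) \<le> (\<Sum>k. x ^ k /\<^sub>R fact k)"
    using assms by (intro sum_le_suminf summable_exp_generic) auto
  then show ?thesis by (simp add: exp_def divide_inverse mult.commute)
qed

text \<open>A crude Stirling bound from a single term of the exponential series at n.\<close>

lemma fact_ge_exp:
  assumes "n \<ge> 1"
  shows "exp (real n * ln (real n) - real n) \<le> fact n"
proof -
  have "real n ^ n \<le> exp (real n) * fact n"
    using exp_ge_power_over_fact[of "real n" n] by (simp add: divide_le_eq)
  moreover have "real n ^ n = exp (real n * ln (real n))"
    using assms by (simp add: exp_of_nat_mult)
  ultimately show ?thesis by (simp add: exp_diff divide_le_eq mult.commute)
qed

text \<open>With W = 4 (\<Delta> + 3) and l = n div W, rounding gives l \<ge> n / (2 W), and ln l -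
  1 \<ge> ln n / 2 for large n; so l! contributes n powr (\<theta> n) with \<theta> = 1 / (4 W). A
  quarter of \<theta> pays for all factors exp (O(n)).\<close>

lemma connected_regular_graphs_many:
  assumes \<Delta>: "\<Delta> \<ge> 3"
  defines "\<theta> \<equiv> 1 / (16 * (real \<Delta> + 3))"
  obtains n0 where "\<And>n. n \<ge> n0 \<Longrightarrow> even (\<Delta> * n) \<Longrightarrow>
    exp ((1 + 3 * \<theta> / 4) * real n * ln (real n)) \<le> card (connected_regular_graphs n \<Delta>)"
proof -
  define W where "W = 4 * (\<Delta> + 3)"
  have \<theta>W: "\<theta> = 1 / (4 * real W)" by (simp add: \<theta>_def W_def)
  have W: "W \<ge> 24" using \<Delta> by (simp add: W_def)
  have \<theta>: "\<theta> > 0" using W by (simp add: \<theta>W)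
  obtain n1 where n1: "\<And>n. n \<ge> n1 \<Longrightarrow> ln (real n) \<ge> max (2 * ln (2 * real W) + 2) ((3 + ln \<Delta>) * 4 / \<theta>)"
    using eventually_ln_ge by blast
  have "exp ((1 + 3 * \<theta> / 4) * real n * ln (real n)) \<le> card (connected_regular_graphs n \<Delta>)"
    if n: "n \<ge> max (4 * W) n1" and ev: "even (\<Delta> * n)" for n
  proof -
    define c where "c = card (connected_regular_graphs n \<Delta>)"
    define L where "L = ln (real n)"
    have L: "L \<ge> 2 * ln (2 * real W) + 2" "L \<ge> (3 + ln \<Delta>) * 4 / \<theta>" using n1[of n] n by (auto simp: L_def)
    have "ln (2 * real W) \<ge> 0" using W by simp
    then have L2: "L \<ge> 2" using L(1) by linarith
    have n0: "n \<ge> 1" using n W by simp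
    define l where "l = n div W"
    have lge: "real l \<ge> real n / (2 * real W)"
    proof -
      have "n < W * l + W" using W dividend_less_times_div[of W n] by (simp add: l_def mult.commute)
      then have "real n \<le> real W * real l + real W" by (metis less_imp_le of_nat_add of_nat_le_iff of_nat_mult)
      moreover have "2 * real W \<le> real n" using n by simp
      ultimately have "real n \<le> 2 * (real W * real l)" by linarith
      then show ?thesis using W by (simp add: divide_le_eq mult_ac)
    qed
    have l1: "l \<ge> 1" unfolding l_def using n W by (simp add: div_greater_zero_iff Suc_le_eq)
    have lnl: "ln (real l) \<ge> L / 2 + 1"
    proof -
      have "ln (real n / (2 * real W)) \<le> ln (real l)" using lge n0 W l1 by (intro ln_mono) auto
      moreover have "ln (real n / (2 * real W)) = L - ln (2 * real W)"
        using n0 W by (simp add: ln_div L_def)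
      ultimately show ?thesis using L(1) by linarith
    qed
    have "real l * ln (real l) - real l = real l * (ln (real l) - 1)" by (simp add: right_diff_distrib)
    moreover have "real n / (2 * real W) * (L / 2) \<le> real l * (ln (real l) - 1)"
      using lge lnl L2 by (intro mult_mono) auto
    moreover have "real n / (2 * real W) * (L / 2) = \<theta> * (real n * L)" by (simp add: \<theta>W)
    ultimately have fl: "exp (\<theta> * (real n * L)) \<le> fact l"
      using fact_ge_exp[OF l1] by (smt (verit) exp_le_cancel_iff)
    have "fact n * fact l \<le> c * (n * \<Delta> ^ (n - 1))"
      using connected_regular_graphs_lower_bound[OF \<Delta> ev] n unfolding c_def l_def W_def by simp
    then have "(fact n * fact l :: real) \<le> real c * (real n * real \<Delta> ^ (n - 1))"
      by (metis of_nat_fact of_nat_le_iff of_nat_mult of_nat_power)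
    moreover have "exp (real n * L - real n) * exp (\<theta> * (real n * L)) \<le> fact n * fact l"
      using fact_ge_exp[OF n0] fl by (intro mult_mono) (auto simp: L_def)
    moreover have "real n * real \<Delta> ^ (n - 1) \<le> exp (real n) * exp (real n * ln \<Delta>)"
    proof (rule mult_mono)
      show "real n \<le> exp (real n)" using exp_ge_add_one_self[of "real n"] by linarith
      have "real \<Delta> ^ (n - 1) \<le> real \<Delta> ^ n" using \<Delta> by (intro power_increasing) auto
      also have "\<dots> = exp (real n * ln \<Delta>)" using \<Delta> by (simp add: exp_of_nat_mult)
      finally show "real \<Delta> ^ (n - 1) \<le> exp (real n * ln \<Delta>)" .
    qed auto
    then have "real c * (real n * real \<Delta> ^ (n - 1)) \<le> real c * (exp (real n) * exp (real n * ln \<Delta>))"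
      by (intro mult_left_mono) auto
    ultimately have "exp (real n * L - real n) * exp (\<theta> * (real n * L)) \<le> real c * (exp (real n) * exp (real n * ln \<Delta>))"
      by linarith
    moreover have "exp (real n * L - real n + \<theta> * (real n * L) - real n - real n * ln \<Delta>) * (exp (real n) * exp (real n * ln \<Delta>)) =
        exp (real n * L - real n) * exp (\<theta> * (real n * L))"
      by (simp flip: exp_add)
    ultimately have "exp (real n * L - real n + \<theta> * (real n * L) - real n - real n * ln \<Delta>) \<le> real c"
      by (metis exp_gt_zero mult_le_cancel_right_pos mult_pos_pos)
    moreover have "(1 + 3 * \<theta> / 4) * real n * L \<le> real n * L - real n + \<theta> * (real n * L) - real n - real n * ln \<Delta>"
    proof -
      have "3 + ln \<Delta> \<le> \<theta> * L / 4" using L(2) \<theta> by (simp add: divide_le_eq mult_ac)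
      then have "real n * (2 + ln \<Delta>) \<le> real n * (\<theta> * L / 4)" by (intro mult_left_mono) auto
      then show ?thesis by (simp add: algebra_simps)
    qed
    ultimately show ?thesis unfolding c_def[symmetric] L_def[symmetric] by (meson exp_le_cancel_iff order_trans)
  qed
  then show ?thesis using that by blast
qed

text \<open>In dimension at most c k each packing bound is at most n powr \<epsilon>, so apart from
  the n ^ n parent maps everything costs n powr (O(\<epsilon>) n) or exp (O(n)).\<close>

lemma card_embeddable_graphs_small:
  fixes \<beta> \<theta> C0 :: real
  assumes \<Delta>: "\<Delta> \<ge> 3" and \<beta>: "\<beta> > 0" and \<theta>: "0 < \<theta>" "\<theta> \<le> 1" and C0: "C0 > 0"
  obtains c n0 where "c > 0" "\<And>n \<alpha> k. n \<ge> n0 \<Longrightarrow> \<beta> * ln (real n) \<le> \<alpha> \<Longrightarrow> \<alpha> \<le> real n \<Longrightarrow>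
     k \<le> C0 * (ln (real n) / ln (1 + \<alpha> / ln (real n))) \<Longrightarrow>
     card (embeddable_graphs n \<Delta> (c * k) \<alpha>) \<le> exp ((1 + \<theta> / 2) * real n * ln (real n))"
proof -
  have ln\<Delta>: "ln \<Delta> \<ge> 1"
  proof -
    have "exp 1 \<le> real \<Delta>" using exp_le \<Delta> by linarith
    then show ?thesis using \<Delta> by (subst ln_ge_iff) auto
  qed
  \<comment> \<open>The terms with \<epsilon> add up to \<epsilon> (1 + 2 \<Delta>) \<le> 3 \<theta>
    / 16: one from the net indices, two for each of the \<Delta> neighbours. The remaining 5
    \<theta> / 16 of \<theta> / 2 absorb the terms linear in n.\<close>
  define \<epsilon> where "\<epsilon> = \<theta> / (16 * \<Delta>)"
  \<comment> \<open>Makes \<open>\<Delta> ^ l\<close> about n powr \<epsilon> for the hop radius l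
    of about \<delta> ln n.\<close>
  define \<delta> where "\<delta> = \<epsilon> / ln \<Delta>"
  \<comment> \<open>The packing bases are at most 66 + 8 \<alpha> / l, where 66 = 26 + 40, and
    \<alpha> / l \<le> A / \<delta>; so M (1 + A) dominates them all.\<close>
  define M where "M = 66 + 8 / \<delta>"
  \<comment> \<open>Since A \<ge> \<beta>, this gives ln (M (1 + A)) \<le> \<Gamma> ln (1 + A), and
    c below then makes m ln (M (1 + A)) \<le> \<epsilon> ln n for m \<le> c k.\<close>
  define \<Gamma> where "\<Gamma> = ln M / ln (1 + \<beta>) + 1"
  define c where "c = \<epsilon> / (C0 * \<Gamma>)"
  have \<epsilon>: "\<epsilon> > 0" using \<theta> \<Delta> by (simp add: \<epsilon>_def)
  have \<epsilon>8: "\<epsilon> \<le> 1 / 8"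
    unfolding \<epsilon>_def using \<theta> \<Delta> by (simp add: divide_le_eq)
  have \<delta>: "\<delta> > 0" using \<epsilon> ln\<Delta> by (simp add: \<delta>_def)
  have \<delta>1: "\<delta> \<le> 1" using \<epsilon>8 ln\<Delta> by (simp add: \<delta>_def divide_le_eq)
  have M: "M \<ge> 66" "M \<ge> 8 / \<delta>" using \<delta> by (auto simp: M_def)
  have lnb: "ln (1 + \<beta>) > 0" using \<beta> by simp
  have lnM: "ln M \<ge> 0" using M by simp
  have \<Gamma>: "\<Gamma> \<ge> 1" using lnb lnM by (simp add: \<Gamma>_def)
  have c: "c > 0" using \<epsilon> C0 \<Gamma> by (simp add: c_def)
  \<comment> \<open>The coefficient of n in the final exponent: 1 from the net indices, 1 from the
    table, the rest from the neighbourhoods.\<close>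
  define c1 where "c1 = 2 + \<Delta> + 2 * \<Delta> * ln \<Delta>"
  obtain n1 where n1: "\<And>n. n \<ge> n1 \<Longrightarrow> ln (real n) \<ge> max 92 (16 * c1 / (5 * \<theta>))"
    using eventually_ln_ge by blast
  have "card (embeddable_graphs n \<Delta> (c * k) \<alpha>) \<le> exp ((1 + \<theta> / 2) * real n * ln (real n))"
    if n: "n \<ge> max 6 n1" and \<alpha>: "\<beta> * ln (real n) \<le> \<alpha>" "\<alpha> \<le> real n"
      and k: "k \<le> C0 * (ln (real n) / ln (1 + \<alpha> / ln (real n)))" for n \<alpha> k
  proof -
    define L where "L = ln (real n)"
    have L: "L \<ge> 92" "L \<ge> 16 * c1 / (5 * \<theta>)" using n1[of n] n by (auto simp: L_def)
    have expL: "exp L = real n" using n by (simp add: L_def)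
    have Ln: "L \<le> real n - 1" using n unfolding L_def by (intro ln_le_minus_one) auto
    define A where "A = \<alpha> / L"
    have A: "A \<ge> \<beta>" using \<alpha>(1) L by (simp add: A_def L_def le_divide_eq)
    have \<alpha>A: "\<alpha> = A * L" using L by (simp add: A_def)
    have \<alpha>0: "\<alpha> > 0" using A \<beta> L by (simp add: \<alpha>A)
    define Y where "Y = M * (1 + A)"
    have Yge: "Y \<ge> 66 + 8 / \<delta> * A"
    proof -
      have "8 / \<delta> * A \<le> M * A" using M A \<beta> by (intro mult_right_mono) auto
      then show ?thesis using M(1) by (simp add: Y_def algebra_simps)
    qed
    have Y66: "Y \<ge> 66"
    proof -
      have "0 \<le> 8 / \<delta> * A" using \<delta> A \<beta> by simp
      then show ?thesis using Yge by linarith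
    qed
    have lnA: "ln (1 + A) \<ge> ln (1 + \<beta>)" using A \<beta> by simp
    have lnY: "ln Y \<le> \<Gamma> * ln (1 + A)"
    proof -
      have "ln Y = ln M + ln (1 + A)" using M A \<beta> by (simp add: Y_def ln_mult)
      also have "ln M \<le> ln M / ln (1 + \<beta>) * ln (1 + A)"
      proof -
        have "ln M * ln (1 + \<beta>) \<le> ln M * ln (1 + A)" using lnM lnA by (intro mult_left_mono) auto
        then show ?thesis using lnb by (simp add: le_divide_eq)
      qed
      finally show ?thesis by (simp add: \<Gamma>_def algebra_simps)
    qed
    define x where "x = exp (\<epsilon> * L)"
    have x1: "x \<ge> 1" using \<epsilon> L by (simp add: x_def)
    have pow: "y ^ m \<le> x" if m: "real m \<le> c * k" and y: "0 \<le> y" "y \<le> Y" for m y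
    proof -
      have "real m * ln Y \<le> (c * (C0 * (L / ln (1 + A)))) * (\<Gamma> * ln (1 + A))"
      proof (rule mult_mono)
        have "c * k \<le> c * (C0 * (L / ln (1 + A)))"
          unfolding A_def L_def by (rule mult_left_mono[OF k]) (use c in simp)
        then show "real m \<le> c * (C0 * (L / ln (1 + A)))" using m by linarith
        show "0 \<le> c * (C0 * (L / ln (1 + A)))" using c C0 L lnA lnb by simp
        show "0 \<le> ln Y" using Y66 by simp
      qed (rule lnY)
      also have "\<dots> = \<epsilon> * L" using C0 \<Gamma> lnA lnb by (simp add: c_def)
      finally have "exp (real m * ln Y) \<le> x" by (simp add: x_def)
      moreover have "Y ^ m = exp (real m * ln Y)" using Y66 by (simp add: exp_of_nat_mult)
      moreover have "y ^ m \<le> Y ^ m" using y by (rule power_mono[rotated])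
      ultimately show ?thesis by linarith
    qed
    define l where "l = nat \<lceil>\<delta> * L\<rceil>"
    have \<delta>L: "\<delta> * L > 0" using \<delta> L by simp
    have l1: "l \<ge> 1" using \<delta>L unfolding l_def by linarith
    have lge: "real l \<ge> \<delta> * L" unfolding l_def by linarith
    have lle: "real l \<le> \<delta> * L + 1"
    proof -
      have "real l = of_int \<lceil>\<delta> * L\<rceil>" using \<delta>L by (simp add: l_def)
      then show ?thesis by linarith
    qed
    have \<alpha>l: "\<alpha> / l \<le> A / \<delta>"
    proof -
      have "\<alpha> / l \<le> \<alpha> / (\<delta> * L)" using lge \<delta>L \<alpha>0 by (intro divide_left_mono) auto
      also have "\<dots> = A / \<delta>" using L \<delta> by (simp add: A_def)
      finally show ?thesis .
    qed
    have l0: "real l \<noteq> 0" "1 / real l \<le> 1" using l1 by auto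
    define K where "K = nat \<lceil>x\<rceil>"
    define B where "B = nat \<lceil>real n * (\<alpha> + l) + 1\<rceil>"
    define D where "D = nat \<lceil>x * real \<Delta> ^ Suc l\<rceil>"
    have Kge: "x \<le> real K" and Bge: "real n * (\<alpha> + l) + 1 \<le> real B" and Dge: "x * real \<Delta> ^ Suc l \<le> real D"
      unfolding K_def B_def D_def by (rule real_nat_ceiling_ge)+
    have ceil: "real (nat \<lceil>z\<rceil>) \<le> 2 * z" if "z \<ge> 1" for z :: real
    proof -
      have "real (nat \<lceil>z\<rceil>) = of_int \<lceil>z\<rceil>" using that by simp
      then show ?thesis using that by linarith
    qed
    have e2: "2 \<le> exp (1::real)" using exp_ge_add_one_self[of 1] by simp
    have Kle: "real K \<le> exp (1 + \<epsilon> * L)"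
    proof -
      have "real K \<le> 2 * x" unfolding K_def using x1 by (rule ceil)
      also have "\<dots> \<le> exp 1 * x" using e2 x1 by (intro mult_right_mono) auto
      finally show ?thesis by (simp add: exp_add x_def)
    qed
    have Dle: "real D \<le> exp (1 + 2 * \<epsilon> * L + 2 * ln \<Delta>)"
    proof -
      have "1 * 1 \<le> x * real \<Delta> ^ Suc l" using x1 \<Delta> by (intro mult_mono one_le_power) auto
      then have "real D \<le> 2 * (x * real \<Delta> ^ Suc l)" unfolding D_def by (intro ceil) simp
      also have "\<dots> \<le> exp 1 * (x * real \<Delta> ^ Suc l)" using e2 x1 by (intro mult_right_mono) auto
      also have "real \<Delta> ^ Suc l = exp (real (Suc l) * ln \<Delta>)" using \<Delta> by (simp only: exp_of_nat_mult) simp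
      also have "exp 1 * (x * exp (real (Suc l) * ln \<Delta>)) = exp (1 + \<epsilon> * L + real (Suc l) * ln \<Delta>)"
        by (simp add: x_def exp_add mult_ac)
      also have "\<dots> \<le> exp (1 + 2 * \<epsilon> * L + 2 * ln \<Delta>)"
      proof -
        have "real (Suc l) * ln \<Delta> \<le> (\<delta> * L + 2) * ln \<Delta>" using lle ln\<Delta> by (intro mult_right_mono) auto
        also have "\<dots> = \<epsilon> * L + 2 * ln \<Delta>" using ln\<Delta> by (simp add: \<delta>_def algebra_simps)
        finally show ?thesis unfolding exp_le_cancel_iff by linarith
      qed
      finally show ?thesis .
    qed
    have ln_le: "real l \<le> real n"
    proof -
      have "\<delta> * L \<le> 1 * L" using \<delta>1 L by (intro mult_right_mono) auto
      then show ?thesis using lle Ln by linarith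
    qed
    have Ble: "real (2 * B + 1) \<le> exp (3 * L)"
    proof -
      have "real n * (\<alpha> + l) \<le> real n * (2 * real n)" using \<alpha>(2) ln_le by (intro mult_left_mono) auto
      moreover have "real n * (\<alpha> + l) \<ge> 0" using \<alpha>0 by simp
      then have "real B = of_int \<lceil>real n * (\<alpha> + l) + 1\<rceil>" by (simp add: B_def)
      then have "real B \<le> real n * (\<alpha> + l) + 2" by linarith
      ultimately have "real (2 * B + 1) \<le> 4 * real n ^ 2 + 5" by (simp add: power2_eq_square)
      also have "\<dots> \<le> 6 * real n ^ 2"
      proof -
        have "6 ^ 2 \<le> real n ^ 2" using n by (intro power_mono) auto
        then show ?thesis by simp
      qed
      also have "\<dots> \<le> real n * real n ^ 2" using n by (intro mult_right_mono) auto
      also have "\<dots> = exp (3 * L)" by (simp add: expL[symmetric] power2_eq_square flip: exp_add)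
      finally show ?thesis .
    qed
    have card: "real (card (embeddable_graphs n \<Delta> (c * k) \<alpha>)) \<le>
       real (n ^ n * K ^ n * (2 * B + 1) ^ (K * K) * (D ^ \<Delta>) ^ n)"
    proof (rule of_nat_mono, rule card_embeddable_graphs_le[OF _ _ \<alpha>0 l1 _ _ Bge])
      fix m assume m: "real m \<le> c * k"
      have "(18::real) ^ m \<le> x" using Y66 by (intro pow[OF m]) auto
      then show "18 ^ m \<le> real K" using Kge by linarith
      have "2 + 4 * (\<alpha> + l) / l = 6 + 4 * (\<alpha> / l)" using l0 by (simp add: field_simps)
      also have "\<dots> \<le> Y"
      proof -
        have "A / \<delta> \<ge> 0" using \<delta> A \<beta> by simp
        moreover have "8 / \<delta> * A = 8 * (A / \<delta>)" by simp
        ultimately show ?thesis using \<alpha>l Yge by linarith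
      qed
      finally have "(2 + 4 * (\<alpha> + l) / l) ^ m \<le> x" using \<alpha>0 by (intro pow[OF m]) auto
      then show "(2 + 4 * (\<alpha> + l) / l) ^ m \<le> real K" using Kge by linarith
      have "2 + 4 * (2 * \<alpha> + 6 * real l + 10) / real l = 26 + 8 * (\<alpha> / l) + 40 * (1 / real l)"
        using l0 by (simp add: field_simps)
      also have "\<dots> \<le> 66 + 8 * (A / \<delta>)" using \<alpha>l l0 by linarith
      also have "\<dots> \<le> Y" using Yge by simp
      finally have "(2 + 4 * (2 * \<alpha> + 6 * real l + 10) / real l) ^ m \<le> x" using \<alpha>0 by (intro pow[OF m]) auto
      then have "(2 + 4 * (2 * \<alpha> + 6 * real l + 10) / real l) ^ m * real \<Delta> ^ Suc l \<le> x * real \<Delta> ^ Suc l"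
        by (intro mult_right_mono) auto
      then show "(2 + 4 * (2 * \<alpha> + 6 * real l + 10) / real l) ^ m * real \<Delta> ^ Suc l \<le> real D"
        using Dge by linarith
    qed (use \<Delta> n in auto)
    have f1: "real n ^ n = exp (real n * L)" using n by (simp add: exp_of_nat_mult L_def)
    have f2: "real K ^ n \<le> exp (real n * (1 + \<epsilon> * L))"
      using power_mono[OF Kle, of n] by (simp add: exp_of_nat_mult)
    \<comment> \<open>Since \<epsilon> \<le> 1 / 8, the table has O(n powr (1 / 4)) entries, each
      with at most n ^ 3 values; its cost exp n is negligible beside n ^ n.\<close>
    have f3: "real (2 * B + 1) ^ (K * K) \<le> exp (real n)"
    proof -
      have "real (2 * B + 1) ^ (K * K) \<le> exp (3 * L) ^ (K * K)" by (rule power_mono[OF Ble]) simp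
      also have "\<dots> = exp (real (K * K) * (3 * L))" by (simp only: exp_of_nat_mult)
      also have "real (K * K) * (3 * L) \<le> real n"
      proof -
        have "real K \<le> 2 * x" unfolding K_def using x1 by (rule ceil)
        then have "real K * real K \<le> (2 * x) * (2 * x)" by (intro mult_mono) auto
        also have "\<dots> = 4 * exp (2 * \<epsilon> * L)" by (simp add: x_def flip: exp_add)
        also have "\<dots> \<le> 4 * exp (L / 4)" using \<epsilon>8 L by simp
        finally have KK: "real (K * K) \<le> 4 * exp (L / 4)" by simp
        have "3 * L \<le> 3 * (2 * exp (L / 2))" using exp_ge_add_one_self[of "L / 2"] by linarith
        then have "real (K * K) * (3 * L) \<le> 4 * exp (L / 4) * (3 * (2 * exp (L / 2)))"
          using KK L(1) by (intro mult_mono) auto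
        also have "\<dots> = 24 * exp (L * 3 / 4)" by (simp add: algebra_simps flip: exp_add)
        also have "\<dots> \<le> exp (L / 4) * exp (L * 3 / 4)"
        proof (rule mult_right_mono)
          show "24 \<le> exp (L / 4)" using exp_ge_add_one_self[of "L / 4"] L(1) by linarith
        qed simp
        also have "\<dots> = real n" by (simp add: expL flip: exp_add)
        finally show ?thesis .
      qed
      finally show ?thesis by simp
    qed
    have f4: "(real D ^ \<Delta>) ^ n \<le> exp (real n * (\<Delta> * (1 + 2 * \<epsilon> * L + 2 * ln \<Delta>)))"
    proof -
      have "(real D ^ \<Delta>) ^ n \<le> (exp (1 + 2 * \<epsilon> * L + 2 * ln \<Delta>) ^ \<Delta>) ^ n"
        using Dle by (intro power_mono) auto
      then show ?thesis by (simp only: exp_of_nat_mult)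
    qed
    have "real (n ^ n * K ^ n * (2 * B + 1) ^ (K * K) * (D ^ \<Delta>) ^ n) =
       real n ^ n * real K ^ n * real (2 * B + 1) ^ (K * K) * (real D ^ \<Delta>) ^ n"
      by (simp only: of_nat_mult of_nat_power)
    also have "\<dots> \<le> exp (real n * L) * exp (real n * (1 + \<epsilon> * L)) * exp (real n) *
        exp (real n * (\<Delta> * (1 + 2 * \<epsilon> * L + 2 * ln \<Delta>)))"
      unfolding f1 using f2 f3 f4 by (intro mult_mono) auto
    also have "\<dots> = exp (real n * L + real n * (1 + \<epsilon> * L) + real n +
        real n * (\<Delta> * (1 + 2 * \<epsilon> * L + 2 * ln \<Delta>)))" by (simp only: exp_add)
    also have "\<dots> \<le> exp ((1 + \<theta> / 2) * real n * L)"
    proof -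
      have "\<epsilon> * (1 + 2 * \<Delta>) \<le> \<epsilon> * (3 * \<Delta>)" using \<epsilon> \<Delta> by (intro mult_left_mono) auto
      also have "\<dots> = 3 * \<theta> / 16" using \<Delta> by (simp add: \<epsilon>_def)
      finally have "\<epsilon> * (1 + 2 * \<Delta>) * L \<le> 3 * \<theta> / 16 * L" using L by (intro mult_right_mono) auto
      moreover have "c1 \<le> 5 * \<theta> / 16 * L" using L(2) \<theta> by (simp add: divide_le_eq mult_ac)
      ultimately have "c1 + \<epsilon> * (1 + 2 * \<Delta>) * L \<le> \<theta> / 2 * L" by (simp add: algebra_simps)
      then have "real n * (c1 + \<epsilon> * (1 + 2 * \<Delta>) * L) \<le> real n * (\<theta> / 2 * L)" by (intro mult_left_mono) auto
      then show ?thesis by (simp add: c1_def algebra_simps)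
    qed
    finally show ?thesis using card by (simp add: L_def)
  qed
  then show ?thesis using that c by blast
qed

section \<open>Probabilities as quotients of counts\<close>

lemma cond_pmf_of_set_eq:
  assumes "finite A" "A \<inter> B \<noteq> {}"
  shows "cond_pmf (pmf_of_set A) B = pmf_of_set (A \<inter> B)"
proof (rule pmf_eqI)
  fix x
  have A: "A \<noteq> {}" using assms(2) by blast
  have "set_pmf (pmf_of_set A) \<inter> B \<noteq> {}" using assms A by simp
  then have "pmf (cond_pmf (pmf_of_set A) B) x =
      (if x \<in> B then pmf (pmf_of_set A) x / measure (measure_pmf (pmf_of_set A)) B else 0)"
    by (rule pmf_cond)
  also have "\<dots> = pmf (pmf_of_set (A \<inter> B)) x"
    using assms A by (auto simp: measure_pmf_of_set indicator_def)
  finally show "pmf (cond_pmf (pmf_of_set A) B) x = pmf (pmf_of_set (A \<inter> B)) x" .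
qed

lemma random_connected_regular_graph_prob:
  assumes "connected_regular_graphs n \<Delta> \<noteq> {}"
  shows "measure_pmf.prob (random_connected_regular_graph n \<Delta>) X =
    card {E \<in> regular_graphs n \<Delta>. connected_graph n E \<and> E \<in> X} / card (connected_regular_graphs n \<Delta>)"
proof -
  have eq: "regular_graphs n \<Delta> \<inter> {E. connected_graph n E} = connected_regular_graphs n \<Delta>" by auto
  have fin: "finite (connected_regular_graphs n \<Delta>)" using finite_regular_graphs by simp
  have "connected_regular_graphs n \<Delta> \<inter> X = {E \<in> regular_graphs n \<Delta>. connected_graph n E \<and> E \<in> X}" by auto
  moreover have "random_connected_regular_graph n \<Delta> = pmf_of_set (connected_regular_graphs n \<Delta>)"
    unfolding random_connected_regular_graph_def
    using cond_pmf_of_set_eq[OF finite_regular_graphs, of n \<Delta> "{E. connected_graph n E}"] assms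
    unfolding eq by blast
  ultimately show ?thesis by (simp only: measure_pmf_of_set[OF assms fin])
qed

theorem theorem1p4:
  fixes \<beta> :: real and \<Delta> :: nat
  assumes "\<beta> > 0" and "\<Delta> \<ge> 3"
  shows "\<exists>c C c' :: real. \<exists>n\<^sub>0 :: nat. c > 0 \<and> C > 0 \<and> c' > 0 \<and>
    (\<forall>n \<ge> n\<^sub>0. \<forall>\<alpha> :: real.
       even (\<Delta> * n) \<and> \<beta> * ln (real n) \<le> \<alpha> \<and> \<alpha> \<le> real n \<longrightarrow>
       (let k = real (dim_red_modulus TYPE(linf) n \<alpha>);
            G = random_connected_regular_graph n \<Delta>
        in measure_pmf.prob G
             {E. embeds_in_dimension_at_most {1..n} (graph_dist E) (c * k) \<alpha>}
             \<le> exp (- c' * real n * ln (real n)) \<and>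
           measure_pmf.prob G
             {E. embeds_in_dimension_at_most {1..n} (graph_dist E) (C * k) \<alpha>} = 1))"
proof -
  define \<theta> where "\<theta> = 1 / (16 * (real \<Delta> + 3))"
  have \<theta>: "0 < \<theta>" "\<theta> \<le> 1" by (simp_all add: \<theta>_def add_nonneg_pos)
  obtain C0 n1 where C0: "C0 > 0" and k: "\<And>n \<alpha>. n \<ge> n1 \<Longrightarrow> \<beta> * ln (real n) \<le> \<alpha> \<Longrightarrow> \<alpha> \<le> real n \<Longrightarrow>
     real (dim_red_modulus TYPE(linf) n \<alpha>) \<le> C0 * (ln (real n) / ln (1 + \<alpha> / ln (real n)))"
    using dim_red_modulus_upper_bound[OF assms(1)] by blast
  obtain c n2 where c: "c > 0" and few: "\<And>n \<alpha> k. n \<ge> n2 \<Longrightarrow> \<beta> * ln (real n) \<le> \<alpha> \<Longrightarrow> \<alpha> \<le> real n \<Longrightarrow>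
     k \<le> C0 * (ln (real n) / ln (1 + \<alpha> / ln (real n))) \<Longrightarrow>
     card (embeddable_graphs n \<Delta> (c * k) \<alpha>) \<le> exp ((1 + \<theta> / 2) * real n * ln (real n))"
    using card_embeddable_graphs_small[OF assms(2,1) \<theta> C0] by blast
  obtain n3 where many: "\<And>n. n \<ge> n3 \<Longrightarrow> even (\<Delta> * n) \<Longrightarrow>
    exp ((1 + 3 * \<theta> / 4) * real n * ln (real n)) \<le> card (connected_regular_graphs n \<Delta>)"
    using connected_regular_graphs_many[OF assms(2)] unfolding \<theta>_def by blast
  obtain n4 where n4: "\<And>n. n \<ge> n4 \<Longrightarrow> ln (real n) \<ge> 256 / \<beta>" using eventually_ln_ge by blast
  define n0 where "n0 = Max {1, n1, n2, n3, n4}"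
  have main: "measure_pmf.prob (random_connected_regular_graph n \<Delta>)
         {E. embeds_in_dimension_at_most {1..n} (graph_dist E) (c * real (dim_red_modulus TYPE(linf) n \<alpha>)) \<alpha>}
         \<le> exp (- (\<theta> / 4) * real n * ln (real n)) \<and>
       measure_pmf.prob (random_connected_regular_graph n \<Delta>)
         {E. embeds_in_dimension_at_most {1..n} (graph_dist E) (1 * real (dim_red_modulus TYPE(linf) n \<alpha>)) \<alpha>} = 1"
    if n: "n \<ge> n0" and ev: "even (\<Delta> * n)" and \<alpha>: "\<beta> * ln (real n) \<le> \<alpha>" "\<alpha> \<le> real n" for n \<alpha>
  proof -
    have ns: "n \<ge> 1" "n \<ge> n1" "n \<ge> n2" "n \<ge> n3" "n \<ge> n4" using n by (auto simp: n0_def)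
    let ?k = "real (dim_red_modulus TYPE(linf) n \<alpha>)"
    let ?Con = "connected_regular_graphs n \<Delta>"
    have lower: "exp ((1 + 3 * \<theta> / 4) * real n * ln (real n)) \<le> real (card ?Con)" by (rule many[OF ns(4) ev])
    then have card0: "real (card ?Con) > 0" using exp_gt_zero less_le_trans by blast
    then have ne: "?Con \<noteq> {}" by (metis card.empty less_irrefl of_nat_0)
    note prob = random_connected_regular_graph_prob[OF ne]
    have upper: "real (card (embeddable_graphs n \<Delta> (c * ?k) \<alpha>)) \<le> exp ((1 + \<theta> / 2) * real n * ln (real n))"
      by (rule few[OF ns(3) \<alpha> k[OF ns(2) \<alpha>]])
    \<comment> \<open>The exponents 1 + \<theta> / 2 and 1 + 3 \<theta> / 4 differ by \<theta> / 4,
      which becomes c'.\<close>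
    have "real (card (embeddable_graphs n \<Delta> (c * ?k) \<alpha>)) / card ?Con \<le>
        exp ((1 + \<theta> / 2) * real n * ln (real n)) / exp ((1 + 3 * \<theta> / 4) * real n * ln (real n))"
      using upper lower by (intro frac_le) auto
    also have "\<dots> = exp (- (\<theta> / 4) * real n * ln (real n))"
      by (simp add: algebra_simps flip: exp_diff)
    finally have "measure_pmf.prob (random_connected_regular_graph n \<Delta>)
         {E. embeds_in_dimension_at_most {1..n} (graph_dist E) (c * ?k) \<alpha>} \<le> exp (- (\<theta> / 4) * real n * ln (real n))"
      unfolding prob by simp
    \<comment> \<open>From 256 on the modulus is a dimension that is actually attained, so every
      connected graph is counted.\<close>
    moreover have "256 \<le> \<alpha>" using n4[OF ns(5)] assms(1) \<alpha>(1) by (simp add: divide_le_eq mult.commute)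
    then have "{E \<in> regular_graphs n \<Delta>. connected_graph n E \<and>
        E \<in> {E. embeds_in_dimension_at_most {1..n} (graph_dist E) (1 * ?k) \<alpha>}} = ?Con"
      using connected_regular_graph_embeds[OF _ _ _ ns(1)] by auto
    then have "measure_pmf.prob (random_connected_regular_graph n \<Delta>)
         {E. embeds_in_dimension_at_most {1..n} (graph_dist E) (1 * ?k) \<alpha>} = 1"
      unfolding prob using card0 by simp
    ultimately show ?thesis by blast
  qed
  show ?thesis
    unfolding Let_def using main c \<theta>(1)
    by (intro exI[of _ c] exI[of _ 1] exI[of _ "\<theta> / 4"] exI[of _ n0]) auto
qed

end
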